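(* Let $G=(V,E,m,\mu)$ be a complete graph and m is nondegenerate. Then the following are equivalent: (a) G satisfies $CD(K,\infty)$. (b) For any finitely supported function f,$$P_t(f)^2-(P_tf)^2\leqslant \frac{1-e^{-2Kt}}{K}P_t(\Gamma(f)).$$ (c) For any $f\in D(Q)$,$$P_t(f)^2-(P_tf)^2\leqslant \frac{1-e^{-2Kt}}{K}P_t(\Gamma(f)).$$
   Context: $G=(V,E,\mu,m)$ is a locally finite weighted graph (self-loops allowed) with symmetric edge weights $\mu:E\to[0,\infty)$ (extended by $\mu_{xy}=0$ if $x\nsim y$) and a vertex measure $m:V\to[0,\infty)$. The Laplacian is $\triangle f(x)=\frac{1}{m(x)}\sum_{y\in V}\mu_{xy}(f(y)-f(x))$, and $P_t=e^{t\triangle}$ is the associated heat semigroup on $l^p(V,m)$. $Q(f)=\frac12\sum_{x,y\in V}\mu_{xy}(f(y)-f(x))^2$ is the Dirichlet form with domain $D(Q)$, and $C_0(V)$ denotes the finitely supported functions. $\Gamma(f,g)=\frac12(\triangle(fg)-f\triangle g-g\triangle f)$, $\Gamma(f)=\Gamma(f,f)$, and $\Gamma_2(f)=\frac12\triangle\Gamma(f)-\Gamma(f,\triangle f)$. The graph satisfies $CD(K,\infty)$ ($K\in\mathbb{R}$) if $\Gamma_2(f)(x)\geqslant K\Gamma(f)(x)$ for all $x\in V$ and all $f$. The graph is complete if there is a nondecreasing sequence $\eta_k\in C_0(V)$ with $\lim_{k\to\infty}\eta_k=1$ and $\Gamma(\eta_k)\leqslant \frac1k$. The measure $m$ is nondegenerate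 if $\inf_{x\in V}m(x)>0$. *)

theory Defs
  imports "HOL-Analysis.Analysis"
begin

text \<open>
  The vertex set is the whole type \<open>'v\<close>, and \<open>E\<close> is the symmetric adjacency relation.
  Self-loops are allowed, and connectedness is not required.
\<close>

locale weighted_graph =
  fixes E :: "('v \<times> 'v) set" and \<mu> :: "'v \<Rightarrow> 'v \<Rightarrow> real" and m :: "'v \<Rightarrow> real"
  assumes sym_edges: "sym E"
    and weight_sym: "\<mu> x y = \<mu> y x"
    and weight_nonneg: "0 \<le> \<mu> x y"
    and weight_off_edges: "(x, y) \<notin> E \<Longrightarrow> \<mu> x y = 0"
    and measure_nonneg: "0 \<le> m x"

definition locally_finite :: "('v \<times> 'v) set \<Rightarrow> bool" where
  "locally_finite E \<longleftrightarrow> (\<forall>x. finite {y. (x, y) \<in> E})"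

definition nondegenerate :: "('v \<Rightarrow> real) \<Rightarrow> bool" where
  "nondegenerate m \<longleftrightarrow> 0 < (INF x. m x)"

definition finsupp :: "('v \<Rightarrow> real) set" where
  "finsupp = {f. finite {x. f x \<noteq> 0}}"


subsection \<open>Laplacian, iterated gradients and curvature\<close>

definition laplacian ::
  "('v \<Rightarrow> 'v \<Rightarrow> real) \<Rightarrow> ('v \<Rightarrow> real) \<Rightarrow> ('v \<Rightarrow> real) \<Rightarrow> 'v \<Rightarrow> real" where
  "laplacian \<mu> m f x = 1 / m x * (\<Sum>\<^sub>\<infinity>y. \<mu> x y * (f y - f x))"

definition grad ::
  "('v \<Rightarrow> 'v \<Rightarrow> real) \<Rightarrow> ('v \<Rightarrow> real) \<Rightarrow> ('v \<Rightarrow> real) \<Rightarrow> ('v \<Rightarrow> real) \<Rightarrow> 'v \<Rightarrow> real" where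
  "grad \<mu> m f g x =
     1 / 2 * (laplacian \<mu> m (\<lambda>z. f z * g z) x - f x * laplacian \<mu> m g x - g x * laplacian \<mu> m f x)"

definition grad2 ::
  "('v \<Rightarrow> 'v \<Rightarrow> real) \<Rightarrow> ('v \<Rightarrow> real) \<Rightarrow> ('v \<Rightarrow> real) \<Rightarrow> 'v \<Rightarrow> real" where
  "grad2 \<mu> m f x =
     1 / 2 * laplacian \<mu> m (grad \<mu> m f f) x - grad \<mu> m f (laplacian \<mu> m f) x"

definition CD_inf :: "('v \<Rightarrow> 'v \<Rightarrow> real) \<Rightarrow> ('v \<Rightarrow> real) \<Rightarrow> real \<Rightarrow> bool" where
  "CD_inf \<mu> m K \<longleftrightarrow> (\<forall>f x. grad2 \<mu> m f x \<ge> K * grad \<mu> m f f x)"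

text \<open>The bound \<open>1 / k\<close> is only imposed for \<open>k \<ge> 1\<close>, since \<open>1 / 0 = 0\<close>.\<close>

definition complete_graph :: "('v \<Rightarrow> 'v \<Rightarrow> real) \<Rightarrow> ('v \<Rightarrow> real) \<Rightarrow> bool" where
  "complete_graph \<mu> m \<longleftrightarrow>
     (\<exists>\<eta> :: nat \<Rightarrow> 'v \<Rightarrow> real.
        mono \<eta> \<and> (\<forall>k. \<eta> k \<in> finsupp) \<and> (\<forall>x. (\<lambda>k. \<eta> k x) \<longlonglongrightarrow> 1) \<and>
        (\<forall>k\<ge>1. \<forall>x. grad \<mu> m (\<eta> k) (\<eta> k) x \<le> 1 / real k))"


subsection \<open>The Hilbert space \<open>l\<^sup>2(V, m)\<close> and the Dirichlet form\<close>

definition l2 :: "('v \<Rightarrow> real) \<Rightarrow> ('v \<Rightarrow> real) set" where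
  "l2 m = {f. (\<lambda>x. m x * (f x)\<^sup>2) summable_on UNIV}"

definition l2_inner :: "('v \<Rightarrow> real) \<Rightarrow> ('v \<Rightarrow> real) \<Rightarrow> ('v \<Rightarrow> real) \<Rightarrow> real" where
  "l2_inner m f g = (\<Sum>\<^sub>\<infinity>x. m x * f x * g x)"

definition l2_norm :: "('v \<Rightarrow> real) \<Rightarrow> ('v \<Rightarrow> real) \<Rightarrow> real" where
  "l2_norm m f = sqrt (\<Sum>\<^sub>\<infinity>x. m x * (f x)\<^sup>2)"

definition dirichlet_energy :: "('v \<Rightarrow> 'v \<Rightarrow> real) \<Rightarrow> ('v \<Rightarrow> real) \<Rightarrow> ennreal" where
  "dirichlet_energy \<mu> f = (\<Sum>\<^sub>\<infinity>(x, y). ennreal (\<mu> x y * (f y - f x)\<^sup>2)) / 2"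

text \<open>
  \<open>D(Q)\<close> is the completion of the finitely supported functions under the form norm
  \<open>(\<parallel>f\<parallel>\<^sup>2 + Q(f))\<^sup>1\<^sup>/\<^sup>2\<close>, realised inside \<open>l\<^sup>2(V, m)\<close>.
\<close>

definition form_domain :: "('v \<Rightarrow> 'v \<Rightarrow> real) \<Rightarrow> ('v \<Rightarrow> real) \<Rightarrow> ('v \<Rightarrow> real) set" where
  "form_domain \<mu> m =
     {f \<in> l2 m. \<exists>g :: nat \<Rightarrow> 'v \<Rightarrow> real.
        (\<forall>n. g n \<in> finsupp) \<and>
        (\<lambda>n. l2_norm m (\<lambda>x. f x - g n x)) \<longlonglongrightarrow> 0 \<and>
        (\<lambda>n. dirichlet_energy \<mu> (\<lambda>x. f x - g n x)) \<longlonglongrightarrow> 0}"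

text \<open>The polarised form; the sum converges absolutely for \<open>f\<close> and \<open>g\<close> of finite energy.\<close>

definition dirichlet_form ::
  "('v \<Rightarrow> 'v \<Rightarrow> real) \<Rightarrow> ('v \<Rightarrow> real) \<Rightarrow> ('v \<Rightarrow> real) \<Rightarrow> real" where
  "dirichlet_form \<mu> f g = 1 / 2 * (\<Sum>\<^sub>\<infinity>(x, y). \<mu> x y * (f y - f x) * (g y - g x))"

text \<open>
  The domain of the self-adjoint operator associated with the form. Testing
  \<open>Q(f, h) = - \<langle>g, h\<rangle>\<close> against point masses \<open>h\<close> forces \<open>g = laplacian \<mu> m f\<close>, so the operator is
  the restriction of the Laplacian to this domain.
\<close>

definition laplacian_domain ::
  "('v \<Rightarrow> 'v \<Rightarrow> real) \<Rightarrow> ('v \<Rightarrow> real) \<Rightarrow> ('v \<Rightarrow> real) set" where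
  "laplacian_domain \<mu> m =
     {f \<in> form_domain \<mu> m. laplacian \<mu> m f \<in> l2 m \<and>
        (\<forall>h\<in>form_domain \<mu> m. dirichlet_form \<mu> f h = - l2_inner m (laplacian \<mu> m f) h)}"


subsection \<open>The heat semigroup\<close>

text \<open>
  Strongly continuous semigroups of bounded linear operators on \<open>l\<^sup>2(V, m)\<close>, and their
  infinitesimal generators as graphs. Nothing is said about \<open>P t f\<close> for \<open>t < 0\<close> or \<open>f \<notin> l2 m\<close>.
\<close>

definition C0_semigroup ::
  "('v \<Rightarrow> real) \<Rightarrow> (real \<Rightarrow> ('v \<Rightarrow> real) \<Rightarrow> 'v \<Rightarrow> real) \<Rightarrow> bool" where
  "C0_semigroup m P \<longleftrightarrow>
     (\<forall>t\<ge>0. \<forall>f\<in>l2 m. P t f \<in> l2 m) \<and>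
     (\<forall>t\<ge>0. \<forall>f\<in>l2 m. \<forall>g\<in>l2 m. \<forall>a b.
        P t (\<lambda>x. a * f x + b * g x) = (\<lambda>x. a * P t f x + b * P t g x)) \<and>
     (\<forall>t\<ge>0. \<exists>C. \<forall>f\<in>l2 m. l2_norm m (P t f) \<le> C * l2_norm m f) \<and>
     (\<forall>f\<in>l2 m. P 0 f = f) \<and>
     (\<forall>s\<ge>0. \<forall>t\<ge>0. \<forall>f\<in>l2 m. P (s + t) f = P s (P t f)) \<and>
     (\<forall>f\<in>l2 m. ((\<lambda>t. l2_norm m (\<lambda>x. P t f x - f x)) \<longlongrightarrow> 0) (at_right 0))"

definition generator ::
  "('v \<Rightarrow> real) \<Rightarrow> (real \<Rightarrow> ('v \<Rightarrow> real) \<Rightarrow> 'v \<Rightarrow> real) \<Rightarrow> (('v \<Rightarrow> real) \<times> ('v \<Rightarrow> real)) set" where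
  "generator m P =
     {(f, g). f \<in> l2 m \<and> g \<in> l2 m \<and>
        ((\<lambda>t. l2_norm m (\<lambda>x. (P t f x - f x) / t - g x)) \<longlongrightarrow> 0) (at_right 0)}"

text \<open>
  The semigroup \<open>exp (t \<triangle>)\<close> generated by the Laplacian of the Dirichlet form. A \<open>C\<^sub>0\<close>-semigroup
  is determined by its generator, so for \<open>m > 0\<close> the choice is unique for \<open>t \<ge> 0\<close> on \<open>l2 m\<close>.
  If \<open>m\<close> is nondegenerate then \<open>l\<^sup>1(V, m) \<subseteq> l\<^sup>2(V, m)\<close>; in particular \<open>f\<^sup>2\<close>
  and the squared gradient of \<open>f\<close> lie in \<open>l2 m\<close> for every \<open>f\<close> in the form domain.
\<close>

definition heat_semigroup ::
  "('v \<Rightarrow> 'v \<Rightarrow> real) \<Rightarrow> ('v \<Rightarrow> real) \<Rightarrow> real \<Rightarrow> ('v \<Rightarrow> real) \<Rightarrow> 'v \<Rightarrow> real" where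
  "heat_semigroup \<mu> m =
     (SOME P. C0_semigroup m P \<and>
        generator m P = {(f, laplacian \<mu> m f) | f. f \<in> laplacian_domain \<mu> m})"

text \<open>The factor \<open>(1 - exp (-2Kt)) / K\<close>, read as its limit \<open>2t\<close> when \<open>K = 0\<close>.\<close>

definition curvature_factor :: "real \<Rightarrow> real \<Rightarrow> real" where
  "curvature_factor K t = (if K = 0 then 2 * t else (1 - exp (- 2 * K * t)) / K)"

end

theory Submission
  imports Defs
begin

text \<open>
  Existence of the semigroup: the resolvent of the Dirichlet Laplacian is an orthogonal projection
  onto the graph of the discrete gradient, and the dyadic Euler products
  \<open>(1 - t A / 2\<^sup>n)\<close> to the power \<open>- 2\<^sup>n\<close> of an m-dissipative operator \<open>A\<close> converge to a contraction
  semigroup whose generator is \<open>A\<close>. On a complete graph the cutoffs \<open>\<eta>\<^sub>k f\<close> converge to \<open>f\<close>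
  in the form norm, so \<open>D(Q)\<close> consists of all functions in \<open>l\<^sup>2\<close> of finite energy.

  (a) to (b): put \<open>g = P\<^bsub>t-s\<^esub> f\<close>, \<open>k = P\<^sub>s \<delta>\<^sub>x \<ge> 0\<close>, \<open>\<phi>(s) = \<langle>g\<^sup>2, k\<rangle>\<close>
  and \<open>G(s) = \<langle>g\<^sup>2, \<triangle>k\<rangle> - 2\<langle>g \<triangle>g, k\<rangle> = 2\<langle>\<Gamma>(g), k\<rangle>\<close>. Then \<open>\<phi>' = G\<close>, and \<open>G' \<ge> 2 K G\<close> is
  the curvature condition for \<open>g\<close> tested against \<open>k\<close>. Since \<open>g\<close> and \<open>k\<close> are not finitely supported,
  this requires \<open>\<Gamma>(g) \<in> D(Q)\<close>, which follows from a Caccioppoli estimate. Integrating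
  \<open>G(s) \<le> exp (-2K(t-s)) G(t)\<close> from \<open>0\<close> to \<open>t\<close> gives (b).

  (b) to (a): at \<open>t = 0\<close> the difference of the two sides of (b) vanishes to first order, and its second
  derivative is \<open>4 (\<Gamma>\<^sub>2(f) - K \<Gamma>(f))\<close>; for general \<open>f\<close> cut off outside the ball of radius two.
  (b) to (c): both sides are continuous in the form norm.
\<close>

section \<open>Strongly continuous semigroups\<close>

text \<open>The heat semigroup is obtained by choice, and all that is known of it are the clauses of
  \<open>C0_semigroup\<close> and its generator. Symmetry and positivity are not among these; they
  are read off the generator by differentiating along orbits. The clauses bound each operator
  separately, so bounds that are uniform on time intervals have to come from the uniform boundedness
  principle. G is written through the Laplacian and products rather than through \<Gamma>(g):
  nondegeneracy makes l2 an algebra with bounded multiplication, hence G is a finite sum of bounded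
  multilinear expressions in differentiable orbits, and the product rule applies. Returning from
  such expressions to \<Gamma> is an integration by parts valid on the domain of the form. The
  factor (1 - exp (-2Kt)) / K is twice the integral of exp (-2K(t-s)) over [0,t]; the two comes from
  G(t) = 2 m(x) P_t \<Gamma>(f)(x).\<close>

lemma uniform_boundedness:
  fixes T :: "nat \<Rightarrow> 'a::banach \<Rightarrow> 'b::real_normed_vector"
  assumes bl: "\<And>i. bounded_linear (T i)"
    and pw: "\<And>x. \<exists>B. \<forall>i. norm (T i x) \<le> B"
  shows "\<exists>M. \<forall>i x. norm (T i x) \<le> M * norm x"
proof -
  define C where "C k = {x. \<forall>i. norm (T i x) \<le> real k}" for k :: nat
  have clC: "closed (C k)" for k
  proof -
    have "C k = (\<Inter>i. {x. norm (T i x) \<le> real k})" by (auto simp: C_def)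
    moreover have "closed {x. norm (T i x) \<le> real k}" for i
      by (intro closed_Collect_le continuous_intros linear_continuous_on bl)
    ultimately show ?thesis by (simp add: closed_INT)
  qed
  have un: "(\<Union>k. C k) = UNIV"
  proof -
    have "\<exists>k. x \<in> C k" for x
    proof -
      from pw obtain B where B: "\<And>i. norm (T i x) \<le> B" by blast
      obtain k :: nat where "B \<le> real k" using real_arch_simple by blast
      with B have "x \<in> C k" unfolding C_def using order_trans by blast
      then show ?thesis ..
    qed
    then show ?thesis by auto
  qed
  \<comment> \<open>Baire: countably many closed sets with empty interior cannot cover a complete
    space.\<close>
  have "\<exists>k. interior (C k) \<noteq> {}"
  proof (rule ccontr)
    assume "\<not> ?thesis"
    then have e: "interior (C k) = {}" for k by blast
    have "Met_TC.mtopology interior_of (\<Union>(range C)) = {}"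
    proof (rule Met_TC.metric_Baire_category_alt)
      show "Met_TC.mcomplete TYPE('a)"
        by (simp add: complete_UNIV)
    qed (use clC e in auto)
    then show False using un by auto
  qed
  then obtain k x0 where "x0 \<in> interior (C k)" by blast
  then obtain e where e: "e > 0" "cball x0 e \<subseteq> C k"
    unfolding mem_interior_cball by blast
  have "norm (T i x) \<le> (2 * real k / e) * norm x" for i x
  proof (cases "x = 0")
    case True
    then show ?thesis using bounded_linear.linear[OF bl] linear_0 by (metis mult_zero_right norm_zero order_refl)
  next
    case False
    \<comment> \<open>\<open>x\<close> is rescaled to length \<open>e\<close>, so that
      \<open>x0 + y\<close> stays in the ball inside \<open>C k\<close>; then \<open>T i y\<close>
      is a difference of two vectors of norm at most \<open>k\<close>.\<close>
    define y where "y = (e / norm x) *\<^sub>R x"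
    have "norm y = e" using False e by (simp add: y_def)
    then have "x0 + y \<in> C k" "x0 \<in> C k" using e by (auto simp: dist_norm subset_iff)
    then have "norm (T i (x0 + y)) \<le> k" "norm (T i x0) \<le> k" by (auto simp: C_def)
    moreover have "T i y = T i (x0 + y) - T i x0"
      by (simp add: linear_add[OF bounded_linear.linear[OF bl]])
    ultimately have "norm (T i y) \<le> 2 * real k"
      using norm_triangle_ineq4[of "T i (x0 + y)" "T i x0"] by simp
    moreover have "T i y = (e / norm x) *\<^sub>R T i x"
      by (simp add: y_def linear_scale[OF bounded_linear.linear[OF bl]])
    ultimately have "e / norm x * norm (T i x) \<le> 2 * real k" using e by simp
    then show ?thesis using False e by (simp add: field_simps)
  qed
  then show ?thesis by blast
qed

text \<open>Each operator is bounded with a constant that may depend on its time, and continuity is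
  required at time 0 only, just as in \<open>C0_semigroup\<close>. The locale serves both the
  constructed semigroup and the chosen one.\<close>

locale strongly_continuous_semigroup =
  fixes T :: "real \<Rightarrow> 'a::banach \<Rightarrow> 'a"
  assumes bounded_linear: "0 \<le> t \<Longrightarrow> bounded_linear (T t)"
    and zero [simp]: "T 0 f = f"
    and add: "0 \<le> s \<Longrightarrow> 0 \<le> t \<Longrightarrow> T (s + t) f = T s (T t f)"
    and continuous_0: "((\<lambda>t. T t f) \<longlongrightarrow> f) (at_right 0)"
begin

lemma diff: "0 \<le> t \<Longrightarrow> T t (f - g) = T t f - T t g"
  using bounded_linear linear_diff bounded_linear.linear by blast

lemma scale: "0 \<le> t \<Longrightarrow> T t (c *\<^sub>R f) = c *\<^sub>R T t f"
  using bounded_linear linear_scale bounded_linear.linear by blast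

text \<open>Otherwise there are times \<tau> n \<le> 1 / (n+1) at which the norm exceeds n. Orbits
  converge along these times, so they are bounded pointwise, and uniform boundedness is
  contradicted.\<close>

lemma bounded_near_0: "\<exists>\<delta>>0. \<exists>M. \<forall>t f. 0 \<le> t \<and> t \<le> \<delta> \<longrightarrow> norm (T t f) \<le> M * norm f"
proof (rule ccontr)
  assume neg: "\<not> ?thesis"
  have "\<exists>t. 0 \<le> t \<and> t \<le> 1 / Suc n \<and> (\<exists>f. norm (T t f) > real n * norm f)" for n
  proof -
    have "(1::real) / Suc n > 0" by simp
    then show ?thesis using neg by (meson not_le)
  qed
  then obtain \<tau> where \<tau>: "\<And>n. 0 \<le> \<tau> n" "\<And>n. \<tau> n \<le> 1 / Suc n"
    "\<And>n. \<exists>f. norm (T (\<tau> n) f) > real n * norm f" by metis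
  have lim: "\<tau> \<longlonglongrightarrow> 0"
    by (rule tendsto_sandwich[of "\<lambda>_. 0" _ _ "\<lambda>n. 1 / Suc n"])
       (use \<tau> LIMSEQ_Suc[OF lim_const_over_n[of 1]] in auto)
  have "\<exists>B. \<forall>n. norm (T (\<tau> n) f) \<le> B" for f
  proof -
    have "((\<lambda>t. T t f) \<longlongrightarrow> f) (at 0 within {0..})"
      using continuous_0 by (simp add: at_within_Ici_at_right)
    then have "continuous (at 0 within {0..}) (\<lambda>t. T t f)"
      by (simp add: continuous_within)
    then have "(\<lambda>n. T (\<tau> n) f) \<longlonglongrightarrow> T 0 f"
      using lim \<tau>(1) by (auto simp: continuous_within_sequentially o_def)
    then have "bounded (range (\<lambda>n. T (\<tau> n) f))" by (rule convergent_imp_bounded)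
    then show ?thesis by (auto simp: bounded_iff)
  qed
  then have "\<exists>M. \<forall>n f. norm (T (\<tau> n) f) \<le> M * norm f"
    using \<tau>(1) bounded_linear by (intro uniform_boundedness) auto
  then obtain M where M: "\<And>n f. norm (T (\<tau> n) f) \<le> M * norm f" by blast
  obtain n :: nat where n: "M \<le> real n" using real_arch_simple by blast
  from \<tau>(3)[of n] obtain f where f: "norm (T (\<tau> n) f) > real n * norm f" by blast
  have "M * norm f \<le> real n * norm f" using n by (simp add: mult_right_mono)
  with f M[of n f] show False by linarith
qed

lemma bounded_on_interval:
  obtains M where "0 \<le> M" "\<And>t f. 0 \<le> t \<Longrightarrow> t \<le> b \<Longrightarrow> norm (T t f) \<le> M * norm f"
proof -
  from bounded_near_0 obtain \<delta> M0 where \<delta>: "\<delta> > 0"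
    and M0: "\<And>t f. 0 \<le> t \<Longrightarrow> t \<le> \<delta> \<Longrightarrow> norm (T t f) \<le> M0 * norm f" by blast
  have step: "\<exists>M\<ge>0. \<forall>t f. 0 \<le> t \<and> t \<le> real n * \<delta> \<longrightarrow> norm (T t f) \<le> M * norm f" for n
  proof (induction n)
    case 0
    show ?case by (rule exI[of _ 1]) auto
  next
    case (Suc n)
    then obtain M where M: "M \<ge> 0" "\<And>t f. 0 \<le> t \<Longrightarrow> t \<le> real n * \<delta> \<Longrightarrow> norm (T t f) \<le> M * norm f" by blast
    have "norm (T t f) \<le> max M (\<bar>M0\<bar> * M) * norm f" if t: "0 \<le> t" "t \<le> real (Suc n) * \<delta>" for t f
    proof (cases "t \<le> real n * \<delta>")
      case True
      then have "norm (T t f) \<le> M * norm f" using M t by blast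
      also have "\<dots> \<le> max M (\<bar>M0\<bar> * M) * norm f" by (intro mult_right_mono) auto
      finally show ?thesis .
    next
      case False
      then have u: "0 \<le> t - real n * \<delta>" "t - real n * \<delta> \<le> \<delta>" using t by (auto simp: algebra_simps)
      have n0: "0 \<le> real n * \<delta>" using \<delta> by simp
      have "T t f = T (t - real n * \<delta>) (T (real n * \<delta>) f)"
        using add[OF u(1) n0, of f] by simp
      also have "norm \<dots> \<le> M0 * norm (T (real n * \<delta>) f)" using M0 u by blast
      also have "\<dots> \<le> \<bar>M0\<bar> * (M * norm f)"
        using M(2)[OF n0 order_refl, of f] M(1) by (intro mult_mono) auto
      also have "\<dots> \<le> max M (\<bar>M0\<bar> * M) * norm f"
        unfolding mult.assoc[symmetric] by (intro mult_right_mono) auto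
      finally show ?thesis .
    qed
    then show ?case using M(1) by (intro exI[of _ "max M (\<bar>M0\<bar> * M)"]) auto
  qed
  obtain n :: nat where n: "b / \<delta> \<le> real n" using real_arch_simple by blast
  then have "b \<le> real n * \<delta>" using \<delta> by (simp add: field_simps)
  with step[of n] that show ?thesis by (meson order_trans)
qed

text \<open>Factoring out the smaller time treats both sides of t at once: two-sided statements at t
  reduce to the right-hand limit at 0.\<close>

lemma orbit_diff:
  assumes "0 \<le> s" "0 \<le> t"
  shows "T s f - T t f = sgn (s - t) *\<^sub>R T (min s t) (T \<bar>s - t\<bar> f - f)"
proof (cases "t \<le> s")
  case True
  then have "T s f = T t (T (s - t) f)" using add[of t "s - t" f] assms by simp
  then show ?thesis using True assms by (auto simp: min_def diff)
next
  case False
  then have "T t f = T s (T (t - s) f)" using add[of s "t - s" f] assms by simp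
  then show ?thesis using False assms by (simp add: min_def diff)
qed

lemma tendsto_abs_diff_at_right:
  "filterlim (\<lambda>s. \<bar>s - t\<bar>) (at_right 0) (at t within S)" for t :: real
proof -
  have "((\<lambda>s. \<bar>s - t\<bar>) \<longlongrightarrow> \<bar>t - t\<bar>) (at t within S)"
    by (intro tendsto_intros)
  then show ?thesis
    by (auto simp: filterlim_at eventually_at_filter)
qed

lemma orbit_continuous:
  assumes t: "0 \<le> t" shows "((\<lambda>s. T s f) \<longlongrightarrow> T t f) (at t within {0..})"
proof -
  obtain M where M: "0 \<le> M" "\<And>s f. 0 \<le> s \<Longrightarrow> s \<le> t + 1 \<Longrightarrow> norm (T s f) \<le> M * norm f"
    using bounded_on_interval by blast
  have "((\<lambda>s. T s f - T t f) \<longlongrightarrow> 0) (at t within {0..})"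
  proof (rule Lim_null_comparison)
    have "\<forall>\<^sub>F s in at t within {0..}. s \<in> {0..}" by (simp add: eventually_at_filter)
    then show "\<forall>\<^sub>F s in at t within {0..}. norm (T s f - T t f) \<le> M * norm (T \<bar>s - t\<bar> f - f)"
    proof eventually_elim
      case (elim s)
      then have "norm (T s f - T t f) \<le> norm (T (min s t) (T \<bar>s - t\<bar> f - f))"
        using orbit_diff[of s t f] t by (auto simp: sgn_if)
      also have "\<dots> \<le> M * norm (T \<bar>s - t\<bar> f - f)" using elim t by (intro M(2)) auto
      finally show ?case .
    qed
    have "((\<lambda>s. T \<bar>s - t\<bar> f) \<longlongrightarrow> f) (at t within {0..})"
      using filterlim_compose[OF continuous_0 tendsto_abs_diff_at_right] .
    then show "((\<lambda>s. M * norm (T \<bar>s - t\<bar> f - f)) \<longlongrightarrow> 0) (at t within {0..})"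
      by (intro tendsto_mult_right_zero tendsto_norm_zero) (simp add: LIM_zero_iff)
  qed
  then show ?thesis by (simp add: LIM_zero_iff)
qed

text \<open>The difference quotient at \<open>t\<close> is \<open>T (min s t)\<close> applied to the
  difference quotient at 0. The local bound controls the error of the latter, and continuity of the
  orbit of \<open>g\<close> removes the \<open>min\<close>.\<close>

lemma orbit_derivative:
  assumes gen: "((\<lambda>t. (T t f - f) /\<^sub>R t) \<longlongrightarrow> g) (at_right 0)" and t: "0 \<le> t"
  shows "((\<lambda>s. T s f) has_vector_derivative T t g) (at t within {0..})"
proof -
  obtain M where M: "0 \<le> M" "\<And>s f. 0 \<le> s \<Longrightarrow> s \<le> t + 1 \<Longrightarrow> norm (T s f) \<le> M * norm f"
    using bounded_on_interval by blast
  let ?F = "at t within {0..}"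
  let ?D = "\<lambda>s. (T \<bar>s - t\<bar> f - f) /\<^sub>R \<bar>s - t\<bar>"
  have "((\<lambda>s. (T s f - T t f) /\<^sub>R (s - t) - T t g) \<longlongrightarrow> 0) ?F"
  proof (rule Lim_null_comparison)
    have "\<forall>\<^sub>F s in ?F. s \<in> {0..} \<and> s \<noteq> t" by (simp add: eventually_at_filter)
    then show "\<forall>\<^sub>F s in ?F. norm ((T s f - T t f) /\<^sub>R (s - t) - T t g)
        \<le> M * norm (?D s - g) + norm (T (min s t) g - T t g)"
    proof eventually_elim
      case (elim s)
      then have s: "0 \<le> s" "0 \<le> min s t" "s \<noteq> t" using t by auto
      have "inverse (s - t) * sgn (s - t) = inverse \<bar>s - t\<bar>" using s by (auto simp: sgn_if divide_simps)
      then have "(T s f - T t f) /\<^sub>R (s - t) = T (min s t) (?D s)"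
        using s t by (subst orbit_diff) (auto simp: scale)
      then have "(T s f - T t f) /\<^sub>R (s - t) - T t g = T (min s t) (?D s - g) + (T (min s t) g - T t g)"
        using s by (simp add: diff)
      also have "norm \<dots> \<le> norm (T (min s t) (?D s - g)) + norm (T (min s t) g - T t g)"
        by (rule norm_triangle_ineq)
      also have "norm (T (min s t) (?D s - g)) \<le> M * norm (?D s - g)"
        using s t by (intro M(2)) auto
      finally show ?case by simp
    qed
    have "(?D \<longlongrightarrow> g) ?F"
      using filterlim_compose[OF gen tendsto_abs_diff_at_right] .
    then have 1: "((\<lambda>s. M * norm (?D s - g)) \<longlongrightarrow> 0) ?F"
      by (intro tendsto_mult_right_zero tendsto_norm_zero) (simp add: LIM_zero_iff)
    have "((\<lambda>s. T (min s t) g) \<longlongrightarrow> T t g) ?F"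
    proof -
      have "continuous (at t within {0..}) (\<lambda>s. T s g)"
        using orbit_continuous[OF t] by (simp add: continuous_within)
      moreover have "continuous (at t within {0..}) (\<lambda>s. min s t)"
        by (intro continuous_intros)
      moreover have "(\<lambda>s. min s t) ` {0..} \<subseteq> {0..}" using t by auto
      ultimately have "continuous (at t within {0..}) ((\<lambda>s. T s g) \<circ> (\<lambda>s. min s t))"
        by (intro continuous_within_compose)
           (auto intro: continuous_within_subset)
      then show ?thesis by (simp add: continuous_within o_def)
    qed
    then have 2: "((\<lambda>s. norm (T (min s t) g - T t g)) \<longlongrightarrow> 0) ?F"
      by (intro tendsto_norm_zero) (simp add: LIM_zero_iff)
    show "((\<lambda>s. M * norm (?D s - g) + norm (T (min s t) g - T t g)) \<longlongrightarrow> 0) ?F"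
      using tendsto_add[OF 1 2] by simp
  qed
  then have "((\<lambda>s. norm ((T s f - T t f) /\<^sub>R (s - t) - T t g)) \<longlongrightarrow> 0) ?F"
    by (rule tendsto_norm_zero)
  moreover have "\<forall>\<^sub>F s in ?F. norm ((T s f - T t f) /\<^sub>R (s - t) - T t g)
       = norm (T s f - T t f - (s - t) *\<^sub>R T t g) / norm (s - t)"
  proof -
    have "\<forall>\<^sub>F s in ?F. s \<noteq> t" by (simp add: eventually_at_filter)
    then show ?thesis
    proof eventually_elim
      case (elim s)
      then have "(T s f - T t f) /\<^sub>R (s - t) - T t g = (T s f - T t f - (s - t) *\<^sub>R T t g) /\<^sub>R (s - t)"
        by (simp add: scaleR_right_diff_distrib)
      then show ?case by (simp add: divide_inverse mult.commute)
    qed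
  qed
  ultimately have "((\<lambda>s. norm (T s f - T t f - (s - t) *\<^sub>R T t g) / norm (s - t)) \<longlongrightarrow> 0) ?F"
    by (rule Lim_transform_eventually)
  then show ?thesis
    by (simp add: has_vector_derivative_def has_derivative_iff_norm bounded_linear_scaleR_left)
qed

end

section \<open>Semigroups generated by m-dissipative operators\<close>

text \<open>The operator is unbounded and is represented by its graph. Clause \<open>range\<close>
  says that 1 - hA is onto: \<open>(g - f) /\<^sub>R h\<close> being the value at \<open>g\<close>
  means g - hAg = f.\<close>

locale m_dissipative =
  fixes A :: "('h::{real_inner,banach} \<times> 'h) set"
  assumes subspace: "subspace A"
    and dissipative: "(f, w) \<in> A \<Longrightarrow> inner w f \<le> 0"
    and range: "0 < h \<Longrightarrow> \<exists>g. (g, (g - f) /\<^sub>R h) \<in> A"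
    and dense: "closure (fst ` A) = UNIV"
begin

section \<open>Resolvents of a dissipative operator\<close>

definition J :: "real \<Rightarrow> 'h \<Rightarrow> 'h" where
  "J h f = (if h = 0 then f else (THE g. (g, (g - f) /\<^sub>R h) \<in> A))"

text \<open>\<open>J h\<close> is the inverse of 1 - hA. Reading it as the identity for h = 0 lets
  products of resolvents cover time 0 without a case distinction.\<close>

lemma J_0 [simp]: "J 0 f = f"
  by (simp add: J_def)

lemma resolvent_unique:
  assumes "0 < h" "(g, (g - f) /\<^sub>R h) \<in> A" "(g', (g' - f) /\<^sub>R h) \<in> A"
  shows "g = g'"
proof -
  have "(g, (g - f) /\<^sub>R h) - (g', (g' - f) /\<^sub>R h) \<in> A"
    using subspace_diff[OF subspace] assms by blast
  moreover have "(g - f) /\<^sub>R h - (g' - f) /\<^sub>R h = (g - g') /\<^sub>R h"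
    by (simp add: scaleR_right_diff_distrib)
  ultimately have "(g - g', (g - g') /\<^sub>R h) \<in> A" by simp
  from dissipative[OF this] have "inner (g - g') (g - g') \<le> 0"
    using assms(1) by (simp add: mult_le_0_iff)
  then show ?thesis using inner_eq_zero_iff[of "g - g'"] inner_ge_zero[of "g - g'"] by simp
qed

lemma J_mem: "0 < h \<Longrightarrow> (J h f, (J h f - f) /\<^sub>R h) \<in> A"
proof -
  assume h: "0 < h"
  then have "\<exists>!g. (g, (g - f) /\<^sub>R h) \<in> A"
    using range resolvent_unique by blast
  from theI'[OF this] show ?thesis using h by (simp add: J_def)
qed

lemma J_eqI: "0 < h \<Longrightarrow> (g, (g - f) /\<^sub>R h) \<in> A \<Longrightarrow> J h f = g"
  using resolvent_unique J_mem by blast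

lemma J_linear: "0 \<le> h \<Longrightarrow> linear (J h)"
proof (cases "h = 0")
  case True
  then show ?thesis by (simp add: linear_iff)
next
  case False
  assume "0 \<le> h"
  with False have h: "0 < h" by simp
  show ?thesis
  proof
    fix f g
    have "(J h f, (J h f - f) /\<^sub>R h) + (J h g, (J h g - g) /\<^sub>R h) \<in> A"
      using subspace_add[OF subspace] J_mem h by blast
    moreover have "(J h f - f) /\<^sub>R h + (J h g - g) /\<^sub>R h = (J h f + J h g - (f + g)) /\<^sub>R h"
      by (simp add: algebra_simps)
    ultimately show "J h (f + g) = J h f + J h g" by (intro J_eqI h) simp
  next
    fix c f
    have "c *\<^sub>R (J h f, (J h f - f) /\<^sub>R h) \<in> A"
      using subspace_scale[OF subspace] J_mem h by blast
    moreover have "c *\<^sub>R ((J h f - f) /\<^sub>R h) = (c *\<^sub>R J h f - c *\<^sub>R f) /\<^sub>R h"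
      by (simp add: algebra_simps)
    ultimately show "J h (c *\<^sub>R f) = c *\<^sub>R J h f" by (intro J_eqI h) simp
  qed
qed

lemma J_contraction: "0 \<le> h \<Longrightarrow> norm (J h f) \<le> norm f"
proof (cases "h = 0")
  case False
  assume "0 \<le> h"
  with False have h: "0 < h" by simp
  from dissipative[OF J_mem[OF h, of f]] have "inner (J h f - f) (J h f) \<le> 0"
    using h by (simp add: mult_le_0_iff)
  then have "(norm (J h f))\<^sup>2 \<le> inner f (J h f)"
    by (simp add: inner_diff_left power2_norm_eq_inner)
  also have "\<dots> \<le> norm f * norm (J h f)" by (rule norm_cauchy_schwarz)
  finally show ?thesis by (cases "J h f = 0") (auto simp: power2_eq_square)
qed simp

lemma J_diff: "0 \<le> h \<Longrightarrow> J h (f - g) = J h f - J h g"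
  by (rule linear_diff[OF J_linear])

lemma J_invert:
  assumes "(f, w) \<in> A" "0 \<le> h" shows "J h (f - h *\<^sub>R w) = f"
proof (cases "h = 0")
  case False
  with assms show ?thesis by (intro J_eqI) auto
qed simp

lemma J_minus: "(f, w) \<in> A \<Longrightarrow> 0 \<le> h \<Longrightarrow> J h f - f = h *\<^sub>R J h w"
  using J_invert[of f w h] by (simp add: J_diff linear_scale[OF J_linear] algebra_simps)

lemma J_in_A:
  assumes "(f, w) \<in> A" "0 \<le> h" shows "(J h f, J h w) \<in> A"
proof (cases "h = 0")
  case False
  then show ?thesis using J_mem[of h f] J_minus[OF assms] assms by simp
qed (use assms in simp)

text \<open>\<open>J a\<close> maps the graph of A into itself, so \<open>J a (J b f)\<close> solves
  the equation that characterises \<open>J b (J a f)\<close>.\<close>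

lemma J_commute: "0 \<le> a \<Longrightarrow> 0 \<le> b \<Longrightarrow> J a (J b f) = J b (J a f)"
proof (cases "b = 0")
  case False
  assume a: "0 \<le> a" and "0 \<le> b"
  with False have b: "0 < b" by simp
  from J_in_A[OF J_mem[OF b, of f] a]
  have "(J a (J b f), (J a (J b f) - J a f) /\<^sub>R b) \<in> A"
    by (simp add: J_diff a linear_scale[OF J_linear[OF a]])
  then show ?thesis using J_eqI[OF b] by metis
qed simp

lemma J_near: "(f, w) \<in> A \<Longrightarrow> 0 \<le> h \<Longrightarrow> norm (J h f - f) \<le> h * norm w"
  by (simp add: J_minus mult_left_mono J_contraction)

lemma dense_approx:
  assumes "0 < e" obtains g w where "(g, w) \<in> A" "norm (f - g) < e"
proof -
  have "f \<in> closure (fst ` A)" by (simp add: dense)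
  then obtain g where "g \<in> fst ` A" "dist g f < e"
    using assms closure_approachable by metis
  with that show ?thesis by (auto simp: dist_norm norm_minus_commute)
qed

lemma J_tendsto: "((\<lambda>h. J h f) \<longlongrightarrow> f) (at_right 0)"
proof (rule tendstoI)
  fix e :: real assume e: "0 < e"
  obtain g w where gw: "(g, w) \<in> A" "norm (f - g) < e / 3"
    using dense_approx[of "e / 3" f] e by auto
  have "\<forall>\<^sub>F h in at_right 0. 0 < h \<and> h * norm w < e / 3"
  proof -
    have "((\<lambda>h. h * norm w) \<longlongrightarrow> 0 * norm w) (at_right 0)" by (intro tendsto_intros)
    then have "\<forall>\<^sub>F h in at_right 0. h * norm w < e / 3"
      using e by (intro order_tendstoD(2)) auto
    then show ?thesis using eventually_at_right_less[of 0] by eventually_elim auto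
  qed
  then show "\<forall>\<^sub>F h in at_right 0. dist (J h f) f < e"
  proof eventually_elim
    case (elim h)
    have "J h f - f = J h (f - g) + (J h g - g) - (f - g)" using elim by (simp add: J_diff)
    also have "norm \<dots> \<le> norm (J h (f - g)) + norm (J h g - g) + norm (f - g)"
      by (meson norm_triangle_ineq norm_triangle_ineq4 add_mono order_trans order_refl)
    also have "\<dots> < e"
      using J_contraction[of h "f - g"] J_near[OF gw(1), of h] gw elim by simp
    finally show ?case by (simp add: dist_norm)
  qed
qed

text \<open>Since (1 - bA)(1 - aA) = 1 - (a+b)A + ab A^2, two successive steps differ from one step
  of length a+b by a term of size ab on the domain of A^2.\<close>

lemma J_J_approx:
  assumes A: "(f, w) \<in> A" "(w, z) \<in> A" and ab: "0 \<le> a" "0 \<le> b"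
  shows "norm (J a (J b f) - J (a + b) f) \<le> a * b * norm z"
proof -
  note lin = linear_scale[OF J_linear] linear_add[OF J_linear] J_diff
  let ?p = "J (a + b) f" and ?w = "J (a + b) w" and ?z = "J (a + b) z"
  have s: "0 \<le> a + b" using ab by simp
  have p: "(?p, ?w) \<in> A" "(?w, ?z) \<in> A" using A J_in_A s by auto
  have "f = ?p - (a + b) *\<^sub>R ?w" using J_minus[OF A(1) s] by (simp add: algebra_simps)
  \<comment> \<open>With p = \<open>?p\<close>, the right-hand side is (1 - bA)(1 - aA)p, which
    \<open>J b\<close> and then \<open>J a\<close> undo exactly.\<close>
  then have e: "f + (a * b) *\<^sub>R ?z = (?p - b *\<^sub>R ?w) - a *\<^sub>R (?w - b *\<^sub>R ?z)"
    by (simp add: algebra_simps)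
  have "J b (f + (a * b) *\<^sub>R ?z) = ?p - a *\<^sub>R ?w"
    unfolding e using ab J_invert[OF p(1)] J_invert[OF p(2)] by (simp add: lin)
  then have "J a (J b (f + (a * b) *\<^sub>R ?z)) = ?p"
    using ab J_invert[OF p(1)] by simp
  then have "J a (J b f) - ?p = - ((a * b) *\<^sub>R J a (J b ?z))"
    using ab by (simp add: lin algebra_simps add_eq_0_iff)
  then have "norm (J a (J b f) - ?p) = a * b * norm (J a (J b ?z))"
    using ab by simp
  also have "norm (J a (J b ?z)) \<le> norm z"
    using J_contraction ab s by (meson order_trans)
  then have "a * b * norm (J a (J b ?z)) \<le> a * b * norm z"
    using ab by (intro mult_left_mono) auto
  finally show ?thesis .
qed

text \<open>\<open>dom2 c\<close> is the part of the domain of \<open>A\<^sup>2\<close> where \<open>\<parallel>A\<^sup>2 f\<parallel> \<le> c\<close>; the resolvents preserve it.\<close>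

definition dom2 :: "real \<Rightarrow> 'h set" where
  "dom2 c = {f. \<exists>w z. (f, w) \<in> A \<and> (w, z) \<in> A \<and> norm z \<le> c}"

lemma J_dom2: "f \<in> dom2 c \<Longrightarrow> 0 \<le> h \<Longrightarrow> J h f \<in> dom2 c"
  unfolding dom2_def using J_in_A J_contraction order_trans by blast

lemma J_J_approx': "f \<in> dom2 c \<Longrightarrow> 0 \<le> a \<Longrightarrow> 0 \<le> b \<Longrightarrow> norm (J a (J b f) - J (a + b) f) \<le> a * b * c"
proof -
  assume f: "f \<in> dom2 c" and ab: "0 \<le> a" "0 \<le> b"
  then obtain w z where "(f, w) \<in> A" "(w, z) \<in> A" "norm z \<le> c" unfolding dom2_def by blast
  then show ?thesis using J_J_approx[of f w z a b] ab
    by (meson mult_left_mono mult_nonneg_nonneg order_trans)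
qed

text \<open>Telescoping: the factors Y are replaced by X one after the other. The contraction X does
  not amplify earlier errors, and Y keeps the argument in C, where the one-step bound holds.\<close>

lemma funpow_approx:
  fixes X Y :: "'h \<Rightarrow> 'h"
  assumes X: "\<And>f g. X (f - g) = X f - X g" "\<And>f. norm (X f) \<le> norm f"
    and Y: "\<And>f. f \<in> C \<Longrightarrow> Y f \<in> C"
    and e: "\<And>f. f \<in> C \<Longrightarrow> norm (X f - Y f) \<le> \<epsilon>" and f: "f \<in> C"
  shows "norm ((X ^^ n) f - (Y ^^ n) f) \<le> real n * \<epsilon>"
proof (induction n)
  case (Suc n)
  have "(Y ^^ n) f \<in> C" by (induction n) (use f Y in auto)
  have "(X ^^ Suc n) f - (Y ^^ Suc n) f
      = X ((X ^^ n) f - (Y ^^ n) f) + (X ((Y ^^ n) f) - Y ((Y ^^ n) f))"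
    by (simp add: X)
  also have "norm \<dots> \<le> norm ((X ^^ n) f - (Y ^^ n) f) + \<epsilon>"
    using X(2) e[OF \<open>(Y ^^ n) f \<in> C\<close>] by (meson norm_triangle_le add_mono)
  also have "\<dots> \<le> real n * \<epsilon> + \<epsilon>" using Suc by simp
  finally show ?case by (simp add: algebra_simps)
qed simp

lemma J_J_pow_approx:
  assumes g: "g \<in> dom2 c" and ab: "0 \<le> a" "0 \<le> b"
  shows "norm (((\<lambda>f. J a (J b f)) ^^ n) g - (J (a + b) ^^ n) g) \<le> real n * (a * b * c)"
proof (rule funpow_approx[where C = "dom2 c"])
  show "norm (J a (J b f)) \<le> norm f" for f
    using J_contraction[OF ab(1), of "J b f"] J_contraction[OF ab(2), of f] by linarith
  show "norm (J a (J b f) - J (a + b) f) \<le> a * b * c" if "f \<in> dom2 c" for f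
    using J_J_approx'[OF that ab] .
qed (use ab g J_dom2 in \<open>auto simp: J_diff\<close>)

section \<open>Dyadic Euler products\<close>

definition euler :: "nat \<Rightarrow> real \<Rightarrow> 'h \<Rightarrow> 'h" where
  "euler n t f = (J (t / 2 ^ n) ^^ (2 ^ n)) f"

lemma J_pow_diff: "0 \<le> h \<Longrightarrow> (J h ^^ n) (f - g) = (J h ^^ n) f - (J h ^^ n) g"
  by (induction n) (auto simp: J_diff)

lemma J_pow_contraction: "0 \<le> h \<Longrightarrow> norm ((J h ^^ n) f) \<le> norm f"
  by (induction n) (auto intro: order_trans[OF J_contraction])

lemma euler_diff: "0 \<le> t \<Longrightarrow> euler n t (f - g) = euler n t f - euler n t g"
  by (simp add: euler_def J_pow_diff)

lemma euler_contraction: "0 \<le> t \<Longrightarrow> norm (euler n t f) \<le> norm f"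
  by (simp add: euler_def J_pow_contraction)

lemma euler_scale: "0 \<le> t \<Longrightarrow> euler n t (c *\<^sub>R f) = c *\<^sub>R euler n t f"
proof -
  assume "0 \<le> t"
  then have "(J (t / 2 ^ n) ^^ k) (c *\<^sub>R f) = c *\<^sub>R (J (t / 2 ^ n) ^^ k) f" for k
    by (induction k) (auto simp: linear_scale[OF J_linear])
  then show ?thesis by (simp add: euler_def)
qed

lemma euler_0: "euler 0 t f = J t f"
  by (simp add: euler_def)

lemma euler_at_0 [simp]: "euler n 0 f = f"
proof -
  have "(J 0 ^^ k) f = f" for k by (induction k) auto
  then show ?thesis by (simp add: euler_def)
qed

text \<open>With dyadic step sizes, each step of level n is split into two equal steps of level n+1.
  Every one of the 2^n splittings costs c (t / 2^(n+1))^2, in total t^2 c / (4 * 2^n).\<close>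

lemma euler_Suc:
  assumes f: "f \<in> dom2 c" and t: "0 \<le> t"
  shows "norm (euler (Suc n) t f - euler n t f) \<le> t\<^sup>2 * c / 4 * (1 / 2) ^ n"
proof -
  let ?h = "t / 2 ^ Suc n"
  have h: "0 \<le> ?h" using t by simp
  have "norm (((\<lambda>f. J ?h (J ?h f)) ^^ 2 ^ n) f - (J (?h + ?h) ^^ 2 ^ n) f) \<le> real (2 ^ n) * (?h * ?h * c)"
    by (rule J_J_pow_approx[OF f h h])
  moreover have "((\<lambda>f. J ?h (J ?h f)) ^^ 2 ^ n) f = euler (Suc n) t f"
  proof -
    have "(\<lambda>f. J ?h (J ?h f)) = J ?h ^^ 2" by (auto simp: eval_nat_numeral)
    then show ?thesis by (simp add: euler_def funpow_mult)
  qed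
  moreover have "(J (?h + ?h) ^^ 2 ^ n) f = euler n t f"
    by (simp add: euler_def field_simps)
  moreover have "real (2 ^ n) * (?h * ?h * c) = t\<^sup>2 * c / 4 * (1 / 2) ^ n"
    by (simp add: power2_eq_square power_one_over field_simps)
  ultimately show ?thesis by (simp only:)
qed

text \<open>Summing the geometric errors gives a bound of order t^2 that does not depend on n. It
  survives the limit, so the limit semigroup has the same first-order behaviour at 0 as a single
  resolvent.\<close>

lemma euler_bound:
  assumes f: "f \<in> dom2 c" and t: "0 \<le> t" and c: "0 \<le> c"
  shows "norm (euler n t f - J t f) \<le> t\<^sup>2 * c"
proof -
  have "norm (euler n t f - J t f) \<le> t\<^sup>2 * c / 4 * (2 - 2 * (1 / 2) ^ n)"
  proof (induction n)
    case 0
    then show ?case by (simp add: euler_0)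
  next
    case (Suc n)
    have "norm (euler (Suc n) t f - J t f) \<le> norm (euler (Suc n) t f - euler n t f) + norm (euler n t f - J t f)"
      by (metis norm_triangle_ineq diff_add_cancel add_diff_eq)
    also have "\<dots> \<le> t\<^sup>2 * c / 4 * (1 / 2) ^ n + t\<^sup>2 * c / 4 * (2 - 2 * (1 / 2) ^ n)"
      using euler_Suc[OF f t, of n] Suc by simp
    also have "\<dots> = t\<^sup>2 * c / 4 * (2 - 2 * (1 / 2) ^ Suc n)" by (simp add: algebra_simps)
    finally show ?case .
  qed
  also have "\<dots> \<le> t\<^sup>2 * c / 4 * 4"
  proof (intro mult_left_mono)
    have "(0::real) \<le> (1 / 2) ^ n" by simp
    then show "2 - 2 * (1 / 2) ^ n \<le> (4::real)" by linarith
  qed (use c in simp)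
  finally show ?thesis by simp
qed

text \<open>A resolvent applied to an element of the domain lies in the domain of A^2 and is close
  to that element for small steps.\<close>

lemma dom2_dense:
  assumes "0 < e" obtains g c where "g \<in> dom2 c" "0 \<le> c" "norm (f - g) < e"
proof -
  obtain g w where gw: "(g, w) \<in> A" "norm (f - g) < e / 2"
    using dense_approx[of "e / 2" f] assms by auto
  have "\<forall>\<^sub>F h in at_right 0. dist (J h g) g < e / 2"
    using tendstoD[OF J_tendsto[of g], of "e / 2"] assms by simp
  then obtain h where h: "0 < h" "dist (J h g) g < e / 2"
    using eventually_at_right_less[of "0::real"]
    by (metis (mono_tags, lifting) eventually_conj eventually_happens trivial_limit_at_right_real)
  have "(J h g, J h w) \<in> A" "(J h w, (J h w - w) /\<^sub>R h) \<in> A"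
    using J_in_A gw h J_mem by auto
  then have "J h g \<in> dom2 (norm ((J h w - w) /\<^sub>R h))" unfolding dom2_def by blast
  moreover have "norm (f - J h g) < e"
    using norm_triangle_ineq[of "f - g" "g - J h g"] gw(2) h(2) by (simp add: dist_norm norm_minus_commute)
  ultimately show ?thesis using that norm_ge_zero by blast
qed

lemma euler_Cauchy:
  assumes t: "0 \<le> t" shows "convergent (\<lambda>n. euler n t f)"
proof -
  have base: "convergent (\<lambda>n. euler n t g)" if g: "g \<in> dom2 c" for g c
  proof -
    have "summable (\<lambda>n. t\<^sup>2 * c / 4 * (1 / 2) ^ n)" by (intro summable_mult summable_geometric) simp
    then have "summable (\<lambda>n. euler (Suc n) t g - euler n t g)"
      by (rule summable_comparison_test'[where N = 0]) (use euler_Suc[OF g t] in auto)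
    then have "convergent (\<lambda>n. (euler n t g - euler 0 t g) + euler 0 t g)"
      by (intro convergent_add convergent_const)
         (simp add: summable_iff_convergent sum_lessThan_telescope[of "\<lambda>n. euler n t g"])
    then show ?thesis by simp
  qed
  have "Cauchy (\<lambda>n. euler n t f)"
  proof (rule metric_CauchyI)
    fix e :: real assume e: "0 < e"
    obtain g c where g: "g \<in> dom2 c" "norm (f - g) < e / 3"
      using dom2_dense[of "e / 3" f] e by (metis zero_less_divide_iff zero_less_numeral)
    from base[OF g(1)] have "Cauchy (\<lambda>n. euler n t g)" by (rule convergent_Cauchy)
    then obtain N where N: "\<And>m n. m \<ge> N \<Longrightarrow> n \<ge> N \<Longrightarrow> dist (euler m t g) (euler n t g) < e / 3"
      using metric_CauchyD[of _ "e / 3"] e by (metis zero_less_divide_iff zero_less_numeral)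
    have "dist (euler m t f) (euler n t f) < e" if mn: "m \<ge> N" "n \<ge> N" for m n
    proof -
      have "euler m t f - euler n t f = euler m t (f - g) - euler n t (f - g) + (euler m t g - euler n t g)"
        using t by (simp add: euler_diff)
      also have "norm \<dots> \<le> norm (euler m t (f - g)) + norm (euler n t (f - g)) + norm (euler m t g - euler n t g)"
        by (meson norm_triangle_ineq norm_triangle_ineq4 add_mono order_trans order_refl)
      also have "\<dots> < e"
        using euler_contraction[OF t, of m "f - g"] euler_contraction[OF t, of n "f - g"] g(2) N[OF mn]
        by (simp add: dist_norm)
      finally show ?thesis by (simp add: dist_norm)
    qed
    then show "\<exists>M. \<forall>m\<ge>M. \<forall>n\<ge>M. dist (euler m t f) (euler n t f) < e" by blast
  qed
  then show ?thesis by (simp add: Cauchy_convergent_iff)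
qed

section \<open>The limit semigroup and its generator\<close>

definition S :: "real \<Rightarrow> 'h \<Rightarrow> 'h" where
  "S t f = lim (\<lambda>n. euler n t f)"

lemma euler_S: "0 \<le> t \<Longrightarrow> (\<lambda>n. euler n t f) \<longlonglongrightarrow> S t f"
  unfolding S_def using euler_Cauchy convergent_LIMSEQ_iff by blast

lemma S_contraction: "0 \<le> t \<Longrightarrow> norm (S t f) \<le> norm f"
  by (rule LIMSEQ_le_const2[OF tendsto_norm[OF euler_S]]) (auto simp: euler_contraction)

lemma S_diff: "0 \<le> t \<Longrightarrow> S t (f - g) = S t f - S t g"
  using LIMSEQ_unique[OF euler_S[of t "f - g"]] tendsto_diff[OF euler_S[of t f] euler_S[of t g]]
  by (simp add: euler_diff)

lemma S_scale: "0 \<le> t \<Longrightarrow> S t (c *\<^sub>R f) = c *\<^sub>R S t f"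
  using LIMSEQ_unique[OF euler_S[of t "c *\<^sub>R f"]] tendsto_scaleR[OF tendsto_const euler_S[of t f], of c]
  by (simp add: euler_scale)

lemma S_bounded_linear: "0 \<le> t \<Longrightarrow> bounded_linear (S t)"
proof (rule bounded_linear_intro[of _ 1])
  assume t: "0 \<le> t"
  fix f g
  have "S t (f + g) = S t (f - (-1) *\<^sub>R g)" by simp
  also have "\<dots> = S t f - (-1) *\<^sub>R S t g" by (simp only: S_diff[OF t] S_scale[OF t])
  finally show "S t (f + g) = S t f + S t g" by simp
qed (auto simp: S_scale S_contraction)

lemma S_0: "S 0 f = f"
  using LIMSEQ_unique[OF euler_S[of 0 f]] by simp

text \<open>At level n, the products for s and t interleave because resolvents commute. Merging 2^n
  pairs of steps costs 2^n c (s / 2^n)(t / 2^n), which tends to 0.\<close>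

lemma S_add:
  assumes st: "0 \<le> s" "0 \<le> t" shows "S (s + t) f = S s (S t f)"
proof -
  have base: "S (s + t) g = S s (S t g)" if g: "g \<in> dom2 c" and c: "0 \<le> c" for g c
  proof -
    have "(\<lambda>n. euler n s (euler n t g) - euler n (s + t) g) \<longlonglongrightarrow> 0"
    proof (rule Lim_null_comparison)
      show "\<forall>\<^sub>F n in sequentially. norm (euler n s (euler n t g) - euler n (s + t) g) \<le> s * t * c * (1 / 2) ^ n"
      proof (intro always_eventually allI)
        fix n
        let ?a = "s / 2 ^ n" and ?b = "t / 2 ^ n"
        have ab: "0 \<le> ?a" "0 \<le> ?b" using st by auto
        have "((\<lambda>f. J ?a (J ?b f)) ^^ k) g = (J ?a ^^ k) ((J ?b ^^ k) g)" for k
        proof (induction k)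
          case (Suc k)
          have "J ?b ((J ?a ^^ j) f) = (J ?a ^^ j) (J ?b f)" for j f
            by (induction j) (auto simp: J_commute[OF ab(2) ab(1)])
          then show ?case using Suc by simp
        qed simp
        moreover have "norm (((\<lambda>f. J ?a (J ?b f)) ^^ 2 ^ n) g - (J (?a + ?b) ^^ 2 ^ n) g) \<le> real (2 ^ n) * (?a * ?b * c)"
          by (rule J_J_pow_approx[OF g ab])
        moreover have "real (2 ^ n) * (?a * ?b * c) = s * t * c * (1 / 2) ^ n"
          by (simp add: power_one_over field_simps)
        ultimately show "norm (euler n s (euler n t g) - euler n (s + t) g) \<le> s * t * c * (1 / 2) ^ n"
          by (simp add: euler_def add_divide_distrib)
      qed
      show "(\<lambda>n. s * t * c * (1 / 2) ^ n) \<longlonglongrightarrow> 0"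
        by (intro tendsto_mult_right_zero LIMSEQ_power_zero) simp
    qed
    moreover have "(\<lambda>n. euler n s (euler n t g)) \<longlonglongrightarrow> S s (S t g)"
    proof -
      have "(\<lambda>n. euler n s (euler n t g - S t g)) \<longlonglongrightarrow> 0"
      proof (rule Lim_null_comparison)
        show "\<forall>\<^sub>F n in sequentially. norm (euler n s (euler n t g - S t g)) \<le> norm (euler n t g - S t g)"
          using st by (auto simp: euler_contraction)
        show "(\<lambda>n. norm (euler n t g - S t g)) \<longlonglongrightarrow> 0"
          using euler_S[OF st(2), of g] by (intro tendsto_norm_zero) (simp add: LIM_zero_iff)
      qed
      from tendsto_add[OF this euler_S[OF st(1), of "S t g"]] show ?thesis
        using st by (simp add: euler_diff)
    qed
    ultimately have "(\<lambda>n. euler n (s + t) g) \<longlonglongrightarrow> S s (S t g)"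
      using tendsto_diff[of "\<lambda>n. euler n s (euler n t g)" _ _ "\<lambda>n. euler n s (euler n t g) - euler n (s + t) g" 0]
      by simp
    then show ?thesis using euler_S[of "s + t" g] st LIMSEQ_unique by simp
  qed
  have "norm (S (s + t) f - S s (S t f)) \<le> e" if e: "0 < e" for e
  proof -
    obtain g c where g: "g \<in> dom2 c" "0 \<le> c" "norm (f - g) < e / 2"
      using dom2_dense[of "e / 2" f] e by auto
    have "S (s + t) f - S s (S t f) = S (s + t) (f - g) - S s (S t (f - g))"
      using base[OF g(1,2)] st by (simp add: S_diff)
    also have "norm \<dots> \<le> norm (S (s + t) (f - g)) + norm (S s (S t (f - g)))"
      by (rule norm_triangle_ineq4)
    also have "\<dots> \<le> norm (f - g) + norm (f - g)"
      using st S_contraction by (intro add_mono) (auto intro: order_trans)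
    finally show ?thesis using g(3) by simp
  qed
  then have "norm (S (s + t) f - S s (S t f)) \<le> 0" by (rule field_le_epsilon) simp
  then show ?thesis by simp
qed

lemma S_near: "(f, w) \<in> A \<Longrightarrow> 0 \<le> t \<Longrightarrow> norm (S t f - f) \<le> t * norm w"
proof -
  assume f: "(f, w) \<in> A" and t: "0 \<le> t"
  have "norm (euler n t f - f) \<le> t * norm w" for n
  proof -
    let ?h = "t / 2 ^ n"
    have h: "0 \<le> ?h" using t by simp
    have "norm ((J ?h ^^ k) f - f) \<le> real k * (?h * norm w)" for k
    proof (induction k)
      case (Suc k)
      have "(J ?h ^^ Suc k) f - f = J ?h ((J ?h ^^ k) f - f) + (J ?h f - f)"
        using h by (simp add: J_diff)
      also have "norm \<dots> \<le> norm ((J ?h ^^ k) f - f) + ?h * norm w"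
        using J_contraction[OF h] J_near[OF f h] by (meson norm_triangle_le add_mono)
      also have "\<dots> \<le> real k * (?h * norm w) + ?h * norm w" using Suc by simp
      also have "\<dots> = real (Suc k) * (?h * norm w)" unfolding of_nat_Suc by (simp only: ring_distribs mult_1 add.commute)
      finally show ?case .
    qed simp
    from this[of "2 ^ n"] show ?thesis by (simp add: euler_def)
  qed
  moreover have "(\<lambda>n. norm (euler n t f - f)) \<longlonglongrightarrow> norm (S t f - f)"
    by (intro tendsto_intros euler_S t)
  ultimately show ?thesis by (intro LIMSEQ_le_const2) auto
qed

lemma S_tendsto: "((\<lambda>t. S t f) \<longlongrightarrow> f) (at_right 0)"
proof (rule tendstoI)
  fix e :: real assume e: "0 < e"
  obtain g w where gw: "(g, w) \<in> A" "norm (f - g) < e / 3"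
    using dense_approx[of "e / 3" f] e by auto
  have "\<forall>\<^sub>F h in at_right 0. 0 < h \<and> h * norm w < e / 3"
  proof -
    have "((\<lambda>h. h * norm w) \<longlongrightarrow> 0 * norm w) (at_right 0)" by (intro tendsto_intros)
    then have "\<forall>\<^sub>F h in at_right 0. h * norm w < e / 3"
      using e by (intro order_tendstoD(2)) auto
    then show ?thesis using eventually_at_right_less[of 0] by eventually_elim auto
  qed
  then show "\<forall>\<^sub>F h in at_right 0. dist (S h f) f < e"
  proof eventually_elim
    case (elim h)
    have "S h f - f = S h (f - g) + (S h g - g) - (f - g)" using elim by (simp add: S_diff)
    also have "norm \<dots> \<le> norm (S h (f - g)) + norm (S h g - g) + norm (f - g)"
      by (meson norm_triangle_ineq norm_triangle_ineq4 add_mono order_trans order_refl)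
    also have "\<dots> < e"
      using S_contraction[of h "f - g"] S_near[OF gw(1), of h] gw elim by simp
    finally show ?case by (simp add: dist_norm)
  qed
qed

sublocale S: strongly_continuous_semigroup S
  by (rule strongly_continuous_semigroup.intro) (simp_all add: S_bounded_linear S_0 S_add S_tendsto)

lemma S_generator:
  assumes f: "(f, w) \<in> A"
  shows "((\<lambda>t. (S t f - f) /\<^sub>R t) \<longlongrightarrow> w) (at_right 0)"
proof (rule tendstoI)
  fix e :: real assume e: "0 < e"
  have "\<forall>\<^sub>F h in at_right 0. dist (J h w) w < e / 4"
    using tendstoD[OF J_tendsto[of w], of "e / 4"] e by simp
  then obtain h where h: "0 < h" "dist (J h w) w < e / 4"
    using eventually_at_right_less[of "0::real"]
    by (metis (mono_tags, lifting) eventually_conj eventually_happens trivial_limit_at_right_real)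
  \<comment> \<open>\<open>J h f\<close> approximates \<open>f\<close> in the graph norm and lies in
    the domain of A^2 at the same time: \<open>euler_bound\<close> handles \<open>g\<close>, and
    \<open>S_near\<close> handles the remainder, whose image under A has norm at most e/4.\<close>
  define g v z where "g = J h f" and "v = J h w" and "z = (J h w - w) /\<^sub>R h"
  have g: "(g, v) \<in> A" "(v, z) \<in> A" using f h J_in_A J_mem unfolding g_def v_def z_def by auto
  have g2: "g \<in> dom2 (norm z)" using g unfolding dom2_def by blast
  have fg: "(f - g, w - v) \<in> A" using subspace_diff[OF subspace f g(1)] by simp
  have wv: "norm (w - v) < e / 4" using h by (simp add: v_def dist_norm norm_minus_commute)
  have "\<forall>\<^sub>F t in at_right 0. 0 < t \<and> t * (2 * norm z) < e / 4"
  proof -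
    have "((\<lambda>t. t * (2 * norm z)) \<longlongrightarrow> 0 * (2 * norm z)) (at_right 0)" by (intro tendsto_intros)
    then have "\<forall>\<^sub>F t in at_right 0. t * (2 * norm z) < e / 4"
      using e by (intro order_tendstoD(2)) auto
    then show ?thesis using eventually_at_right_less[of 0] by eventually_elim auto
  qed
  then show "\<forall>\<^sub>F t in at_right 0. dist ((S t f - f) /\<^sub>R t) w < e"
  proof eventually_elim
    case (elim t)
    then have t: "0 < t" "0 \<le> t" by auto
    have "norm (S t g - J t g) \<le> t\<^sup>2 * norm z"
      using LIMSEQ_le_const2[OF tendsto_norm[OF tendsto_diff[OF euler_S[OF t(2), of g] tendsto_const[of "J t g"]]]]
        euler_bound[OF g2 t(2)] by auto
    then have 1: "norm ((S t g - J t g) /\<^sub>R t) \<le> t * norm z"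
      using t by (simp add: pos_divide_le_eq inverse_eq_divide power2_eq_square mult_ac)
    have 2: "(J t g - g) /\<^sub>R t - v = J t v - v" using J_minus[OF g(1) t(2)] t by simp
    have 3: "norm (J t v - v) \<le> t * norm z" using J_near[OF g(2) t(2)] .
    have 4: "norm ((S t (f - g) - (f - g)) /\<^sub>R t) \<le> norm (w - v)"
      using S_near[OF fg t(2)] t by (simp add: pos_divide_le_eq inverse_eq_divide mult_ac del: scaleR_right_diff_distrib)
    have "(S t f - f) /\<^sub>R t - w = (S t g - J t g) /\<^sub>R t + ((J t g - g) /\<^sub>R t - v)
        + (S t (f - g) - (f - g)) /\<^sub>R t - (w - v)"
      using t by (simp add: S_diff scaleR_right_diff_distrib)
    also have "norm \<dots> \<le> norm ((S t g - J t g) /\<^sub>R t) + norm ((J t g - g) /\<^sub>R t - v)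
        + norm ((S t (f - g) - (f - g)) /\<^sub>R t) + norm (w - v)"
      by (meson norm_triangle_ineq norm_triangle_ineq4 add_mono order_trans order_refl)
    also have "\<dots> < e"
    proof -
      have "2 * (t * norm z) < e / 4" using elim by (simp add: mult_ac)
      then show ?thesis using 1 3 4 wv e unfolding 2 by linarith
    qed
    finally show ?case by (simp add: dist_norm)
  qed
qed

text \<open>The generator cannot extend A properly: a contraction semigroup has a dissipative
  generator, and 1 - A is already onto.\<close>

lemma S_generator_iff:
  "((\<lambda>t. (S t f - f) /\<^sub>R t) \<longlongrightarrow> w) (at_right 0) \<longleftrightarrow> (f, w) \<in> A"
proof
  assume lim: "((\<lambda>t. (S t f - f) /\<^sub>R t) \<longlongrightarrow> w) (at_right 0)"
  \<comment> \<open>\<open>g\<close> lies in the domain of A and satisfies g - Ag = f - w. Hence the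
    generator maps e = f - g to e itself, and dissipativity forces e = 0.\<close>
  define g where "g = J 1 (f - w)"
  have g: "(g, g - (f - w)) \<in> A" using J_mem[of 1 "f - w"] by (simp add: g_def)
  let ?e = "f - g"
  have "((\<lambda>t. (S t f - f) /\<^sub>R t - (S t g - g) /\<^sub>R t) \<longlongrightarrow> w - (g - (f - w))) (at_right 0)"
    by (intro tendsto_diff lim S_generator g)
  moreover have "\<forall>\<^sub>F t in at_right 0. (S t f - f) /\<^sub>R t - (S t g - g) /\<^sub>R t = (S t ?e - ?e) /\<^sub>R t"
    using eventually_at_right_less[of "0::real"]
    by eventually_elim (simp add: S_diff scaleR_right_diff_distrib)
  ultimately have "((\<lambda>t. (S t ?e - ?e) /\<^sub>R t) \<longlongrightarrow> ?e) (at_right 0)"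
    by (rule Lim_transform_eventually[THEN tendsto_eq_rhs]) simp
  then have "((\<lambda>t. inner ((S t ?e - ?e) /\<^sub>R t) ?e) \<longlongrightarrow> inner ?e ?e) (at_right 0)"
    by (intro tendsto_intros)
  moreover have "\<forall>\<^sub>F t in at_right 0. inner ((S t ?e - ?e) /\<^sub>R t) ?e \<le> 0"
    using eventually_at_right_less[of "0::real"]
  proof eventually_elim
    case (elim t)
    have "inner (S t ?e) ?e \<le> norm (S t ?e) * norm ?e" by (rule norm_cauchy_schwarz)
    also have "\<dots> \<le> norm ?e * norm ?e" using S_contraction elim by (intro mult_right_mono) auto
    finally have "inner (S t ?e - ?e) ?e \<le> 0"
      by (simp add: inner_diff_left flip: power2_norm_eq_inner power2_eq_square)
    then show ?case using elim by (simp add: mult_le_0_iff)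
  qed
  ultimately have "inner ?e ?e \<le> 0"
    by (intro tendsto_upperbound[of _ _ "at_right 0"]) auto
  then have "f = g" using inner_eq_zero_iff[of ?e] inner_ge_zero[of ?e] by simp
  then show "(f, w) \<in> A" using g by simp
qed (rule S_generator)

end

section \<open>The Hilbert space of square-summable functions\<close>

lemma summable_on_real_bound:
  fixes f g :: "'i \<Rightarrow> real"
  assumes "g summable_on A" "\<And>x. x \<in> A \<Longrightarrow> \<bar>f x\<bar> \<le> g x"
  shows "f summable_on A"
proof -
  have "(\<lambda>x. norm (f x)) summable_on A"
    by (rule summable_on_comparison_test[OF assms(1)]) (use assms(2) in auto)
  then show ?thesis by (rule abs_summable_summable)
qed

lemma summable_on_mult_of_squares:
  fixes f g :: "'i \<Rightarrow> real"
  assumes "(\<lambda>x. (f x)\<^sup>2) summable_on A" "(\<lambda>x. (g x)\<^sup>2) summable_on A"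
  shows "(\<lambda>x. f x * g x) summable_on A"
proof (rule summable_on_real_bound[OF summable_on_add[OF assms]])
  fix x
  have "2 * (\<bar>f x\<bar> * \<bar>g x\<bar>) \<le> (f x)\<^sup>2 + (g x)\<^sup>2"
    using sum_squares_bound[of "\<bar>f x\<bar>" "\<bar>g x\<bar>"] by simp
  moreover have "0 \<le> \<bar>f x\<bar> * \<bar>g x\<bar>" by simp
  ultimately show "\<bar>f x * g x\<bar> \<le> (f x)\<^sup>2 + (g x)\<^sup>2" unfolding abs_mult by linarith
qed

lemma summable_on_diff:
  fixes f g :: "'i \<Rightarrow> 'b::{topological_ab_group_add, t2_space}"
  assumes "f summable_on A" "g summable_on A"
  shows "(\<lambda>x. f x - g x) summable_on A"
  using summable_on_add[OF assms(1), of "\<lambda>x. - g x"] assms(2) by (simp add: summable_on_uminus)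

lemma infsum_diff:
  fixes f g :: "'i \<Rightarrow> 'b::{topological_ab_group_add, t2_space}"
  assumes "f summable_on A" "g summable_on A"
  shows "(\<Sum>\<^sub>\<infinity>x\<in>A. f x - g x) = infsum f A - infsum g A"
  using infsum_add[OF assms(1), of "\<lambda>x. - g x"] assms(2) by (simp add: summable_on_uminus infsum_uminus)

lemma summable_on_square_add:
  fixes f g :: "'i \<Rightarrow> real"
  assumes "(\<lambda>x. (f x)\<^sup>2) summable_on A" "(\<lambda>x. (g x)\<^sup>2) summable_on A"
  shows "(\<lambda>x. (f x + g x)\<^sup>2) summable_on A"
proof -
  have "(\<lambda>x. (f x)\<^sup>2 + (g x)\<^sup>2 + 2 * (f x * g x)) summable_on A"
    by (intro summable_on_add summable_on_cmult_right summable_on_mult_of_squares assms)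
  then show ?thesis by (simp add: power2_sum algebra_simps)
qed

text \<open>The space carries no weight. Vertex measure and edge weights enter through square roots
  in \<open>emb\<close> and \<open>dif\<close>, so one type serves functions on vertices and
  gradients on ordered pairs.\<close>

typedef 'i ell2 = "{f :: 'i \<Rightarrow> real. (\<lambda>x. (f x)\<^sup>2) summable_on UNIV}"
  morphisms coord Abs_ell2
  by (rule exI[of _ "\<lambda>_. 0"]) simp

setup_lifting type_definition_ell2

lemma coord_summable: "(\<lambda>x. (coord a x)\<^sup>2) summable_on UNIV"
  using coord by blast

lemma ell2_eqI: "(\<And>x. coord a x = coord b x) \<Longrightarrow> a = b"
  by (rule coord_inject[THEN iffD1]) auto

instantiation ell2 :: (type) real_vector
begin

lift_definition zero_ell2 :: "'a ell2" is "\<lambda>_. 0" by simp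
lift_definition plus_ell2 :: "'a ell2 \<Rightarrow> 'a ell2 \<Rightarrow> 'a ell2" is "\<lambda>f g x. f x + g x"
  by (rule summable_on_square_add)
lift_definition uminus_ell2 :: "'a ell2 \<Rightarrow> 'a ell2" is "\<lambda>f x. - f x" by simp
lift_definition minus_ell2 :: "'a ell2 \<Rightarrow> 'a ell2 \<Rightarrow> 'a ell2" is "\<lambda>f g x. f x - g x"
proof -
  fix f g :: "'a \<Rightarrow> real"
  assume "(\<lambda>x. (f x)\<^sup>2) summable_on UNIV" "(\<lambda>x. (g x)\<^sup>2) summable_on UNIV"
  then show "(\<lambda>x. (f x - g x)\<^sup>2) summable_on UNIV"
    using summable_on_square_add[of f UNIV "\<lambda>x. - g x"] by simp
qed
lift_definition scaleR_ell2 :: "real \<Rightarrow> 'a ell2 \<Rightarrow> 'a ell2" is "\<lambda>c f x. c * f x"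
  by (simp add: power_mult_distrib summable_on_cmult_right)

instance
  by standard (transfer; simp add: algebra_simps; fail)+

end

lemmas coord_simps [simp] =
  zero_ell2.rep_eq plus_ell2.rep_eq uminus_ell2.rep_eq minus_ell2.rep_eq scaleR_ell2.rep_eq

instantiation ell2 :: (type) real_inner
begin

definition inner_ell2 :: "'a ell2 \<Rightarrow> 'a ell2 \<Rightarrow> real" where
  "inner_ell2 a b = (\<Sum>\<^sub>\<infinity>x. coord a x * coord b x)"
definition norm_ell2 :: "'a ell2 \<Rightarrow> real" where "norm_ell2 a = sqrt (inner a a)"
definition dist_ell2 :: "'a ell2 \<Rightarrow> 'a ell2 \<Rightarrow> real" where "dist_ell2 a b = norm (a - b)"
definition sgn_ell2 :: "'a ell2 \<Rightarrow> 'a ell2" where "sgn_ell2 a = a /\<^sub>R norm a"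
definition uniformity_ell2 :: "('a ell2 \<times> 'a ell2) filter" where
  "uniformity_ell2 = (INF e\<in>{0<..}. principal {(x, y). dist x y < e})"
definition open_ell2 :: "'a ell2 set \<Rightarrow> bool" where
  "open_ell2 U \<longleftrightarrow> (\<forall>x\<in>U. eventually (\<lambda>(x', y). x' = x \<longrightarrow> y \<in> U) uniformity)"

instance
proof
  fix a b c :: "'a ell2" and r s :: real
  show "dist a b = norm (a - b)" by (simp add: dist_ell2_def)
  show "sgn a = a /\<^sub>R norm a" by (simp add: sgn_ell2_def)
  show "inner a b = inner b a" by (simp add: inner_ell2_def mult.commute)
  note sm = summable_on_mult_of_squares[OF coord_summable coord_summable]
  have "inner (a + b) c = (\<Sum>\<^sub>\<infinity>x. coord a x * coord c x + coord b x * coord c x)"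
    by (simp add: inner_ell2_def plus_ell2.rep_eq algebra_simps)
  also have "\<dots> = inner a c + inner b c"
    unfolding inner_ell2_def by (intro infsum_add sm)
  finally show "inner (a + b) c = inner a c + inner b c" .
  show "inner (r *\<^sub>R a) b = r * inner a b"
    by (simp add: inner_ell2_def scaleR_ell2.rep_eq mult.assoc infsum_cmult_right')
  show "0 \<le> inner a a" by (simp add: inner_ell2_def infsum_nonneg)
  show "inner a a = 0 \<longleftrightarrow> a = 0"
  proof
    assume z: "inner a a = 0"
    have "coord a x * coord a x = 0" for x
      by (rule nonneg_infsum_le_0D[of "\<lambda>x. coord a x * coord a x" UNIV])
         (use z sm[of a a] in \<open>auto simp: inner_ell2_def\<close>)
    then show "a = 0" by (intro ell2_eqI) (simp add: zero_ell2.rep_eq)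
  qed (simp add: inner_ell2_def zero_ell2.rep_eq)
  show "norm a = sqrt (inner a a)" by (simp add: norm_ell2_def)
qed (simp_all add: uniformity_ell2_def open_ell2_def)

end

lemma coord_mult_summable: "(\<lambda>x. coord a x * coord b x) summable_on UNIV"
  by (intro summable_on_mult_of_squares coord_summable)

lemma norm_ell2_square: "(norm a)\<^sup>2 = (\<Sum>\<^sub>\<infinity>x. (coord a x)\<^sup>2)"
  unfolding power2_norm_eq_inner inner_ell2_def by (simp add: power2_eq_square)

lemma sum_coord_le_norm: "finite F \<Longrightarrow> (\<Sum>x\<in>F. (coord a x)\<^sup>2) \<le> (norm a)\<^sup>2"
  unfolding norm_ell2_square by (rule finite_sum_le_infsum) (auto simp: coord_summable)

lemma coord_le_norm: "\<bar>coord a x\<bar> \<le> norm a"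
proof -
  have "(coord a x)\<^sup>2 \<le> (norm a)\<^sup>2" using sum_coord_le_norm[of "{x}" a] by simp
  then show ?thesis using abs_le_square_iff[of "coord a x" "norm a"] by simp
qed

lemma bounded_linear_coord: "bounded_linear (\<lambda>a. coord a x)"
  by (rule bounded_linear_intro[of _ 1]) (auto simp: coord_le_norm)

lemmas tendsto_coord = bounded_linear.tendsto[OF bounded_linear_coord]

lemma norm_ell2_le:
  assumes "\<And>F. finite F \<Longrightarrow> (\<Sum>x\<in>F. (coord a x)\<^sup>2) \<le> c\<^sup>2" "0 \<le> c" shows "norm a \<le> c"
proof -
  have "(norm a)\<^sup>2 \<le> c\<^sup>2"
    unfolding norm_ell2_square by (rule infsum_le_finite_sums[OF coord_summable assms(1)])
  then show ?thesis using assms(2) by (rule power2_le_imp_le)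
qed

instance ell2 :: (type) banach
proof
  fix X :: "nat \<Rightarrow> 'a ell2" assume C: "Cauchy X"
  have "convergent (\<lambda>n. coord (X n) x)" for x
    using bounded_linear.Cauchy[OF bounded_linear_coord C] by (simp add: Cauchy_convergent_iff)
  then obtain f where f: "\<And>x. (\<lambda>n. coord (X n) x) \<longlonglongrightarrow> f x" unfolding convergent_def by metis
  \<comment> \<open>Square-summability of the coordinatewise limit \<open>f\<close> is still open at
    this point, so closeness is expressed through finite partial sums, uniformly in the finite
    set.\<close>
  have near: "\<exists>N. \<forall>n\<ge>N. \<forall>F. finite F \<longrightarrow> (\<Sum>x\<in>F. (coord (X n) x - f x)\<^sup>2) \<le> e\<^sup>2" if e: "0 < e" for e
  proof -
    from C e obtain N where N: "\<And>k n. N \<le> k \<Longrightarrow> N \<le> n \<Longrightarrow> dist (X n) (X k) < e"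
      by (metis metric_CauchyD)
    have "(\<Sum>x\<in>F. (coord (X n) x - f x)\<^sup>2) \<le> e\<^sup>2" if n: "N \<le> n" and F: "finite F" for n F
    proof (rule LIMSEQ_le_const2)
      show "(\<lambda>k. \<Sum>x\<in>F. (coord (X n) x - coord (X k) x)\<^sup>2) \<longlonglongrightarrow> (\<Sum>x\<in>F. (coord (X n) x - f x)\<^sup>2)"
        by (intro tendsto_intros f)
      have "(\<Sum>x\<in>F. (coord (X n) x - coord (X k) x)\<^sup>2) \<le> e\<^sup>2" if "N \<le> k" for k
      proof -
        have "(\<Sum>x\<in>F. (coord (X n) x - coord (X k) x)\<^sup>2) \<le> (norm (X n - X k))\<^sup>2"
          using sum_coord_le_norm[OF F, of "X n - X k"] by simp
        also have "\<dots> \<le> e\<^sup>2" using N[OF that n] by (intro power_mono) (auto simp: dist_norm)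
        finally show ?thesis .
      qed
      then show "\<exists>M. \<forall>k\<ge>M. (\<Sum>x\<in>F. (coord (X n) x - coord (X k) x)\<^sup>2) \<le> e\<^sup>2" by blast
    qed
    then show ?thesis by blast
  qed
  obtain N where N: "\<And>n F. N \<le> n \<Longrightarrow> finite F \<Longrightarrow> (\<Sum>x\<in>F. (coord (X n) x - f x)\<^sup>2) \<le> 1"
    using near[of 1] by auto
  have "(\<lambda>x. (coord (X N) x - f x)\<^sup>2) summable_on UNIV"
    by (rule nonneg_bounded_partial_sums_imp_summable_on[of _ _ 1]) (use N[of N] in auto)
  then have "(\<lambda>x. (coord (X N) x + - (coord (X N) x - f x))\<^sup>2) summable_on UNIV"
    by (intro summable_on_square_add coord_summable) (simp add: power2_commute)
  then have fs: "(\<lambda>x. (f x)\<^sup>2) summable_on UNIV" by simp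
  have cf: "coord (Abs_ell2 f) = f" using fs by (simp add: Abs_ell2_inverse)
  have "X \<longlonglongrightarrow> Abs_ell2 f"
  proof (rule metric_LIMSEQ_I)
    fix e :: real assume e: "0 < e"
    then obtain N where N: "\<And>n F. N \<le> n \<Longrightarrow> finite F \<Longrightarrow> (\<Sum>x\<in>F. (coord (X n) x - f x)\<^sup>2) \<le> (e / 2)\<^sup>2"
      using near[of "e / 2"] by auto
    have "norm (X n - Abs_ell2 f) \<le> e / 2" if "N \<le> n" for n
      by (rule norm_ell2_le) (use N[OF that] cf e in auto)
    then show "\<exists>N. \<forall>n\<ge>N. dist (X n) (Abs_ell2 f) < e"
      using e by (intro exI[of _ N]) (force simp: dist_norm)
  qed
  then show "convergent X" by (auto simp: convergent_def)
qed

text \<open>Multiplication operator. The value 0 for an unbounded multiplier is a default that makes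
  the operation total.\<close>

lift_definition ell2_mult :: "('i \<Rightarrow> real) \<Rightarrow> 'i ell2 \<Rightarrow> 'i ell2" is
  "\<lambda>k f. if bounded (range k) then (\<lambda>x. k x * f x) else (\<lambda>_. 0)"
proof -
  fix k f :: "'i \<Rightarrow> real"
  assume f: "(\<lambda>x. (f x)\<^sup>2) summable_on UNIV"
  show "(\<lambda>x. ((if bounded (range k) then \<lambda>x. k x * f x else (\<lambda>_. 0)) x)\<^sup>2) summable_on UNIV"
  proof (cases "bounded (range k)")
    case True
    then obtain B where B: "\<And>x. \<bar>k x\<bar> \<le> B" by (auto simp: bounded_iff)
    have "(\<lambda>x. (k x * f x)\<^sup>2) summable_on UNIV"
    proof (rule summable_on_real_bound)
      show "(\<lambda>x. B\<^sup>2 * (f x)\<^sup>2) summable_on UNIV" by (intro summable_on_cmult_right f)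
      fix x
      have "(k x)\<^sup>2 \<le> B\<^sup>2" using B[of x] by (metis abs_ge_zero order_trans power2_abs power_mono)
      then show "\<bar>(k x * f x)\<^sup>2\<bar> \<le> B\<^sup>2 * (f x)\<^sup>2" by (simp add: power_mult_distrib mult_right_mono)
    qed
    with True show ?thesis by simp
  qed simp
qed

lemma coord_ell2_mult: "bounded (range k) \<Longrightarrow> coord (ell2_mult k a) x = k x * coord a x"
  by (simp add: ell2_mult.rep_eq)

lemma bounded_linear_ell2_mult: 
  assumes k: "bounded (range k)" shows "bounded_linear (ell2_mult k)"
proof -
  from k obtain B where B: "\<And>x. \<bar>k x\<bar> \<le> B" by (auto simp: bounded_iff)
  then have B0: "0 \<le> B" using abs_ge_zero order_trans by blast
  show ?thesis
  proof (rule bounded_linear_intro[of _ B])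
    fix a
    show "norm (ell2_mult k a) \<le> norm a * B"
    proof (rule norm_ell2_le)
      fix F :: "'a set" assume F: "finite F"
      have "(\<Sum>x\<in>F. (coord (ell2_mult k a) x)\<^sup>2) \<le> (\<Sum>x\<in>F. B\<^sup>2 * (coord a x)\<^sup>2)"
      proof (rule sum_mono)
        fix x
        have "(k x)\<^sup>2 \<le> B\<^sup>2" using B[of x] by (metis abs_ge_zero power2_abs power_mono)
        then show "(coord (ell2_mult k a) x)\<^sup>2 \<le> B\<^sup>2 * (coord a x)\<^sup>2"
          by (simp add: coord_ell2_mult k power_mult_distrib mult_right_mono)
      qed
      also have "\<dots> \<le> B\<^sup>2 * (norm a)\<^sup>2"
        unfolding sum_distrib_left[symmetric] by (intro mult_left_mono sum_coord_le_norm F) simp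
      finally show "(\<Sum>x\<in>F. (coord (ell2_mult k a) x)\<^sup>2) \<le> (norm a * B)\<^sup>2"
        by (simp add: power_mult_distrib mult.commute)
    qed (use B0 in simp)
  qed (auto intro!: ell2_eqI simp: coord_ell2_mult k algebra_simps)
qed

section \<open>Dominated convergence and orthogonal projection\<close>

text \<open>A finite set carries all of the sum of \<open>a\<close> up to e/3; off this set the
  weights are at most 1, and on it the terms converge one by one. The weights in use are (1 -
  \<eta>)^2.\<close>

lemma infsum_dominated_tendsto_0:
  fixes a :: "'i \<Rightarrow> real" and w :: "nat \<Rightarrow> 'i \<Rightarrow> real"
  assumes a: "a summable_on UNIV" "\<And>i. 0 \<le> a i"
    and w: "\<And>k i. 0 \<le> w k i" "\<And>k i. w k i \<le> 1" "\<And>i. (\<lambda>k. w k i) \<longlonglongrightarrow> 0"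
  shows "(\<lambda>k. \<Sum>\<^sub>\<infinity>i. w k i * a i) \<longlonglongrightarrow> 0"
proof (rule LIMSEQ_I)
  fix e :: real assume e: "0 < e"
  obtain F where F: "finite F" "dist (sum a F) (infsum a UNIV) \<le> e / 3"
    using infsum_finite_approximation[OF a(1), of "e / 3"] e by auto
  have sw: "(\<lambda>i. w k i * a i) summable_on A" for k A
    by (rule summable_on_real_bound[OF summable_on_subset_banach[OF a(1)]])
       (use a w in \<open>auto intro: mult_left_le_one_le simp: abs_mult\<close>)
  have tail: "infsum a (- F) \<le> e / 3"
  proof -
    have "infsum a UNIV = sum a F + infsum a (- F)"
      using infsum_Un_disjoint[of a F "- F"] F(1) summable_on_subset_banach[OF a(1), of "- F"] by simp
    then show ?thesis using F(2) by (simp add: dist_real_def)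
  qed
  have "(\<lambda>k. \<Sum>i\<in>F. w k i * a i) \<longlonglongrightarrow> (\<Sum>i\<in>F. 0 * a i)"
    by (intro tendsto_intros w)
  then obtain N where N: "\<And>k. k \<ge> N \<Longrightarrow> \<bar>\<Sum>i\<in>F. w k i * a i\<bar> < e / 3"
    using LIMSEQ_D[of _ _ "e / 3"] e by fastforce
  have "norm ((\<Sum>\<^sub>\<infinity>i. w k i * a i) - 0) < e" if k: "k \<ge> N" for k
  proof -
    have "(\<Sum>\<^sub>\<infinity>i. w k i * a i) = (\<Sum>i\<in>F. w k i * a i) + (\<Sum>\<^sub>\<infinity>i\<in>-F. w k i * a i)"
      using infsum_Un_disjoint[of "\<lambda>i. w k i * a i" F "- F"] F(1) sw by simp
    moreover have "(\<Sum>\<^sub>\<infinity>i\<in>-F. w k i * a i) \<le> infsum a (- F)"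
      by (intro infsum_mono sw summable_on_subset_banach[OF a(1)])
         (use a w in \<open>auto intro: mult_left_le_one_le\<close>)
    moreover have "0 \<le> (\<Sum>\<^sub>\<infinity>i\<in>-F. w k i * a i)" by (intro infsum_nonneg) (use a w in auto)
    ultimately show ?thesis using N[OF k] tail e by simp
  qed
  then show "\<exists>no. \<forall>n\<ge>no. norm ((\<Sum>\<^sub>\<infinity>i. w n i * a i) - 0) < e" by blast
qed

lemma infsum_ennreal:
  fixes f :: "'i \<Rightarrow> real"
  assumes "f summable_on UNIV" "\<And>i. 0 \<le> f i"
  shows "(\<Sum>\<^sub>\<infinity>i. ennreal (f i)) = ennreal (infsum f UNIV)"
proof -
  have "ennreal (infsum f UNIV) = (SUP F\<in>{F. finite F}. ennreal (sum f F))"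
    using infsum_nonneg_is_SUPREMUM_ennreal[of f UNIV] assms by simp
  also have "\<dots> = (SUP F\<in>{F. finite F}. (\<Sum>i\<in>F. ennreal (f i)))"
    by (intro SUP_cong) (auto simp: sum_ennreal assms)
  also have "\<dots> = (\<Sum>\<^sub>\<infinity>i. ennreal (f i))"
    by (subst nonneg_infsum_complete) auto
  finally show ?thesis ..
qed

lemma summable_on_of_ennreal_finite:
  fixes f :: "'i \<Rightarrow> real"
  assumes "(\<Sum>\<^sub>\<infinity>i. ennreal (f i)) < \<infinity>" "\<And>i. 0 \<le> f i"
  shows "f summable_on UNIV"
proof -
  obtain c where c: "(\<Sum>\<^sub>\<infinity>i. ennreal (f i)) = ennreal c" "0 \<le> c"
    using assms(1) by (metis less_top_ennreal infinity_ennreal_def)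
  show ?thesis
  proof (rule nonneg_bounded_partial_sums_imp_summable_on)
    show "\<forall>\<^sub>F F in finite_subsets_at_top UNIV. sum f F \<le> c"
    proof (rule eventually_finite_subsets_at_top_weakI)
      fix F :: "'i set" assume F: "finite F"
      have "ennreal (sum f F) = (\<Sum>i\<in>F. ennreal (f i))" by (simp add: sum_ennreal assms(2))
      also have "\<dots> \<le> (\<Sum>\<^sub>\<infinity>i. ennreal (f i))"
        unfolding nonneg_infsum_complete[of UNIV "\<lambda>i. ennreal (f i)", simplified]
        by (rule SUP_upper) (use F in simp)
      finally show "sum f F \<le> c" using c by simp
    qed
  qed (use assms in auto)
qed

text \<open>A minimising sequence for the distance is Cauchy by the parallelogram law, because
  midpoints stay in the subspace and so are no closer to \<open>f\<close> than the infimum.\<close>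

lemma closed_subspace_projection:
  fixes G :: "'h::{real_inner,banach} set"
  assumes G: "subspace G" "closed G"
  obtains p where "p \<in> G" "\<And>q. q \<in> G \<Longrightarrow> inner (f - p) q = 0"
proof -
  define d where "d = (INF q\<in>G. (norm (f - q))\<^sup>2)"
  have ne: "G \<noteq> {}" using subspace_0[OF G(1)] by auto
  have bdd: "bdd_below ((\<lambda>q. (norm (f - q))\<^sup>2) ` G)" by (intro bdd_belowI2[of _ 0]) simp
  have d_le: "d \<le> (norm (f - q))\<^sup>2" if "q \<in> G" for q
    unfolding d_def by (rule cINF_lower[OF bdd that])
  have "\<exists>q\<in>G. (norm (f - q))\<^sup>2 < d + 1 / Suc n" for n
  proof -
    have "(INF q\<in>G. (norm (f - q))\<^sup>2) < d + 1 / Suc n" unfolding d_def by simp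
    then show ?thesis using cINF_less_iff[OF ne bdd] by blast
  qed
  then obtain X where X: "\<And>n. X n \<in> G" "\<And>n. (norm (f - X n))\<^sup>2 < d + 1 / Suc n" by metis
  have close: "(norm (X m - X n))\<^sup>2 \<le> 2 / Suc m + 2 / Suc n" for m n
  proof -
    have "(1 / 2) *\<^sub>R (X m + X n) \<in> G" by (intro subspace_scale subspace_add G X)
    from d_le[OF this] have "d * 4 \<le> (norm (f - (1 / 2) *\<^sub>R (X m + X n)))\<^sup>2 * 4" by simp
    also have "\<dots> = (norm ((f - X m) + (f - X n)))\<^sup>2"
    proof -
      have "(f - X m) + (f - X n) = 2 *\<^sub>R (f - (1 / 2) *\<^sub>R (X m + X n))"
        by (simp add: algebra_simps scaleR_2)
      then show ?thesis by (simp only: norm_scaleR power_mult_distrib) simp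
    qed
    finally have "d * 4 \<le> (norm ((f - X m) + (f - X n)))\<^sup>2" .
    moreover have "(norm ((f - X m) + (f - X n)))\<^sup>2 + (norm (X m - X n))\<^sup>2
       = 2 * (norm (f - X m))\<^sup>2 + 2 * (norm (f - X n))\<^sup>2"
      by (simp add: power2_norm_eq_inner algebra_simps inner_commute)
    ultimately show ?thesis using X(2)[of m] X(2)[of n] by simp
  qed
  have "Cauchy X"
  proof (rule metric_CauchyI)
    fix e :: real assume e: "0 < e"
    obtain N :: nat where N: "4 / e\<^sup>2 < real N" using reals_Archimedean2 by blast
    have "dist (X m) (X n) < e" if mn: "m \<ge> N" "n \<ge> N" for m n
    proof -
      have N0: "0 < real N" using N e by (meson less_trans divide_pos_pos zero_less_numeral zero_less_power)
      have "2 / real (Suc m) \<le> 2 / real N" "2 / real (Suc n) \<le> 2 / real N"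
        using mn N0 by (auto intro!: divide_left_mono)
      then have "(norm (X m - X n))\<^sup>2 \<le> 4 / real N" using close[of m n] by simp
      also have "\<dots> < e\<^sup>2" using N e N0 by (simp add: field_simps)
      finally show ?thesis using e by (simp add: dist_norm power_less_imp_less_base)
    qed
    then show "\<exists>M. \<forall>m\<ge>M. \<forall>n\<ge>M. dist (X m) (X n) < e" by blast
  qed
  then obtain p where p: "X \<longlonglongrightarrow> p" using Cauchy_convergent_iff convergent_def by blast
  have pG: "p \<in> G" using closed_sequentially[OF G(2) _ p] X by blast
  have "(norm (f - p))\<^sup>2 \<le> d"
  proof (rule LIMSEQ_le)
    show "(\<lambda>n. (norm (f - X n))\<^sup>2) \<longlonglongrightarrow> (norm (f - p))\<^sup>2" by (intro tendsto_intros p)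
    have "(\<lambda>n. d + 1 / Suc n) \<longlonglongrightarrow> d + 0"
      by (rule tendsto_add[OF tendsto_const LIMSEQ_Suc[OF lim_const_over_n[of "1::real"]]])
    then show "(\<lambda>n. d + 1 / Suc n) \<longlonglongrightarrow> d" by simp
    show "\<exists>N. \<forall>n\<ge>N. (norm (f - X n))\<^sup>2 \<le> d + 1 / Suc n" using X(2) less_imp_le by blast
  qed
  then have pmin: "(norm (f - p))\<^sup>2 \<le> (norm (f - q))\<^sup>2" if "q \<in> G" for q
    using d_le[OF that] by linarith
  have "inner (f - p) q = 0" if q: "q \<in> G" for q
  proof -
    let ?b = "inner (f - p) q" and ?s = "inner q q"
    have *: "2 * t * ?b \<le> t\<^sup>2 * ?s" for t
    proof -
      have "p + t *\<^sub>R q \<in> G" by (intro subspace_scale subspace_add G pG q)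
      from pmin[OF this] show ?thesis
        unfolding power2_norm_eq_inner by (simp add: algebra_simps inner_commute power2_eq_square)
    qed
    show ?thesis
    proof (cases "?s = 0")
      case True
      then show ?thesis by simp
    next
      case False
      then have s: "?s > 0" using inner_ge_zero[of q] by linarith
      \<comment> \<open>The parameter t = b/s minimises the squared distance from \<open>f\<close>
        to the points p + tq.\<close>
      have "2 * (?b / ?s) * ?b \<le> (?b / ?s)\<^sup>2 * ?s" by (rule *)
      then have "?b * ?b \<le> 0" using s by (simp add: field_simps power2_eq_square)
      then show ?thesis by (auto simp: mult_le_0_iff)
    qed
  qed
  with pG that show ?thesis by blast
qed

section \<open>Weighted graphs\<close>

lemma infsum_swap_pairs:
  "(\<Sum>\<^sub>\<infinity>(x, y). F y x) = (\<Sum>\<^sub>\<infinity>(x, y). F x y)"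
  using infsum_reindex_bij_betw[of prod.swap UNIV UNIV "\<lambda>(x, y). F x y"]
  by (simp add: case_prod_unfold bij_swap)

lemma summable_swap_pairs:
  "(\<lambda>(x, y). F x y) summable_on UNIV \<Longrightarrow> (\<lambda>(x, y). F y x) summable_on UNIV"
  using summable_on_reindex_bij_betw[of prod.swap UNIV UNIV "\<lambda>(x, y). F x y"]
  by (simp add: case_prod_unfold bij_swap)

lemma infsum_pairs:
  fixes F :: "'a \<Rightarrow> 'b \<Rightarrow> real"
  assumes "(\<lambda>(x, y). F x y) summable_on UNIV"
  shows "(\<Sum>\<^sub>\<infinity>(x, y). F x y) = (\<Sum>\<^sub>\<infinity>x. \<Sum>\<^sub>\<infinity>y. F x y)"
  using infsum_Sigma'_banach[of F UNIV "\<lambda>_. UNIV"] assms by simp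

lemma summable_pairs_rows:
  fixes F :: "'a \<Rightarrow> 'b \<Rightarrow> real"
  assumes "(\<lambda>(x, y). F x y) summable_on UNIV"
  shows "(\<lambda>x. \<Sum>\<^sub>\<infinity>y. F x y) summable_on UNIV"
  using summable_on_Sigma_banach[of F UNIV "\<lambda>_. UNIV"] assms by simp

locale nondegenerate_graph = weighted_graph E \<mu> m
  for E :: "('v \<times> 'v) set" and \<mu> :: "'v \<Rightarrow> 'v \<Rightarrow> real" and m :: "'v \<Rightarrow> real" +
  fixes \<delta> :: real
  assumes finite_neighbours: "finite {y. (x, y) \<in> E}"
    and \<delta>_pos: "0 < \<delta>" and \<delta>_le: "\<delta> \<le> m x"
begin

abbreviation Lap :: "('v \<Rightarrow> real) \<Rightarrow> 'v \<Rightarrow> real" where "Lap \<equiv> laplacian \<mu> m"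
abbreviation Gam :: "('v \<Rightarrow> real) \<Rightarrow> ('v \<Rightarrow> real) \<Rightarrow> 'v \<Rightarrow> real" where "Gam \<equiv> grad \<mu> m"
abbreviation N :: "'v \<Rightarrow> 'v set" where "N x \<equiv> {y. (x, y) \<in> E}"

lemma m_pos: "0 < m x"
  using \<delta>_pos \<delta>_le[of x] by linarith

lemma infsum_neighbours: "(\<Sum>\<^sub>\<infinity>y. \<mu> x y * F y) = (\<Sum>y\<in>N x. \<mu> x y * F y)"
proof -
  have "(\<Sum>\<^sub>\<infinity>y. \<mu> x y * F y) = (\<Sum>\<^sub>\<infinity>y\<in>N x. \<mu> x y * F y)"
    by (rule infsum_cong_neutral) (auto simp: weight_off_edges)
  then show ?thesis using finite_neighbours by simp
qed

lemma Lap_sum: "m x * Lap f x = (\<Sum>y\<in>N x. \<mu> x y * (f y - f x))"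
  using m_pos[of x] by (simp add: laplacian_def infsum_neighbours)

lemma Gam_sum: "2 * m x * Gam f g x = (\<Sum>y\<in>N x. \<mu> x y * ((f y - f x) * (g y - g x)))"
proof -
  have "2 * m x * Gam f g x = m x * Lap (\<lambda>z. f z * g z) x - f x * (m x * Lap g x) - g x * (m x * Lap f x)"
    by (simp add: grad_def algebra_simps)
  also have "\<dots> = (\<Sum>y\<in>N x. \<mu> x y * ((f y - f x) * (g y - g x)))"
    unfolding Lap_sum sum_distrib_left sum_subtractf[symmetric]
    by (rule sum.cong) (auto simp: algebra_simps)
  finally show ?thesis .
qed

lemma Lap_eq: "Lap f x = (\<Sum>y\<in>N x. \<mu> x y * (f y - f x)) / m x"
  using Lap_sum[of x f] m_pos[of x] by (simp add: field_simps)

lemma Gam_eq: "Gam f g x = (\<Sum>y\<in>N x. \<mu> x y * ((f y - f x) * (g y - g x))) / (2 * m x)"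
  using Gam_sum[of x f g] m_pos[of x] by (simp add: field_simps)

lemma Gam_nonneg: "0 \<le> Gam f f x"
  unfolding Gam_eq using m_pos[of x] weight_nonneg by (intro divide_nonneg_pos sum_nonneg) auto

lemma Gam_bound: "2 * \<bar>Gam f g x\<bar> \<le> Gam f f x + Gam g g x"
proof -
  have le: "2 * (\<Sum>y\<in>N x. \<mu> x y * ((f y - f x) * (s * (g y - g x)))) \<le>
      (\<Sum>y\<in>N x. \<mu> x y * ((f y - f x) * (f y - f x))) + (\<Sum>y\<in>N x. \<mu> x y * ((g y - g x) * (g y - g x)))"
    if "s = 1 \<or> s = -1" for s
    unfolding sum_distrib_left sum.distrib[symmetric]
  proof (rule sum_mono)
    fix y
    have "2 * ((f y - f x) * (s * (g y - g x))) \<le> (f y - f x) * (f y - f x) + (g y - g x) * (g y - g x)"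
      using sum_squares_bound[of "f y - f x" "s * (g y - g x)"] that by (auto simp: power2_eq_square algebra_simps)
    from mult_left_mono[OF this weight_nonneg[of x y]]
    show "2 * (\<mu> x y * ((f y - f x) * (s * (g y - g x)))) \<le>
      \<mu> x y * ((f y - f x) * (f y - f x)) + \<mu> x y * ((g y - g x) * (g y - g x))"
      by (simp only: distrib_left mult.left_commute)
  qed
  have "2 * (2 * m x * Gam f g x) \<le> 2 * m x * Gam f f x + 2 * m x * Gam g g x"
    unfolding Gam_sum using le[of 1] by simp
  moreover have "2 * - (2 * m x * Gam f g x) \<le> 2 * m x * Gam f f x + 2 * m x * Gam g g x"
  proof -
    have "(\<Sum>y\<in>N x. \<mu> x y * ((f y - f x) * (- 1 * (g y - g x)))) = - (\<Sum>y\<in>N x. \<mu> x y * ((f y - f x) * (g y - g x)))"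
      unfolding sum_negf[symmetric] by (rule sum.cong) (auto simp: algebra_simps)
    then show ?thesis unfolding Gam_sum using le[of "-1"] by simp
  qed
  ultimately have "m x * (2 * Gam f g x) \<le> m x * (Gam f f x + Gam g g x)"
     "m x * (2 * - Gam f g x) \<le> m x * (Gam f f x + Gam g g x)" by (simp_all add: algebra_simps)
  then have "2 * Gam f g x \<le> Gam f f x + Gam g g x" "2 * - Gam f g x \<le> Gam f f x + Gam g g x"
    using m_pos[of x] mult_le_cancel_left_pos by blast+
  then show ?thesis by linarith
qed

subsection \<open>The Hilbert space of the graph\<close>

text \<open>\<open>emb\<close> and \<open>rep\<close> identify l2(V,m) isometrically with the
  unweighted space. Outside \<open>l2 m\<close> the value of \<open>emb\<close> is
  unspecified.\<close>

definition emb :: "('v \<Rightarrow> real) \<Rightarrow> 'v ell2" where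
  "emb f = Abs_ell2 (\<lambda>x. sqrt (m x) * f x)"

definition rep :: "'v ell2 \<Rightarrow> 'v \<Rightarrow> real" where
  "rep a x = coord a x / sqrt (m x)"

lemma sqrt_m_square: "(sqrt (m x) * c)\<^sup>2 = m x * c\<^sup>2"
  using m_pos[of x] by (simp add: power_mult_distrib)

lemma coord_emb: "f \<in> l2 m \<Longrightarrow> coord (emb f) x = sqrt (m x) * f x"
  unfolding emb_def by (subst Abs_ell2_inverse) (auto simp: l2_def sqrt_m_square)

lemma coord_rep: "coord a x = sqrt (m x) * rep a x"
  using m_pos[of x] by (simp add: rep_def)

lemma rep_l2: "rep a \<in> l2 m"
  using coord_summable[of a] by (simp add: l2_def coord_rep sqrt_m_square)

lemma rep_emb: "f \<in> l2 m \<Longrightarrow> rep (emb f) = f"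
  using m_pos by (auto simp: rep_def coord_emb fun_eq_iff less_imp_neq[symmetric])

lemma emb_rep: "emb (rep a) = a"
  by (rule ell2_eqI) (simp add: coord_emb rep_l2 coord_rep[symmetric])

lemma rep_add: "rep (a + b) x = rep a x + rep b x"
  and rep_diff: "rep (a - b) x = rep a x - rep b x"
  and rep_scale: "rep (c *\<^sub>R a) x = c * rep a x"
  and rep_0: "rep 0 x = 0"
  by (simp_all add: rep_def add_divide_distrib diff_divide_distrib)

lemma bounded_linear_rep: "bounded_linear (\<lambda>a. rep a x)"
  unfolding rep_def
  using bounded_linear_compose[OF bounded_linear_divide bounded_linear_coord] .

lemmas tendsto_rep = bounded_linear.tendsto[OF bounded_linear_rep]

lemma emb_eqI: "(\<And>x. rep a x = f x) \<Longrightarrow> emb f = a"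
  using emb_rep by (metis ext)

lemma l2_lin:
  assumes "f \<in> l2 m" "g \<in> l2 m"
  shows "(\<lambda>x. a * f x + b * g x) \<in> l2 m" "emb (\<lambda>x. a * f x + b * g x) = a *\<^sub>R emb f + b *\<^sub>R emb g"
proof -
  have e: "(\<lambda>x. a * f x + b * g x) = rep (a *\<^sub>R emb f + b *\<^sub>R emb g)"
    by (simp add: fun_eq_iff rep_add rep_scale rep_emb assms)
  show "(\<lambda>x. a * f x + b * g x) \<in> l2 m" unfolding e by (rule rep_l2)
  show "emb (\<lambda>x. a * f x + b * g x) = a *\<^sub>R emb f + b *\<^sub>R emb g" unfolding e by (rule emb_rep)
qed

lemma l2_diff:
  assumes "f \<in> l2 m" "g \<in> l2 m"
  shows "(\<lambda>x. f x - g x) \<in> l2 m" "emb (\<lambda>x. f x - g x) = emb f - emb g"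
  using l2_lin[OF assms, of 1 "-1"] by simp_all

lemma inner_emb: "f \<in> l2 m \<Longrightarrow> g \<in> l2 m \<Longrightarrow> inner (emb f) (emb g) = l2_inner m f g"
  unfolding inner_ell2_def l2_inner_def
  by (rule infsum_cong) (use m_pos in \<open>simp add: coord_emb less_imp_le\<close>)

lemma inner_rep: "inner a b = (\<Sum>\<^sub>\<infinity>x. m x * rep a x * rep b x)"
  using inner_emb[OF rep_l2 rep_l2, of a b] by (simp add: emb_rep l2_inner_def)

lemma inner_rep_summable: "(\<lambda>x. m x * rep a x * rep b x) summable_on UNIV"
proof -
  have "(\<lambda>x. m x * rep a x * rep b x) = (\<lambda>x. coord a x * coord b x)"
    using m_pos by (auto simp: fun_eq_iff coord_rep less_imp_le)
  then show ?thesis by (simp add: coord_mult_summable)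
qed

lemma norm_emb: "f \<in> l2 m \<Longrightarrow> norm (emb f) = l2_norm m f"
  by (simp add: norm_eq_sqrt_inner inner_emb l2_inner_def l2_norm_def power2_eq_square mult.assoc)

lemma l2_norm_rep: "l2_norm m (rep a) = norm a"
  by (simp add: norm_emb[symmetric] rep_l2 emb_rep)

lemma l2_bounded: "\<bar>rep a x\<bar> \<le> norm a / sqrt \<delta>"
proof -
  have "\<bar>rep a x\<bar> = \<bar>coord a x\<bar> / sqrt (m x)" using m_pos[of x] by (simp add: rep_def abs_mult)
  also have "\<dots> \<le> norm a / sqrt \<delta>"
    using coord_le_norm \<delta>_pos \<delta>_le by (intro frac_le) auto
  finally show ?thesis .
qed

lemma l2_dominated:
  assumes "f \<in> l2 m" "\<And>x. \<bar>g x\<bar> \<le> c * \<bar>f x\<bar>" shows "g \<in> l2 m"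
proof -
  have "(\<lambda>x. c\<^sup>2 * (m x * (f x)\<^sup>2)) summable_on UNIV"
    using assms(1) by (intro summable_on_cmult_right) (simp add: l2_def)
  then have "(\<lambda>x. m x * (g x)\<^sup>2) summable_on UNIV"
  proof (rule summable_on_comparison_test)
    fix x
    have "(g x)\<^sup>2 \<le> (c * \<bar>f x\<bar>)\<^sup>2" using assms(2)[of x] by (metis abs_ge_zero power2_abs power_mono)
    then have "m x * (g x)\<^sup>2 \<le> m x * (c * \<bar>f x\<bar>)\<^sup>2" by (intro mult_left_mono measure_nonneg)
    then show "m x * (g x)\<^sup>2 \<le> c\<^sup>2 * (m x * (f x)\<^sup>2)" by (simp add: power_mult_distrib mult_ac)
  qed (use measure_nonneg in simp)
  then show ?thesis by (simp add: l2_def)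
qed

lemma l2_bound_exists: "f \<in> l2 m \<Longrightarrow> \<exists>B\<ge>0. \<forall>x. \<bar>f x\<bar> \<le> B"
  using l2_bounded[of "emb f"] \<delta>_pos by (intro exI[of _ "norm (emb f) / sqrt \<delta>"]) (auto simp: rep_emb)

lemma l2_bounded_range: "f \<in> l2 m \<Longrightarrow> bounded (range f)"
  using l2_bound_exists[of f] by (auto simp: bounded_iff)

lemma l2_mult:
  assumes "f \<in> l2 m" "g \<in> l2 m" shows "(\<lambda>x. f x * g x) \<in> l2 m"
proof -
  obtain B where "\<And>x. \<bar>f x\<bar> \<le> B" using l2_bound_exists[OF assms(1)] by blast
  then show ?thesis by (intro l2_dominated[OF assms(2), of _ B]) (simp add: abs_mult mult_right_mono)
qed

text \<open>Nondegeneracy bounds the supremum norm by the norm of \<open>l\<^sup>2\<close>; this makes \<open>l\<^sup>2\<close> an algebra.\<close>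

definition mul :: "'v ell2 \<Rightarrow> 'v ell2 \<Rightarrow> 'v ell2" where
  "mul a b = emb (\<lambda>x. rep a x * rep b x)"

lemma rep_mul: "rep (mul a b) x = rep a x * rep b x"
  by (simp add: mul_def rep_emb l2_mult rep_l2)

text \<open>The constant 1 / sqrt \<delta> is the sup-norm bound for one factor. As a bounded
  bilinear map, \<open>mul\<close> has a product rule along differentiable orbits.\<close>

lemma bounded_bilinear_mul: "bounded_bilinear mul"
proof
  fix a b c :: "'v ell2" and r :: real
  have eq: "a = b" if "\<And>x. rep a x = rep b x" for a b using that emb_rep by (metis ext)
  show "mul (a + b) c = mul a c + mul b c" "mul a (b + c) = mul a b + mul a c"
    "mul (r *\<^sub>R a) b = r *\<^sub>R mul a b" "mul a (r *\<^sub>R b) = r *\<^sub>R mul a b"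
    by (rule eq; simp add: rep_mul rep_add rep_scale algebra_simps)+
  show "\<exists>K. \<forall>a b. norm (mul a b) \<le> norm a * norm b * K"
  proof (intro exI allI)
    fix a b
    show "norm (mul a b) \<le> norm a * norm b * (1 / sqrt \<delta>)"
    proof (rule norm_ell2_le)
      fix F :: "'v set" assume F: "finite F"
      have "(\<Sum>x\<in>F. (coord (mul a b) x)\<^sup>2) \<le> (\<Sum>x\<in>F. (norm a / sqrt \<delta>)\<^sup>2 * (coord b x)\<^sup>2)"
      proof (rule sum_mono)
        fix x
        have "(rep a x)\<^sup>2 \<le> (norm a / sqrt \<delta>)\<^sup>2"
          using l2_bounded[of a x] by (metis abs_ge_zero power2_abs power_mono)
        moreover have "coord (mul a b) x = rep a x * coord b x" by (simp add: coord_rep rep_mul)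
        ultimately show "(coord (mul a b) x)\<^sup>2 \<le> (norm a / sqrt \<delta>)\<^sup>2 * (coord b x)\<^sup>2"
          by (simp add: power_mult_distrib mult_right_mono)
      qed
      also have "\<dots> \<le> (norm a / sqrt \<delta>)\<^sup>2 * (norm b)\<^sup>2"
        unfolding sum_distrib_left[symmetric] by (intro mult_left_mono sum_coord_le_norm F) simp
      finally show "(\<Sum>x\<in>F. (coord (mul a b) x)\<^sup>2) \<le> (norm a * norm b * (1 / sqrt \<delta>))\<^sup>2"
        by (simp add: power_mult_distrib power_divide mult_ac)
    qed (use \<delta>_pos in simp)
  qed
qed

lemma mul_commute: "mul a b = mul b a"
  by (simp add: mul_def mult.commute)

lemma inner_mul: "inner (mul a b) c = inner a (mul b c)"
  by (simp add: inner_rep rep_mul mult_ac)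

subsection \<open>Functions of finite energy\<close>

definition finite_energy :: "('v \<Rightarrow> real) \<Rightarrow> bool" where
  "finite_energy f \<longleftrightarrow> (\<lambda>(x, y). \<mu> x y * (f y - f x)\<^sup>2) summable_on UNIV"

text \<open>The discrete gradient as a vector indexed by ordered pairs. Each edge between distinct
  vertices occurs in both orientations, whence the factor 1/2 in \<open>form\<close>.\<close>

definition dif :: "('v \<Rightarrow> real) \<Rightarrow> ('v \<times> 'v) ell2" where
  "dif f = Abs_ell2 (\<lambda>(x, y). sqrt (\<mu> x y) * (f y - f x))"

lemma sqrt_weight_square: "(sqrt (\<mu> x y) * c)\<^sup>2 = \<mu> x y * c\<^sup>2"
  using weight_nonneg[of x y] by (simp add: power_mult_distrib)

lemma coord_dif: "finite_energy f \<Longrightarrow> coord (dif f) (x, y) = sqrt (\<mu> x y) * (f y - f x)"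
  unfolding dif_def
  by (subst Abs_ell2_inverse) (auto simp: finite_energy_def case_prod_unfold sqrt_weight_square)

text \<open>Being a gradient is a condition on single coordinates. This gives linearity of
  \<open>dif\<close>, and also closedness of its graph, because coordinates are continuous.\<close>

lemma finite_energy_of_coord:
  assumes "\<And>x y. coord p (x, y) = sqrt (\<mu> x y) * (f y - f x)"
  shows "finite_energy f" "dif f = p"
proof -
  have c: "coord p = (\<lambda>(x, y). sqrt (\<mu> x y) * (f y - f x))" using assms by auto
  show "finite_energy f"
    using coord_summable[of p] unfolding c finite_energy_def by (simp add: case_prod_unfold sqrt_weight_square)
  show "dif f = p" unfolding dif_def c[symmetric] by (rule coord_inverse)
qed

definition DQ :: "('v \<Rightarrow> real) set" where
  "DQ = {f \<in> l2 m. finite_energy f}"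

definition form :: "('v \<Rightarrow> real) \<Rightarrow> ('v \<Rightarrow> real) \<Rightarrow> real" where
  "form f g = inner (dif f) (dif g) / 2"

lemma DQ_l2: "f \<in> DQ \<Longrightarrow> f \<in> l2 m" by (simp add: DQ_def)
lemma DQ_energy: "f \<in> DQ \<Longrightarrow> finite_energy f" by (simp add: DQ_def)

lemma form_sum:
  assumes "finite_energy f" "finite_energy g"
  shows "form f g = 1 / 2 * (\<Sum>\<^sub>\<infinity>(x, y). \<mu> x y * ((f y - f x) * (g y - g x)))"
    and "(\<lambda>(x, y). \<mu> x y * ((f y - f x) * (g y - g x))) summable_on UNIV"
proof -
  have e: "(\<lambda>z. coord (dif f) z * coord (dif g) z) = (\<lambda>(x, y). \<mu> x y * ((f y - f x) * (g y - g x)))"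
    using weight_nonneg by (auto simp: fun_eq_iff coord_dif assms)
  show "form f g = 1 / 2 * (\<Sum>\<^sub>\<infinity>(x, y). \<mu> x y * ((f y - f x) * (g y - g x)))"
    by (simp add: form_def inner_ell2_def e)
  show "(\<lambda>(x, y). \<mu> x y * ((f y - f x) * (g y - g x))) summable_on UNIV"
    using coord_mult_summable[of "dif f" "dif g"] unfolding e .
qed

lemma form_eq: "finite_energy f \<Longrightarrow> finite_energy g \<Longrightarrow> dirichlet_form \<mu> f g = form f g"
  by (simp add: form_sum dirichlet_form_def mult.assoc)

lemma form_nonneg: "0 \<le> form f f" by (simp add: form_def)

lemma form_commute: "form f g = form g f" by (simp add: form_def inner_commute)

lemma dif_lin:
  assumes "finite_energy f" "finite_energy g"
  shows "finite_energy (\<lambda>x. a * f x + b * g x)" "dif (\<lambda>x. a * f x + b * g x) = a *\<^sub>R dif f + b *\<^sub>R dif g"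
  by (rule finite_energy_of_coord[of "a *\<^sub>R dif f + b *\<^sub>R dif g"];
      simp add: coord_dif assms algebra_simps)+

lemma dif_diff:
  assumes "finite_energy f" "finite_energy g"
  shows "finite_energy (\<lambda>x. f x - g x)" "dif (\<lambda>x. f x - g x) = dif f - dif g"
  using dif_lin[OF assms, of 1 "-1"] by simp_all

lemma DQ_lin: "f \<in> DQ \<Longrightarrow> g \<in> DQ \<Longrightarrow> (\<lambda>x. a * f x + b * g x) \<in> DQ"
  by (simp add: DQ_def l2_lin dif_lin)

text \<open>Increments controlled by those of two functions of finite energy; this covers products
  of bounded functions as well as negative parts.\<close>

lemma finite_energy_dominated:
  assumes "finite_energy f" "finite_energy g"
    "\<And>x y. \<bar>h y - h x\<bar> \<le> a * \<bar>f y - f x\<bar> + b * \<bar>g y - g x\<bar>"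
  shows "finite_energy h"
proof -
  have "(\<lambda>z. 2 * a\<^sup>2 * (\<lambda>(x, y). \<mu> x y * (f y - f x)\<^sup>2) z
          + 2 * b\<^sup>2 * (\<lambda>(x, y). \<mu> x y * (g y - g x)\<^sup>2) z) summable_on UNIV"
    using assms(1,2) unfolding finite_energy_def
    by (intro summable_on_add summable_on_cmult_right)
  then show ?thesis unfolding finite_energy_def
  proof (rule summable_on_comparison_test; clarify)
    fix x y
    have "(h y - h x)\<^sup>2 \<le> (a * \<bar>f y - f x\<bar> + b * \<bar>g y - g x\<bar>)\<^sup>2"
      using assms(3)[of y x] by (metis abs_ge_zero power2_abs power_mono)
    also have "\<dots> \<le> 2 * (a * \<bar>f y - f x\<bar>)\<^sup>2 + 2 * (b * \<bar>g y - g x\<bar>)\<^sup>2"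
      using sum_squares_bound[of "a * \<bar>f y - f x\<bar>" "b * \<bar>g y - g x\<bar>"] by (simp add: power2_sum)
    finally have "\<mu> x y * (h y - h x)\<^sup>2 \<le> \<mu> x y * (2 * (a * \<bar>f y - f x\<bar>)\<^sup>2 + 2 * (b * \<bar>g y - g x\<bar>)\<^sup>2)"
      by (intro mult_left_mono weight_nonneg)
    then show "\<mu> x y * (h y - h x)\<^sup>2 \<le> 2 * a\<^sup>2 * (\<mu> x y * (f y - f x)\<^sup>2) + 2 * b\<^sup>2 * (\<mu> x y * (g y - g x)\<^sup>2)"
      by (simp add: power_mult_distrib algebra_simps)
    show "0 \<le> \<mu> x y * (h y - h x)\<^sup>2" using weight_nonneg by simp
  qed
qed

lemma DQ_mult:
  assumes "f \<in> DQ" "g \<in> DQ" shows "(\<lambda>x. f x * g x) \<in> DQ"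
proof -
  obtain B C where B: "\<And>x. \<bar>f x\<bar> \<le> B" and C: "\<And>x. \<bar>g x\<bar> \<le> C"
    using l2_bound_exists assms DQ_l2 by metis
  have "finite_energy (\<lambda>x. f x * g x)"
  proof (rule finite_energy_dominated[OF DQ_energy[OF assms(1)] DQ_energy[OF assms(2)]])
    fix x y
    have "f y * g y - f x * g x = g y * (f y - f x) + f x * (g y - g x)" by (simp add: algebra_simps)
    also have "\<bar>\<dots>\<bar> \<le> \<bar>g y\<bar> * \<bar>f y - f x\<bar> + \<bar>f x\<bar> * \<bar>g y - g x\<bar>"
      by (metis abs_mult abs_triangle_ineq)
    also have "\<dots> \<le> C * \<bar>f y - f x\<bar> + B * \<bar>g y - g x\<bar>"
      using B C by (intro add_mono mult_right_mono) auto
    finally show "\<bar>f y * g y - f x * g x\<bar> \<le> C * \<bar>f y - f x\<bar> + B * \<bar>g y - g x\<bar>" .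
  qed
  then show ?thesis using assms by (simp add: DQ_def l2_mult)
qed

lemma finsupp_l2: "f \<in> finsupp \<Longrightarrow> f \<in> l2 m"
  unfolding finsupp_def l2_def mem_Collect_eq
  by (rule finite_nonzero_values_imp_summable_on) (erule rev_finite_subset, auto)

lemma finite_pairs:
  assumes "f \<in> finsupp"
  shows "finite {(x, y). \<mu> x y \<noteq> 0 \<and> (f x \<noteq> 0 \<or> f y \<noteq> 0)}"
proof -
  let ?S = "{x. f x \<noteq> 0}"
  let ?P = "SIGMA x:?S. N x"
  have "finite ?P" using assms finite_neighbours by (intro finite_SigmaI) (auto simp: finsupp_def)
  moreover have "{(x, y). \<mu> x y \<noteq> 0 \<and> (f x \<noteq> 0 \<or> f y \<noteq> 0)} \<subseteq> ?P \<union> prod.swap ` ?P"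
  proof
    fix z assume z: "z \<in> {(x, y). \<mu> x y \<noteq> 0 \<and> (f x \<noteq> 0 \<or> f y \<noteq> 0)}"
    obtain x y where xy: "z = (x, y)" by (cases z)
    have "\<mu> x y \<noteq> 0" using z xy by simp
    moreover then have "\<mu> y x \<noteq> 0" using weight_sym[of x y] by simp
    ultimately have "(x, y) \<in> E" "(y, x) \<in> E" using weight_off_edges by blast+
    then have "(x, y) \<in> ?P \<or> (y, x) \<in> ?P" using z xy by auto
    then show "z \<in> ?P \<union> prod.swap ` ?P" using xy by (metis UnI1 UnI2 imageI swap_simp)
  qed
  ultimately show ?thesis by (meson finite_UnI finite_imageI rev_finite_subset)
qed

lemma finsupp_pair_summable:
  assumes "f \<in> finsupp" "\<And>x y. f x = 0 \<Longrightarrow> f y = 0 \<Longrightarrow> F x y = 0"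
  shows "(\<lambda>(x, y). \<mu> x y * F x y) summable_on UNIV"
  by (rule finite_nonzero_values_imp_summable_on, rule rev_finite_subset[OF finite_pairs[OF assms(1)]])
     (use assms(2) in auto)

lemma finsupp_DQ: "f \<in> finsupp \<Longrightarrow> f \<in> DQ"
  unfolding DQ_def finite_energy_def mem_Collect_eq
  by (intro conjI finsupp_l2 finsupp_pair_summable[where F = "\<lambda>x y. (f y - f x)\<^sup>2"]) auto

lemma finsupp_Lap: "f \<in> finsupp \<Longrightarrow> Lap f \<in> finsupp"
proof -
  assume f: "f \<in> finsupp"
  have "{x. Lap f x \<noteq> 0} \<subseteq> fst ` {(x, y). \<mu> x y \<noteq> 0 \<and> (f x \<noteq> 0 \<or> f y \<noteq> 0)}"
  proof
    fix x assume "x \<in> {x. Lap f x \<noteq> 0}"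
    then have "(\<Sum>y\<in>N x. \<mu> x y * (f y - f x)) \<noteq> 0" by (simp add: Lap_eq)
    then obtain y where "\<mu> x y * (f y - f x) \<noteq> 0" by (meson sum.neutral)
    then have "(x, y) \<in> {(x, y). \<mu> x y \<noteq> 0 \<and> (f x \<noteq> 0 \<or> f y \<noteq> 0)}" by auto
    then show "x \<in> fst ` {(x, y). \<mu> x y \<noteq> 0 \<and> (f x \<noteq> 0 \<or> f y \<noteq> 0)}" by force
  qed
  then show ?thesis unfolding finsupp_def mem_Collect_eq
    by (rule finite_subset[OF _ finite_imageI[OF finite_pairs[OF f]]])
qed

lemma finsupp_mult: "f \<in> finsupp \<Longrightarrow> (\<lambda>x. f x * g x) \<in> finsupp"
  unfolding finsupp_def mem_Collect_eq by (erule rev_finite_subset) auto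

lemma finsupp_lin: "f \<in> finsupp \<Longrightarrow> g \<in> finsupp \<Longrightarrow> (\<lambda>x. a * f x + b * g x) \<in> finsupp"
proof -
  assume "f \<in> finsupp" "g \<in> finsupp"
  then have "finite ({x. f x \<noteq> 0} \<union> {x. g x \<noteq> 0})" by (simp add: finsupp_def)
  then show ?thesis unfolding finsupp_def mem_Collect_eq by (rule rev_finite_subset) auto
qed

lemma finsupp_Gam: "f \<in> finsupp \<Longrightarrow> Gam f f \<in> finsupp"
proof -
  assume f: "f \<in> finsupp"
  have "Gam f f = (\<lambda>x. 1 / 2 * Lap (\<lambda>z. f z * f z) x + (- 1) * (f x * Lap f x))"
    by (simp add: grad_def fun_eq_iff)
  then show ?thesis
    using finsupp_lin[OF finsupp_Lap[OF finsupp_mult[OF f, of f]] finsupp_mult[OF f, of "Lap f"], of "1/2" "-1"] by simp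
qed

text \<open>Summation by parts: the sum over pairs is averaged with its copy under exchange of x and
  y. Summability of the one-sided expression justifies summing by rows and the exchange.\<close>

lemma green:
  assumes "(\<lambda>(x, y). \<mu> x y * (u x * (f y - f x))) summable_on UNIV"
  shows "(\<Sum>\<^sub>\<infinity>x. m x * u x * Lap f x) = - (1 / 2 * (\<Sum>\<^sub>\<infinity>(x, y). \<mu> x y * ((u y - u x) * (f y - f x))))"
proof -
  let ?F = "\<lambda>x y. \<mu> x y * (u x * (f y - f x))"
  have "(\<Sum>\<^sub>\<infinity>y. ?F x y) = m x * u x * Lap f x" for x
  proof -
    have "(\<Sum>\<^sub>\<infinity>y. ?F x y) = u x * (\<Sum>y\<in>N x. \<mu> x y * (f y - f x))"
      unfolding infsum_neighbours sum_distrib_left by (simp only: mult.left_commute)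
    then show ?thesis unfolding Lap_sum[symmetric] by (simp only: mult_ac)
  qed
  then have 1: "(\<Sum>\<^sub>\<infinity>x. m x * u x * Lap f x) = (\<Sum>\<^sub>\<infinity>(x, y). ?F x y)"
    using infsum_pairs[OF assms] by simp
  have "(\<Sum>\<^sub>\<infinity>(x, y). ?F x y) + (\<Sum>\<^sub>\<infinity>(x, y). ?F x y) = (\<Sum>\<^sub>\<infinity>(x, y). ?F x y) + (\<Sum>\<^sub>\<infinity>(x, y). ?F y x)"
    by (simp only: infsum_swap_pairs[of ?F])
  also have "\<dots> = (\<Sum>\<^sub>\<infinity>z. (\<lambda>(x, y). ?F x y) z + (\<lambda>(x, y). ?F y x) z)"
    by (rule infsum_add[symmetric, OF assms summable_swap_pairs[OF assms]])
  also have "\<dots> = (\<Sum>\<^sub>\<infinity>z. - (\<lambda>(x, y). \<mu> x y * ((u y - u x) * (f y - f x))) z)"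
    by (intro infsum_cong) (auto simp: weight_sym algebra_simps)
  finally show ?thesis unfolding 1 infsum_uminus by simp
qed

text \<open>Local finiteness leaves finitely many edges meeting the support of \<open>f\<close>, so
  \<open>u\<close> may be arbitrary; in particular it may be the squared gradient of any
  function.\<close>

lemma green_finsupp:
  assumes "f \<in> finsupp"
  shows "(\<Sum>\<^sub>\<infinity>x. m x * f x * Lap u x) = - (1 / 2 * (\<Sum>\<^sub>\<infinity>(x, y). \<mu> x y * ((f y - f x) * (u y - u x))))"
    and "(\<Sum>\<^sub>\<infinity>x. m x * u x * Lap f x) = - (1 / 2 * (\<Sum>\<^sub>\<infinity>(x, y). \<mu> x y * ((f y - f x) * (u y - u x))))"
proof -
  show "(\<Sum>\<^sub>\<infinity>x. m x * f x * Lap u x) = - (1 / 2 * (\<Sum>\<^sub>\<infinity>(x, y). \<mu> x y * ((f y - f x) * (u y - u x))))"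
    by (rule green, rule finsupp_pair_summable[OF assms]) simp
  have "(\<Sum>\<^sub>\<infinity>x. m x * u x * Lap f x) = - (1 / 2 * (\<Sum>\<^sub>\<infinity>(x, y). \<mu> x y * ((u y - u x) * (f y - f x))))"
    by (rule green, rule finsupp_pair_summable[OF assms]) simp
  then show "(\<Sum>\<^sub>\<infinity>x. m x * u x * Lap f x) = - (1 / 2 * (\<Sum>\<^sub>\<infinity>(x, y). \<mu> x y * ((f y - f x) * (u y - u x))))"
    by (simp only: mult.commute[of "u _ - u _"])
qed

end

subsection \<open>Cutoff functions\<close>

text \<open>The gradient clause is \<Gamma>(\<eta> k) \<le> 1 / (k+1) multiplied by 2m(x).\<close>

locale cutoff_graph = nondegenerate_graph E \<mu> m \<delta>
  for E :: "('v \<times> 'v) set" and \<mu> :: "'v \<Rightarrow> 'v \<Rightarrow> real" and m :: "'v \<Rightarrow> real" and \<delta> :: real +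
  fixes \<eta> :: "nat \<Rightarrow> 'v \<Rightarrow> real"
  assumes \<eta>_nonneg: "0 \<le> \<eta> k x" and \<eta>_le_1: "\<eta> k x \<le> 1"
    and \<eta>_finsupp: "\<eta> k \<in> finsupp"
    and \<eta>_lim: "(\<lambda>k. \<eta> k x) \<longlonglongrightarrow> 1"
    and \<eta>_gradient: "(\<Sum>y | (x, y) \<in> E. \<mu> x y * (\<eta> k y - \<eta> k x)\<^sup>2) \<le> 2 * m x / Suc k"
begin

text \<open>This is the error term in the product rule for \<eta> f. In the row of x the factor
  \<open>(f x)\<^sup>2\<close> is constant, so the gradient bound of the cutoff applies
  directly.\<close>

lemma cutoff_cross:
  assumes f: "f \<in> l2 m"
  shows "(\<lambda>(x, y). \<mu> x y * ((\<eta> k y - \<eta> k x)\<^sup>2 * (f x)\<^sup>2)) summable_on UNIV"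
    and "(\<Sum>\<^sub>\<infinity>(x, y). \<mu> x y * ((\<eta> k y - \<eta> k x)\<^sup>2 * (f x)\<^sup>2)) \<le> 2 / Suc k * (norm (emb f))\<^sup>2"
proof -
  let ?F = "\<lambda>x y. \<mu> x y * ((\<eta> k y - \<eta> k x)\<^sup>2 * (f x)\<^sup>2)"
  show s: "(\<lambda>(x, y). ?F x y) summable_on UNIV"
    by (rule finsupp_pair_summable[OF \<eta>_finsupp[of k]]) simp
  have mf: "(\<lambda>x. m x * (f x)\<^sup>2) summable_on UNIV" using f by (simp add: l2_def)
  have "(\<Sum>\<^sub>\<infinity>(x, y). ?F x y) = (\<Sum>\<^sub>\<infinity>x. \<Sum>\<^sub>\<infinity>y. ?F x y)" by (rule infsum_pairs[OF s])
  also have "\<dots> \<le> (\<Sum>\<^sub>\<infinity>x. 2 / Suc k * (m x * (f x)\<^sup>2))"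
  proof (rule infsum_mono[OF summable_pairs_rows[OF s] summable_on_cmult_right[OF mf]])
    fix x
    have "(\<Sum>\<^sub>\<infinity>y. ?F x y) = (f x)\<^sup>2 * (\<Sum>y\<in>N x. \<mu> x y * (\<eta> k y - \<eta> k x)\<^sup>2)"
      unfolding infsum_neighbours sum_distrib_left by (simp only: mult_ac)
    also have "\<dots> \<le> (f x)\<^sup>2 * (2 * m x / Suc k)"
      by (intro mult_left_mono \<eta>_gradient) simp
    finally show "(\<Sum>\<^sub>\<infinity>y. ?F x y) \<le> 2 / Suc k * (m x * (f x)\<^sup>2)" by (simp add: mult_ac)
  qed
  also have "\<dots> = 2 / Suc k * (\<Sum>\<^sub>\<infinity>x. m x * (f x)\<^sup>2)" by (rule infsum_cmult_right[OF mf])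
  also have "(\<Sum>\<^sub>\<infinity>x. m x * (f x)\<^sup>2) = (norm (emb f))\<^sup>2"
    unfolding norm_ell2_square by (simp add: coord_emb f sqrt_m_square)
  finally show "(\<Sum>\<^sub>\<infinity>(x, y). ?F x y) \<le> 2 / Suc k * (norm (emb f))\<^sup>2" .
qed

lemma cutoff_finsupp: "(\<lambda>x. \<eta> k x * f x) \<in> finsupp"
  by (rule finsupp_mult[OF \<eta>_finsupp])

lemma tendsto_of_norm_square:
  fixes X :: "nat \<Rightarrow> 'b::real_normed_vector"
  assumes "(\<lambda>k. (norm (X k - a))\<^sup>2) \<longlonglongrightarrow> 0" shows "X \<longlonglongrightarrow> a"
proof -
  have "(\<lambda>k. sqrt ((norm (X k - a))\<^sup>2)) \<longlonglongrightarrow> sqrt 0" by (intro tendsto_intros assms)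
  then have "(\<lambda>k. norm (X k - a)) \<longlonglongrightarrow> 0" by simp
  then show ?thesis by (simp add: tendsto_norm_zero_iff LIM_zero_iff)
qed

lemma one_minus_cutoff: "0 \<le> (1 - \<eta> k x)\<^sup>2" "(1 - \<eta> k x)\<^sup>2 \<le> 1" "(\<lambda>k. (1 - \<eta> k x)\<^sup>2) \<longlonglongrightarrow> 0"
proof -
  show "0 \<le> (1 - \<eta> k x)\<^sup>2" by simp
  show "(1 - \<eta> k x)\<^sup>2 \<le> 1" using \<eta>_nonneg[of k x] \<eta>_le_1[of k x] by (intro power_le_one) auto
  have "(\<lambda>k. (1 - \<eta> k x)\<^sup>2) \<longlonglongrightarrow> (1 - 1)\<^sup>2" by (intro tendsto_intros \<eta>_lim)
  then show "(\<lambda>k. (1 - \<eta> k x)\<^sup>2) \<longlonglongrightarrow> 0" by simp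
qed

lemma cutoff_l2_tendsto:
  assumes f: "f \<in> l2 m" shows "(\<lambda>k. emb (\<lambda>x. \<eta> k x * f x)) \<longlonglongrightarrow> emb f"
proof (rule tendsto_of_norm_square)
  have "(norm (emb (\<lambda>x. \<eta> k x * f x) - emb f))\<^sup>2 = (\<Sum>\<^sub>\<infinity>x. (1 - \<eta> k x)\<^sup>2 * (coord (emb f) x)\<^sup>2)" for k
    unfolding norm_ell2_square
  proof (rule infsum_cong)
    fix x
    have "coord (emb (\<lambda>x. \<eta> k x * f x) - emb f) x = - ((1 - \<eta> k x) * coord (emb f) x)"
      unfolding minus_ell2.rep_eq coord_emb[OF f] coord_emb[OF finsupp_l2[OF cutoff_finsupp]]
      by (simp add: algebra_simps)
    then show "(coord (emb (\<lambda>x. \<eta> k x * f x) - emb f) x)\<^sup>2 = (1 - \<eta> k x)\<^sup>2 * (coord (emb f) x)\<^sup>2"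
      by (simp only: power2_minus power_mult_distrib)
  qed
  then show "(\<lambda>k. (norm (emb (\<lambda>x. \<eta> k x * f x) - emb f))\<^sup>2) \<longlonglongrightarrow> 0"
    using infsum_dominated_tendsto_0[OF coord_summable _ one_minus_cutoff, of "emb f" id] by simp
qed

lemma cutoff_dif_tendsto:
  assumes f: "f \<in> DQ" shows "(\<lambda>k. dif (\<lambda>x. \<eta> k x * f x)) \<longlonglongrightarrow> dif f"
proof (rule tendsto_of_norm_square)
  note fe = DQ_energy[OF f] DQ_energy[OF finsupp_DQ[OF cutoff_finsupp]]
  let ?a = "\<lambda>z. (coord (dif f) z)\<^sup>2"
  let ?w = "\<lambda>k z. (1 - \<eta> k (snd z))\<^sup>2"
  have sw: "(\<lambda>z. ?w k z * ?a z) summable_on UNIV" for k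
    by (rule summable_on_real_bound[OF coord_summable[of "dif f"]])
       (simp add: abs_mult one_minus_cutoff mult_left_le_one_le)
  have "(\<lambda>k. \<Sum>\<^sub>\<infinity>z. ?w k z * ?a z) \<longlonglongrightarrow> 0"
    by (rule infsum_dominated_tendsto_0[OF coord_summable _ one_minus_cutoff]) simp
  moreover have "(\<lambda>k. 2 / Suc k * (norm (emb f))\<^sup>2) \<longlonglongrightarrow> 0"
    using LIMSEQ_Suc[OF lim_const_over_n[of "2::real"]] by (rule tendsto_mult_left_zero)
  ultimately have lim: "(\<lambda>k. 2 * (\<Sum>\<^sub>\<infinity>z. ?w k z * ?a z) + 2 * (2 / Suc k * (norm (emb f))\<^sup>2)) \<longlonglongrightarrow> 2 * 0 + 2 * 0"
    by (intro tendsto_add tendsto_mult tendsto_const)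
  show "(\<lambda>k. (norm (dif (\<lambda>x. \<eta> k x * f x) - dif f))\<^sup>2) \<longlonglongrightarrow> 0"
  proof (rule tendsto_sandwich[OF _ _ tendsto_const])
    show "\<forall>\<^sub>F k in sequentially. (norm (dif (\<lambda>x. \<eta> k x * f x) - dif f))\<^sup>2
       \<le> 2 * (\<Sum>\<^sub>\<infinity>z. ?w k z * ?a z) + 2 * (2 / Suc k * (norm (emb f))\<^sup>2)"
    proof (intro always_eventually allI)
      fix k
      let ?B = "\<lambda>(x, y). \<mu> x y * ((\<eta> k y - \<eta> k x)\<^sup>2 * (f x)\<^sup>2)"
      note B = cutoff_cross[OF DQ_l2[OF f], of k]
      have "(norm (dif (\<lambda>x. \<eta> k x * f x) - dif f))\<^sup>2 \<le> (\<Sum>\<^sub>\<infinity>z. 2 * (?w k z * ?a z) + 2 * ?B z)"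
        unfolding norm_ell2_square
      proof (rule infsum_mono[OF coord_summable])
        show "(\<lambda>z. 2 * (?w k z * ?a z) + 2 * ?B z) summable_on UNIV"
          by (intro summable_on_add summable_on_cmult_right sw B)
        fix z :: "'v \<times> 'v"
        obtain x y where z: "z = (x, y)" by (cases z)
        \<comment> \<open>The increment of \<eta> f - f is q - p: p vanishes in the limit by
          dominated convergence, q by the gradient bound of the cutoffs.\<close>
        let ?p = "(1 - \<eta> k y) * (f y - f x)" and ?q = "(\<eta> k y - \<eta> k x) * f x"
        have "coord (dif (\<lambda>x. \<eta> k x * f x) - dif f) z = sqrt (\<mu> x y) * (?q - ?p)"
          unfolding z minus_ell2.rep_eq coord_dif[OF fe(1)] coord_dif[OF fe(2)] by (simp add: algebra_simps)
        then have "(coord (dif (\<lambda>x. \<eta> k x * f x) - dif f) z)\<^sup>2 = \<mu> x y * (?q - ?p)\<^sup>2"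
          by (simp only: sqrt_weight_square)
        also have "\<dots> \<le> \<mu> x y * (2 * ?p\<^sup>2 + 2 * ?q\<^sup>2)"
        proof (rule mult_left_mono[OF _ weight_nonneg])
          show "(?q - ?p)\<^sup>2 \<le> 2 * ?p\<^sup>2 + 2 * ?q\<^sup>2"
            using sum_squares_bound[of ?q "- ?p"] by (simp only: power2_diff power2_minus)
        qed
        also have "\<dots> = 2 * (?w k z * ?a z) + 2 * ?B z"
          unfolding z snd_conv case_prod_conv coord_dif[OF fe(1)] sqrt_weight_square
          by (simp add: power_mult_distrib distrib_left mult_ac)
        finally show "(coord (dif (\<lambda>x. \<eta> k x * f x) - dif f) z)\<^sup>2 \<le> 2 * (?w k z * ?a z) + 2 * ?B z" .
      qed
      also have "\<dots> = 2 * (\<Sum>\<^sub>\<infinity>z. ?w k z * ?a z) + 2 * infsum ?B UNIV"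
        by (simp only: infsum_add[OF summable_on_cmult_right[OF sw] summable_on_cmult_right[OF B(1)]]
              infsum_cmult_right[OF sw] infsum_cmult_right[OF B(1)])
      finally show "(norm (dif (\<lambda>x. \<eta> k x * f x) - dif f))\<^sup>2
         \<le> 2 * (\<Sum>\<^sub>\<infinity>z. ?w k z * ?a z) + 2 * (2 / Suc k * (norm (emb f))\<^sup>2)"
        using B(2) by linarith
    qed
    show "(\<lambda>k. 2 * (\<Sum>\<^sub>\<infinity>z. ?w k z * ?a z) + 2 * (2 / Suc k * (norm (emb f))\<^sup>2)) \<longlonglongrightarrow> 0"
      using lim by simp
  qed simp
qed

lemma energy_eq:
  assumes "finite_energy f" shows "dirichlet_energy \<mu> f = ennreal ((norm (dif f))\<^sup>2 / 2)"
proof -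
  have e: "(\<Sum>\<^sub>\<infinity>(x, y). \<mu> x y * (f y - f x)\<^sup>2) = (norm (dif f))\<^sup>2"
    unfolding norm_ell2_square
    by (rule infsum_cong) (auto simp: coord_dif assms sqrt_weight_square)
  have "(\<Sum>\<^sub>\<infinity>(x, y). ennreal (\<mu> x y * (f y - f x)\<^sup>2)) = ennreal (\<Sum>\<^sub>\<infinity>(x, y). \<mu> x y * (f y - f x)\<^sup>2)"
    using infsum_ennreal[of "\<lambda>(x, y). \<mu> x y * (f y - f x)\<^sup>2"] assms weight_nonneg
    by (simp add: case_prod_unfold finite_energy_def)
  then show ?thesis
    unfolding dirichlet_energy_def e by (simp add: ennreal_divide_numeral)
qed

lemma form_domain_eq: "form_domain \<mu> m = DQ"
proof (intro set_eqI iffI)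
  fix f assume "f \<in> form_domain \<mu> m"
  then obtain g :: "nat \<Rightarrow> 'v \<Rightarrow> real" where f: "f \<in> l2 m" and g: "\<And>n. g n \<in> finsupp"
    and lim: "(\<lambda>n. dirichlet_energy \<mu> (\<lambda>x. f x - g n x)) \<longlonglongrightarrow> 0"
    by (auto simp: form_domain_def)
  \<comment> \<open>A single approximant at finite energy distance suffices, since \<open>f\<close>
    is the sum of the difference and a finitely supported function.\<close>
  have "\<forall>\<^sub>F n in sequentially. dirichlet_energy \<mu> (\<lambda>x. f x - g n x) < 1"
    by (rule order_tendstoD(2)[OF lim]) simp
  then obtain n where n: "dirichlet_energy \<mu> (\<lambda>x. f x - g n x) < 1"
    using eventually_happens by fastforce
  let ?h = "\<lambda>x. f x - g n x"
  have "(\<Sum>\<^sub>\<infinity>z. ennreal ((\<lambda>(x, y). \<mu> x y * (?h y - ?h x)\<^sup>2) z)) < \<infinity>"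
  proof (rule ccontr)
    assume "\<not> ?thesis"
    then have "(\<Sum>\<^sub>\<infinity>z. ennreal ((\<lambda>(x, y). \<mu> x y * (?h y - ?h x)\<^sup>2) z)) = top"
      by (simp add: not_less top_unique)
    then have "dirichlet_energy \<mu> ?h = top"
      unfolding dirichlet_energy_def by (simp add: case_prod_unfold ennreal_top_divide)
    with n show False by simp
  qed
  then have "(\<lambda>(x, y). \<mu> x y * (?h y - ?h x)\<^sup>2) summable_on UNIV"
    by (rule summable_on_of_ennreal_finite) (use weight_nonneg in auto)
  then have "?h \<in> DQ"
    using f g by (simp add: DQ_def finite_energy_def l2_diff finsupp_l2)
  then show "f \<in> DQ" using DQ_lin[OF _ finsupp_DQ[OF g[of n]], of ?h 1 1] by simp
next
  fix f assume f: "f \<in> DQ"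
  note fe = DQ_energy[OF f] DQ_energy[OF finsupp_DQ[OF cutoff_finsupp]]
  note fl = DQ_l2[OF f] finsupp_l2[OF cutoff_finsupp]
  have "(\<lambda>n. norm (emb f - emb (\<lambda>x. \<eta> n x * f x))) \<longlonglongrightarrow> norm (emb f - emb f)"
    by (intro tendsto_intros cutoff_l2_tendsto fl)
  moreover have "norm (emb f - emb (\<lambda>x. \<eta> n x * f x)) = l2_norm m (\<lambda>x. f x - \<eta> n x * f x)" for n
    using l2_diff[OF fl] by (simp add: norm_emb[symmetric])
  moreover have "(\<lambda>n. ennreal ((norm (dif f - dif (\<lambda>x. \<eta> n x * f x)))\<^sup>2 / 2)) \<longlonglongrightarrow> ennreal ((norm (dif f - dif f))\<^sup>2 / 2)"
    by (intro tendsto_intros cutoff_dif_tendsto f) auto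
  moreover have "ennreal ((norm (dif f - dif (\<lambda>x. \<eta> n x * f x)))\<^sup>2 / 2) = dirichlet_energy \<mu> (\<lambda>x. f x - \<eta> n x * f x)" for n
    using dif_diff[OF fe] by (simp add: energy_eq)
  ultimately show "f \<in> form_domain \<mu> m"
    using fl(1) cutoff_finsupp by (auto simp: form_domain_def intro!: exI[of _ "\<lambda>n x. \<eta> n x * f x"])
qed

subsection \<open>The Laplacian as a self-adjoint operator\<close>

text \<open>The weak formulation: \<open>w\<close> is a priori any vector, and testing against point
  masses identifies it with the Laplacian in \<open>LapOp_rep\<close>.\<close>

definition LapOp :: "('v ell2 \<times> 'v ell2) set" where
  "LapOp = {(a, w). rep a \<in> DQ \<and> (\<forall>h\<in>DQ. form (rep a) h = - inner w (emb h))}"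

definition dirac :: "'v \<Rightarrow> 'v \<Rightarrow> real" where
  "dirac x = (\<lambda>y. if y = x then 1 else 0)"

lemma dirac_finsupp: "dirac x \<in> finsupp"
  by (simp add: finsupp_def dirac_def)

lemma infsum_dirac: "(\<Sum>\<^sub>\<infinity>y. m y * F y * dirac x y) = m x * F x"
proof -
  have "(\<Sum>\<^sub>\<infinity>y. m y * F y * dirac x y) = (\<Sum>\<^sub>\<infinity>y\<in>{x}. m y * F y * dirac x y)"
    by (rule infsum_cong_neutral) (auto simp: dirac_def)
  then show ?thesis by (simp add: dirac_def)
qed

lemma inner_dirac: "inner a (emb (dirac x)) = m x * rep a x"
  by (simp add: inner_rep rep_emb finsupp_l2 dirac_finsupp infsum_dirac)

lemma form_finsupp:
  assumes "f \<in> finsupp" "finite_energy u"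
  shows "form f u = - (\<Sum>\<^sub>\<infinity>x. m x * f x * Lap u x)" "form f u = - (\<Sum>\<^sub>\<infinity>x. m x * u x * Lap f x)"
  using green_finsupp[OF assms(1), of u] form_sum(1)[OF DQ_energy[OF finsupp_DQ[OF assms(1)]] assms(2)]
  by simp_all

lemma LapOp_rep: "(a, w) \<in> LapOp \<Longrightarrow> rep w = Lap (rep a)"
proof
  fix x assume a: "(a, w) \<in> LapOp"
  then have "form (rep a) (dirac x) = - inner w (emb (dirac x))"
    by (auto simp: LapOp_def finsupp_DQ dirac_finsupp)
  moreover have "form (dirac x) (rep a) = - (m x * Lap (rep a) x)"
    using a form_finsupp(1)[OF dirac_finsupp, of "rep a" x] infsum_dirac[of "Lap (rep a)" x]
    by (simp add: LapOp_def DQ_energy mult_ac)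
  ultimately have "m x * rep w x = m x * Lap (rep a) x"
    by (auto simp: inner_dirac form_commute)
  then show "rep w x = Lap (rep a) x" using m_pos[of x] by simp
qed

lemma LapOp_eq: "(a, w) \<in> LapOp \<longleftrightarrow> (rep a, rep w) \<in> {(f, Lap f) | f. f \<in> laplacian_domain \<mu> m}"
proof
  assume a: "(a, w) \<in> LapOp"
  note w = LapOp_rep[OF a, symmetric]
  have "rep a \<in> laplacian_domain \<mu> m"
    using a unfolding laplacian_domain_def form_domain_eq mem_Collect_eq w
    by (auto simp: LapOp_def form_eq DQ_energy rep_l2 inner_emb[symmetric] DQ_l2 emb_rep)
  then show "(rep a, rep w) \<in> {(f, Lap f) | f. f \<in> laplacian_domain \<mu> m}" using w by auto
next
  assume "(rep a, rep w) \<in> {(f, Lap f) | f. f \<in> laplacian_domain \<mu> m}"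
  then have "rep a \<in> laplacian_domain \<mu> m" "Lap (rep a) = rep w" by auto
  then show "(a, w) \<in> LapOp"
    unfolding laplacian_domain_def form_domain_eq
    by (auto simp: LapOp_def form_eq[symmetric] DQ_energy rep_l2 inner_emb[symmetric] DQ_l2 emb_rep)
qed

lemma LapOp_DQ: "(a, w) \<in> LapOp \<Longrightarrow> rep a \<in> DQ"
  by (simp add: LapOp_def)

lemma LapOp_form: "(a, w) \<in> LapOp \<Longrightarrow> h \<in> DQ \<Longrightarrow> inner w (emb h) = - form (rep a) h"
  by (auto simp: LapOp_def)

text \<open>The Laplacian preserves finite support, so repeated use places finitely supported
  functions in the domain of every power of the operator.\<close>

lemma finsupp_LapOp: "f \<in> finsupp \<Longrightarrow> (emb f, emb (Lap f)) \<in> LapOp"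
proof -
  assume f: "f \<in> finsupp"
  note l = finsupp_l2[OF f] finsupp_l2[OF finsupp_Lap[OF f]]
  have "form f h = - inner (emb (Lap f)) (emb h)" if h: "h \<in> DQ" for h
    using form_finsupp(2)[OF f DQ_energy[OF h]] inner_emb[OF l(2) DQ_l2[OF h]]
    by (simp add: l2_inner_def mult_ac)
  then show ?thesis using l by (simp add: LapOp_def rep_emb finsupp_DQ f)
qed

lemma finsupp_dense: "closure (emb ` finsupp) = UNIV"
proof -
  have "a \<in> closure (emb ` finsupp)" for a
  proof -
    have "(\<lambda>k. emb (\<lambda>x. \<eta> k x * rep a x)) \<longlonglongrightarrow> a"
      using cutoff_l2_tendsto[OF rep_l2[of a]] by (simp add: emb_rep)
    then show ?thesis using cutoff_finsupp unfolding closure_sequential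
      by (intro exI[of _ "\<lambda>k. emb (\<lambda>x. \<eta> k x * rep a x)"]) blast
  qed
  then show ?thesis by auto
qed

text \<open>
  The resolvent comes from projecting \<open>(f, 0)\<close> orthogonally onto the graph of the gradient,
  rescaled by \<open>sqrt (h / 2)\<close>; closedness of this graph is closedness of the form.
\<close>

lemma LapOp_range:
  assumes h: "0 < h" shows "\<exists>g. (g, (g - f) /\<^sub>R h) \<in> LapOp"
proof -
  let ?s = "sqrt (h / 2)"
  define G where "G = {(a, b). rep a \<in> DQ \<and> b = ?s *\<^sub>R dif (rep a)}"
  have s: "?s > 0" using h by simp
  have G_iff: "(a, b) \<in> G \<longleftrightarrow> (\<forall>x y. coord b (x, y) = ?s * (sqrt (\<mu> x y) * (rep a y - rep a x)))" for a b
  proof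
    assume "(a, b) \<in> G"
    then show "\<forall>x y. coord b (x, y) = ?s * (sqrt (\<mu> x y) * (rep a y - rep a x))"
      by (auto simp: G_def coord_dif DQ_energy)
  next
    assume "\<forall>x y. coord b (x, y) = ?s * (sqrt (\<mu> x y) * (rep a y - rep a x))"
    then have "coord (inverse ?s *\<^sub>R b) (x, y) = sqrt (\<mu> x y) * (rep a y - rep a x)" for x y
      using s by simp
    note e = finite_energy_of_coord[OF this]
    have "b = ?s *\<^sub>R dif (rep a)" unfolding e(2) using s by simp
    then show "(a, b) \<in> G" using e(1) by (simp add: G_def DQ_def rep_l2)
  qed
  have "subspace G"
  proof (rule subspaceI)
    show "0 \<in> G" by (simp add: zero_prod_def G_iff rep_0)
    fix p q assume p: "p \<in> G" and q: "q \<in> G"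
    obtain a b a' b' where pq: "p = (a, b)" "q = (a', b')" by (cases p, cases q)
    have c: "coord b (x, y) = ?s * (sqrt (\<mu> x y) * (rep a y - rep a x))"
      "coord b' (x, y) = ?s * (sqrt (\<mu> x y) * (rep a' y - rep a' x))" for x y
      using p q G_iff unfolding pq by blast+
    show "p + q \<in> G"
      unfolding pq add_Pair G_iff plus_ell2.rep_eq rep_add c by (simp add: algebra_simps)
    fix r :: real
    show "r *\<^sub>R p \<in> G"
      unfolding pq scaleR_Pair G_iff scaleR_ell2.rep_eq rep_scale c by (simp add: algebra_simps)
  qed
  moreover have "closed G"
    unfolding closed_sequential_limits
  proof (intro allI impI, elim conjE)
    fix X l assume X: "\<forall>n. X n \<in> G" "X \<longlonglongrightarrow> l"
    obtain a b where l: "l = (a, b)" by (cases l)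
    have lim: "(\<lambda>n. fst (X n)) \<longlonglongrightarrow> a" "(\<lambda>n. snd (X n)) \<longlonglongrightarrow> b"
      using tendsto_fst[OF X(2)] tendsto_snd[OF X(2)] l by auto
    have "coord b (x, y) = ?s * (sqrt (\<mu> x y) * (rep a y - rep a x))" for x y
    proof (rule LIMSEQ_unique)
      show "(\<lambda>n. coord (snd (X n)) (x, y)) \<longlonglongrightarrow> coord b (x, y)" by (intro tendsto_coord lim)
      have "(\<lambda>n. ?s * (sqrt (\<mu> x y) * (rep (fst (X n)) y - rep (fst (X n)) x)))
          \<longlonglongrightarrow> ?s * (sqrt (\<mu> x y) * (rep a y - rep a x))"
        by (intro tendsto_intros tendsto_rep lim)
      moreover have "?s * (sqrt (\<mu> x y) * (rep (fst (X n)) y - rep (fst (X n)) x)) = coord (snd (X n)) (x, y)" for n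
        using X(1) G_iff[of "fst (X n)" "snd (X n)"] by simp
      ultimately show "(\<lambda>n. coord (snd (X n)) (x, y)) \<longlonglongrightarrow> ?s * (sqrt (\<mu> x y) * (rep a y - rep a x))"
        by (simp only:)
    qed
    then show "l \<in> G" using G_iff l by blast
  qed
  ultimately obtain p where p: "p \<in> G" "\<And>q. q \<in> G \<Longrightarrow> inner ((f, 0) - p) q = 0"
    using closed_subspace_projection[of G "(f, 0)"] by blast
  define g where "g = fst p"
  have pg: "p = (g, ?s *\<^sub>R dif (rep g))" "rep g \<in> DQ" using p(1) by (auto simp: G_def g_def)
  \<comment> \<open>Orthogonality to the graph element of \<open>u\<close> gives two factors sqrt
    (h/2); their product h/2 turns the inner product of gradients into h times the form, which is
    the weak equation g - h Lap g = f.\<close>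
  have "form (rep g) u = - inner ((g - f) /\<^sub>R h) (emb u)" if u: "u \<in> DQ" for u
  proof -
    have "(emb u, ?s *\<^sub>R dif u) \<in> G" using u by (simp add: G_def rep_emb DQ_l2)
    from p(2)[OF this] have "inner (f - g) (emb u) = ?s * (?s * inner (dif (rep g)) (dif u))"
      by (simp add: pg)
    also have "\<dots> = h / 2 * inner (dif (rep g)) (dif u)"
      using h by (simp add: mult.assoc[symmetric])
    finally have "inner (f - g) (emb u) = h * form (rep g) u" by (simp add: form_def)
    then show ?thesis using h by (simp add: inner_diff_left field_simps)
  qed
  then have "(g, (g - f) /\<^sub>R h) \<in> LapOp" using pg by (simp add: LapOp_def)
  then show ?thesis ..
qed

sublocale Lap: m_dissipative LapOp
proof
  show "subspace LapOp"
  proof (rule subspaceI)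
    have z: "rep 0 = (\<lambda>x. 0)" by (simp add: rep_0 fun_eq_iff)
    have "(\<lambda>x. 0) \<in> DQ" by (rule finsupp_DQ) (simp add: finsupp_def)
    moreover have "dif (\<lambda>x. 0) = 0" by (rule finite_energy_of_coord) simp
    ultimately show "0 \<in> LapOp" by (simp add: LapOp_def zero_prod_def z form_def)
    have r: "rep (a *\<^sub>R p + b *\<^sub>R q) = (\<lambda>x. a * rep p x + b * rep q x)" for a b p q
      by (simp add: rep_add rep_scale fun_eq_iff)
    have lin: "(a *\<^sub>R p + b *\<^sub>R q, a *\<^sub>R v + b *\<^sub>R w) \<in> LapOp"
      if pv: "(p, v) \<in> LapOp" and qw: "(q, w) \<in> LapOp" for a b p q v w
    proof -
      note D = LapOp_DQ[OF pv] LapOp_DQ[OF qw]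
      have "form (\<lambda>x. a * rep p x + b * rep q x) h = - inner (a *\<^sub>R v + b *\<^sub>R w) (emb h)"
        if h: "h \<in> DQ" for h
      proof -
        have "form (\<lambda>x. a * rep p x + b * rep q x) h = a * form (rep p) h + b * form (rep q) h"
          unfolding form_def dif_lin(2)[OF D[THEN DQ_energy]]
          by (simp add: inner_add_left add_divide_distrib)
        then show ?thesis
          using LapOp_form[OF pv h] LapOp_form[OF qw h] by (simp add: inner_add_left)
      qed
      then show ?thesis using DQ_lin[OF D] by (auto simp: LapOp_def r)
    qed
    show "p + q \<in> LapOp" if "p \<in> LapOp" "q \<in> LapOp" for p q
      using lin[of "fst p" "snd p" "fst q" "snd q" 1 1] that by (cases p, cases q) simp
    show "c *\<^sub>R p \<in> LapOp" if "p \<in> LapOp" for c p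
      using lin[of "fst p" "snd p" "fst p" "snd p" c 0] that by (cases p) simp
  qed
  show "inner w f \<le> 0" if "(f, w) \<in> LapOp" for f w
    using LapOp_form[OF that LapOp_DQ[OF that]] form_nonneg[of "rep f"] by (simp add: emb_rep)
  show "\<exists>g. (g, (g - f) /\<^sub>R h) \<in> LapOp" if "0 < h" for h f
    by (rule LapOp_range[OF that])
  have "emb ` finsupp \<subseteq> fst ` LapOp" using finsupp_LapOp by force
  then show "closure (fst ` LapOp) = UNIV" using finsupp_dense closure_mono by blast
qed

subsection \<open>The heat semigroup\<close>

lemma generator_iff:
  assumes P: "\<And>t f. 0 \<le> t \<Longrightarrow> f \<in> l2 m \<Longrightarrow> P t f \<in> l2 m"
  shows "(rep a, rep w) \<in> generator m P \<longleftrightarrow>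
    ((\<lambda>t. (emb (P t (rep a)) - a) /\<^sub>R t) \<longlongrightarrow> w) (at_right 0)"
proof -
  have ev: "\<forall>\<^sub>F t in at_right 0. l2_norm m (\<lambda>x. (P t (rep a) x - rep a x) / t - rep w x)
      = norm ((emb (P t (rep a)) - a) /\<^sub>R t - w)"
    using eventually_at_right_less[of "0::real"]
  proof eventually_elim
    case (elim t)
    have "(\<lambda>x. (P t (rep a) x - rep a x) / t - rep w x) = rep ((emb (P t (rep a)) - a) /\<^sub>R t - w)"
      using elim by (simp add: fun_eq_iff rep_diff rep_scale rep_emb P rep_l2 divide_inverse mult.commute)
    then show ?case by (simp add: l2_norm_rep)
  qed
  have "(rep a, rep w) \<in> generator m P \<longleftrightarrow>
    ((\<lambda>t. norm ((emb (P t (rep a)) - a) /\<^sub>R t - w)) \<longlongrightarrow> 0) (at_right 0)"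
    using tendsto_cong[OF ev] by (simp add: generator_def rep_l2)
  also have "\<dots> \<longleftrightarrow> ((\<lambda>t. (emb (P t (rep a)) - a) /\<^sub>R t) \<longlongrightarrow> w) (at_right 0)"
    by (simp add: tendsto_norm_zero_iff LIM_zero_iff)
  finally show ?thesis .
qed

lemma generator_l2: "(f, g) \<in> generator m P \<Longrightarrow> f \<in> l2 m \<and> g \<in> l2 m"
  by (simp add: generator_def)

lemma l2_pairs_eqI:
  assumes "\<And>f g. (f, g) \<in> X \<Longrightarrow> f \<in> l2 m \<and> g \<in> l2 m" "\<And>f g. (f, g) \<in> Y \<Longrightarrow> f \<in> l2 m \<and> g \<in> l2 m"
    "\<And>a w. (rep a, rep w) \<in> X \<longleftrightarrow> (rep a, rep w) \<in> Y"
  shows "X = Y"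
  using assms by (auto simp: set_eq_iff) (metis rep_emb)+

lemma laplacian_domain_l2: "(f, g) \<in> {(f, Lap f) | f. f \<in> laplacian_domain \<mu> m} \<Longrightarrow> f \<in> l2 m \<and> g \<in> l2 m"
  by (auto simp: laplacian_domain_def form_domain_def)

lemma heat_semigroup_exists:
  "\<exists>P. C0_semigroup m P \<and> generator m P = {(f, Lap f) | f. f \<in> laplacian_domain \<mu> m}"
proof (intro exI conjI)
  let ?P = "\<lambda>t f. rep (Lap.S t (emb f))"
  show "C0_semigroup m ?P"
    unfolding C0_semigroup_def
  proof (intro conjI allI ballI impI)
    fix t s :: real and f g :: "'v \<Rightarrow> real" and a b :: real
    assume t: "0 \<le> t" and f: "f \<in> l2 m" and g: "g \<in> l2 m"
    show "?P t (\<lambda>x. a * f x + b * g x) = (\<lambda>x. a * ?P t f x + b * ?P t g x)"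
      using bounded_linear.linear[OF Lap.S_bounded_linear[OF t]]
      by (simp add: l2_lin f g linear_add linear_scale rep_add rep_scale fun_eq_iff)
  next
    fix t :: real assume "0 \<le> t"
    then show "\<exists>C. \<forall>f\<in>l2 m. l2_norm m (?P t f) \<le> C * l2_norm m f"
      using Lap.S_contraction by (intro exI[of _ 1]) (simp add: l2_norm_rep norm_emb[symmetric])
  next
    fix f assume f: "f \<in> l2 m"
    have "((\<lambda>t. norm (Lap.S t (emb f) - emb f)) \<longlongrightarrow> 0) (at_right 0)"
      using Lap.S_tendsto by (intro tendsto_norm_zero) (simp add: LIM_zero_iff)
    moreover have "l2_norm m (\<lambda>x. ?P t f x - f x) = norm (Lap.S t (emb f) - emb f)" for t
    proof -
      have "(\<lambda>x. ?P t f x - f x) = rep (Lap.S t (emb f) - emb f)"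
        by (simp add: fun_eq_iff rep_diff rep_emb f)
      then show ?thesis by (simp add: l2_norm_rep)
    qed
    ultimately show "((\<lambda>t. l2_norm m (\<lambda>x. ?P t f x - f x)) \<longlongrightarrow> 0) (at_right 0)" by simp
  qed (simp_all add: rep_l2 emb_rep rep_emb Lap.S_0 Lap.S_add)
  show "generator m ?P = {(f, Lap f) | f. f \<in> laplacian_domain \<mu> m}"
    by (rule l2_pairs_eqI)
       (use generator_l2 laplacian_domain_l2 in
         \<open>auto simp: generator_iff rep_l2 emb_rep Lap.S_generator_iff LapOp_eq\<close>)
qed

abbreviation heat :: "real \<Rightarrow> ('v \<Rightarrow> real) \<Rightarrow> 'v \<Rightarrow> real" where "heat \<equiv> heat_semigroup \<mu> m"

lemma heat_C0: "C0_semigroup m heat"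
  and heat_generator: "generator m heat = {(f, Lap f) | f. f \<in> laplacian_domain \<mu> m}"
  using someI_ex[OF heat_semigroup_exists] unfolding heat_semigroup_def by auto

text \<open>The chosen semigroup carried over to the Hilbert space. It is analysed only through the
  clauses of \<open>C0_semigroup\<close> and the generator.\<close>

definition U :: "real \<Rightarrow> 'v ell2 \<Rightarrow> 'v ell2" where
  "U t a = emb (heat t (rep a))"

lemma heat_l2: "0 \<le> t \<Longrightarrow> f \<in> l2 m \<Longrightarrow> heat t f \<in> l2 m"
  using heat_C0 by (simp add: C0_semigroup_def)

lemma heat_eq: "0 \<le> t \<Longrightarrow> f \<in> l2 m \<Longrightarrow> heat t f = rep (U t (emb f))"
  by (simp add: U_def rep_emb heat_l2)

sublocale U: strongly_continuous_semigroup U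
proof (rule strongly_continuous_semigroup.intro)
  have lin: "U t (r *\<^sub>R a + s *\<^sub>R b) = r *\<^sub>R U t a + s *\<^sub>R U t b" if t: "0 \<le> t" for t a b r s
  proof -
    have "rep (r *\<^sub>R a + s *\<^sub>R b) = (\<lambda>x. r * rep a x + s * rep b x)"
      by (simp add: fun_eq_iff rep_add rep_scale)
    then have "heat t (rep (r *\<^sub>R a + s *\<^sub>R b)) = (\<lambda>x. r * heat t (rep a) x + s * heat t (rep b) x)"
      using heat_C0 t by (simp add: C0_semigroup_def rep_l2)
    then show ?thesis by (simp add: U_def l2_lin heat_l2 t rep_l2)
  qed
  fix t s :: real and a b :: "'v ell2"
  show "bounded_linear (U t)" if t: "0 \<le> t"
  proof -
    obtain C where C: "\<And>f. f \<in> l2 m \<Longrightarrow> l2_norm m (heat t f) \<le> C * l2_norm m f"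
      using heat_C0 t unfolding C0_semigroup_def by meson
    show ?thesis
    proof (rule bounded_linear_intro[of _ C])
      show "U t (x + y) = U t x + U t y" for x y using lin[OF t, of 1 x 1 y] by simp
      show "U t (r *\<^sub>R x) = r *\<^sub>R U t x" for r x using lin[OF t, of r x 0 x] by simp
      show "norm (U t x) \<le> norm x * C" for x
        using C[OF rep_l2[of x]] by (simp add: U_def norm_emb heat_l2 t rep_l2 l2_norm_rep mult.commute)
    qed
  qed
  show "U 0 a = a" using heat_C0 by (simp add: U_def C0_semigroup_def rep_l2 emb_rep)
  show "U (s + t) a = U s (U t a)" if "0 \<le> s" "0 \<le> t"
    using heat_C0 that by (simp add: U_def C0_semigroup_def rep_l2 rep_emb heat_l2)
  have "((\<lambda>t. l2_norm m (\<lambda>x. heat t (rep a) x - rep a x)) \<longlongrightarrow> 0) (at_right 0)"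
    using heat_C0 by (simp add: C0_semigroup_def rep_l2)
  moreover have "\<forall>\<^sub>F t in at_right 0. l2_norm m (\<lambda>x. heat t (rep a) x - rep a x) = norm (U t a - a)"
    using eventually_at_right_less[of "0::real"]
  proof eventually_elim
    case (elim t)
    have "(\<lambda>x. heat t (rep a) x - rep a x) = rep (U t a - a)"
      using elim by (simp add: fun_eq_iff rep_diff U_def rep_emb heat_l2 rep_l2)
    then show ?case by (simp add: l2_norm_rep)
  qed
  ultimately have "((\<lambda>t. norm (U t a - a)) \<longlongrightarrow> 0) (at_right 0)"
    using tendsto_cong by fastforce
  then show "((\<lambda>t. U t a) \<longlongrightarrow> a) (at_right 0)"
    by (simp add: tendsto_norm_zero_iff LIM_zero_iff)
qed

lemma U_generator: "(a, w) \<in> LapOp \<longleftrightarrow> ((\<lambda>t. (U t a - a) /\<^sub>R t) \<longlongrightarrow> w) (at_right 0)"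
  using generator_iff[of heat a w] LapOp_eq[of a w] unfolding heat_generator U_def by (simp add: heat_l2)

lemma U_derivative:
  "(a, w) \<in> LapOp \<Longrightarrow> 0 \<le> t \<Longrightarrow> ((\<lambda>s. U s a) has_vector_derivative U t w) (at t within {0..})"
  by (rule U.orbit_derivative) (simp_all add: U_generator)

text \<open>\<open>U t\<close> is continuous and commutes with \<open>U s\<close>, so it carries the
  difference quotients of \<open>a\<close> at 0 to those of \<open>U t a\<close>.\<close>

lemma U_LapOp:
  assumes "(a, w) \<in> LapOp" and t: "0 \<le> t" shows "(U t a, U t w) \<in> LapOp"
proof -
  have "((\<lambda>s. U t ((U s a - a) /\<^sub>R s)) \<longlongrightarrow> U t w) (at_right 0)"
    using assms(1) by (intro bounded_linear.tendsto[OF U.bounded_linear[OF t]]) (simp add: U_generator)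
  moreover have "\<forall>\<^sub>F s in at_right 0. U t ((U s a - a) /\<^sub>R s) = (U s (U t a) - U t a) /\<^sub>R s"
    using eventually_at_right_less[of "0::real"]
  proof eventually_elim
    case (elim s)
    then show ?case using t U.add[of s t a] U.add[of t s a] by (simp add: U.scale U.diff add.commute)
  qed
  ultimately show ?thesis unfolding U_generator by (rule Lim_transform_eventually)
qed

end

section \<open>Monotonicity of real functions on a closed interval\<close>

lemma nonneg_derivative_le:
  fixes \<phi> :: "real \<Rightarrow> real"
  assumes ab: "a \<le> b"
    and der: "\<And>s. s \<in> {a..b} \<Longrightarrow> (\<phi> has_vector_derivative \<phi>' s) (at s within {a..b})"
    and nonneg: "\<And>s. s \<in> {a..b} \<Longrightarrow> 0 \<le> \<phi>' s"
  shows "\<phi> a \<le> \<phi> b"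
proof (rule DERIV_nonneg_imp_increasing_open[OF ab])
  show "continuous_on {a..b} \<phi>"
    using der has_vector_derivative_continuous by (fastforce simp: continuous_on_eq_continuous_within)
  fix s assume s: "a < s" "s < b"
  then have "(\<phi> has_vector_derivative \<phi>' s) (at s)"
    using der[of s] at_within_interior[of s "{a..b}"] by (simp add: interior_atLeastAtMost_real)
  then show "\<exists>y. (\<phi> has_real_derivative y) (at s) \<and> 0 \<le> y"
    using nonneg[of s] s by (auto simp: has_real_derivative_iff_has_vector_derivative)
qed

lemma zero_derivative_eq:
  fixes \<phi> :: "real \<Rightarrow> real"
  assumes t: "0 \<le> t"
    and der: "\<And>s. s \<in> {0..t} \<Longrightarrow> (\<phi> has_vector_derivative 0) (at s within {0..t})"
  shows "\<phi> 0 = \<phi> t"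
proof (rule antisym)
  show "\<phi> 0 \<le> \<phi> t" by (rule nonneg_derivative_le[OF t der]) auto
  have "- \<phi> 0 \<le> - \<phi> t"
    by (rule nonneg_derivative_le[OF t, of "\<lambda>s. - \<phi> s" "\<lambda>_. 0"])
       (use has_vector_derivative_minus[OF der] in auto)
  then show "\<phi> t \<le> \<phi> 0" by simp
qed

context cutoff_graph
begin

subsection \<open>Symmetry and positivity of the heat semigroup\<close>

lemma LapOp_symmetric: "(a, v) \<in> LapOp \<Longrightarrow> (b, w) \<in> LapOp \<Longrightarrow> inner v b = inner a w"
proof -
  assume a: "(a, v) \<in> LapOp" and b: "(b, w) \<in> LapOp"
  have "inner v b = - form (rep a) (rep b)"
    using LapOp_form[OF a LapOp_DQ[OF b]] by (simp add: emb_rep)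
  also have "\<dots> = inner w a"
    using LapOp_form[OF b LapOp_DQ[OF a]] by (simp add: emb_rep form_commute)
  finally show ?thesis by (simp add: inner_commute)
qed

lemma U_derivative':
  "(a, w) \<in> LapOp \<Longrightarrow> s \<in> {0..t} \<Longrightarrow> ((\<lambda>s. U s a) has_vector_derivative U s w) (at s within {0..t})"
  by (rule has_vector_derivative_within_subset[OF U_derivative]) auto

lemma U_derivative_reverse:
  assumes "(a, w) \<in> LapOp" "s \<in> {0..t}"
  shows "((\<lambda>s. U (t - s) a) has_vector_derivative - U (t - s) w) (at s within {0..t})"
proof -
  have "((\<lambda>s. t - s) has_vector_derivative - 1) (at s within {0..t})"
    by (auto intro!: derivative_eq_intros)
  moreover have "((\<lambda>s. U s a) has_vector_derivative U (t - s) w) (at (t - s) within (\<lambda>s. t - s) ` {0..t})"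
    by (rule has_vector_derivative_within_subset[OF U_derivative]) (use assms in auto)
  ultimately show ?thesis
    using vector_diff_chain_within[of "\<lambda>s. t - s" "- 1" s "{0..t}" "\<lambda>s. U s a" "U (t - s) w"]
    by (simp add: o_def)
qed

lemma U_cutoff_tendsto: "0 \<le> t \<Longrightarrow> (\<lambda>k. U t (emb (\<lambda>x. \<eta> k x * rep a x))) \<longlonglongrightarrow> U t a"
  using bounded_linear.tendsto[OF U.bounded_linear cutoff_l2_tendsto[OF rep_l2[of a]], of t] by (simp add: emb_rep)

lemma cutoff_tendsto: "(\<lambda>k. emb (\<lambda>x. \<eta> k x * rep a x)) \<longlonglongrightarrow> a"
  using cutoff_l2_tendsto[OF rep_l2[of a]] by (simp add: emb_rep)

text \<open>For \<open>a\<close> and \<open>b\<close> in the domain, s \<mapsto>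
  \<open>inner (U s a) (U (t - s) b)\<close> has derivative zero by symmetry of the generator;
  comparing s = 0 with s = t gives the claim. Cutoffs extend it to all vectors.\<close>

lemma U_symmetric:
  assumes t: "0 \<le> t" shows "inner (U t a) b = inner a (U t b)"
proof -
  have base: "inner (U t a) b = inner a (U t b)" if a: "(a, v) \<in> LapOp" and b: "(b, w) \<in> LapOp" for a b v w
  proof -
    have "inner (U 0 a) (U (t - 0) b) = inner (U t a) (U (t - t) b)"
    proof (rule zero_derivative_eq[OF t])
      fix s assume s: "s \<in> {0..t}"
      have "((\<lambda>s. inner (U s a) (U (t - s) b)) has_vector_derivative
          inner (U s a) (- U (t - s) w) + inner (U s v) (U (t - s) b)) (at s within {0..t})"
        by (rule bounded_bilinear.has_vector_derivative[OF bounded_bilinear_inner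
              U_derivative'[OF a s] U_derivative_reverse[OF b s]])
      moreover have "inner (U s v) (U (t - s) b) = inner (U s a) (U (t - s) w)"
        using s by (intro LapOp_symmetric U_LapOp a b) auto
      ultimately show "((\<lambda>s. inner (U s a) (U (t - s) b)) has_vector_derivative 0) (at s within {0..t})"
        by simp
    qed
    then show ?thesis by simp
  qed
  let ?c = "\<lambda>a k. emb (\<lambda>x. \<eta> k x * rep a x)"
  have "inner (U t (?c a k)) (?c b k) = inner (?c a k) (U t (?c b k))" for k
    using base finsupp_LapOp[OF cutoff_finsupp] by blast
  moreover have "(\<lambda>k. inner (U t (?c a k)) (?c b k)) \<longlonglongrightarrow> inner (U t a) b"
    by (intro tendsto_inner U_cutoff_tendsto cutoff_tendsto t)
  moreover have "(\<lambda>k. inner (?c a k) (U t (?c b k))) \<longlonglongrightarrow> inner a (U t b)"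
    by (intro tendsto_inner U_cutoff_tendsto cutoff_tendsto t)
  ultimately show ?thesis using LIMSEQ_unique by simp
qed

definition neg_part :: "('v \<Rightarrow> real) \<Rightarrow> 'v \<Rightarrow> real" where
  "neg_part f x = max 0 (- f x)"

lemma neg_part_DQ: "f \<in> DQ \<Longrightarrow> neg_part f \<in> DQ"
proof -
  assume f: "f \<in> DQ"
  have "neg_part f \<in> l2 m" by (rule l2_dominated[OF DQ_l2[OF f], of _ 1]) (simp add: neg_part_def)
  moreover have "finite_energy (neg_part f)"
    by (rule finite_energy_dominated[OF DQ_energy[OF f] DQ_energy[OF f], of _ 1 0])
       (auto simp: neg_part_def max_def abs_if)
  ultimately show ?thesis by (simp add: DQ_def)
qed

lemma neg_part_l2: "neg_part (rep a) \<in> l2 m"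
  by (rule l2_dominated[OF rep_l2[of a], of _ 1]) (auto simp: neg_part_def)

text \<open>First-order Taylor estimate for the square of the negative part, whose derivative at a
  is -2 max 0 (-a). The quadratic error with constant 1 can be summed over the vertices.\<close>

lemma neg_part_square: "\<bar>(max 0 (- b))\<^sup>2 - (max 0 (- a))\<^sup>2 + 2 * max 0 (- a) * (b - a)\<bar> \<le> (b - a)\<^sup>2" for a b :: real
proof -
  have e: "(b - a)\<^sup>2 = a * a - 2 * (a * b) + b * b" by (simp add: power2_eq_square algebra_simps)
  have sq: "0 \<le> a * a" "0 \<le> b * b" by simp_all
  consider "a \<le> 0" "b > 0" | "a > 0" "b \<le> 0" | "a \<le> 0" "b \<le> 0" | "a > 0" "b > 0" by linarith
  then show ?thesis
  proof cases
    case 1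
    then have "a * b \<le> 0" by (simp add: mult_nonpos_nonneg)
    moreover have "(max 0 (- b))\<^sup>2 - (max 0 (- a))\<^sup>2 + 2 * max 0 (- a) * (b - a) = a * a - 2 * (a * b)"
      using 1 by (simp add: max_def power2_eq_square algebra_simps)
    ultimately show ?thesis unfolding e using sq by (simp only: abs_le_iff) linarith
  next
    case 2
    then have "a * b \<le> 0" by (simp add: mult_nonneg_nonpos)
    moreover have "(max 0 (- b))\<^sup>2 - (max 0 (- a))\<^sup>2 + 2 * max 0 (- a) * (b - a) = b * b"
      using 2 by (simp add: max_def power2_eq_square)
    ultimately show ?thesis unfolding e using sq by (simp only: abs_le_iff) linarith
  next
    case 3
    then have "(max 0 (- b))\<^sup>2 - (max 0 (- a))\<^sup>2 + 2 * max 0 (- a) * (b - a) = (b - a)\<^sup>2"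
      by (simp add: max_def power2_eq_square algebra_simps)
    then show ?thesis by simp
  qed (simp add: max_def)
qed

lemma neg_part_has_derivative:
  "((\<lambda>a. (norm (emb (neg_part (rep a))))\<^sup>2) has_derivative (\<lambda>h. - 2 * inner (emb (neg_part (rep a))) h)) (at a)"
proof -
  let ?N = "\<lambda>a. emb (neg_part (rep a))"
  have bound: "\<bar>(norm (?N b))\<^sup>2 - (norm (?N a))\<^sup>2 + 2 * inner (?N a) (b - a)\<bar> \<le> (norm (b - a))\<^sup>2" for b
  proof -
    let ?A = "\<lambda>x. m x * rep (?N b) x * rep (?N b) x" and ?B = "\<lambda>x. m x * rep (?N a) x * rep (?N a) x"
      and ?C = "\<lambda>x. m x * rep (?N a) x * rep (b - a) x" and ?D = "\<lambda>x. m x * rep (b - a) x * rep (b - a) x"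
    note sm = inner_rep_summable
    have "(norm (?N b))\<^sup>2 - (norm (?N a))\<^sup>2 + 2 * inner (?N a) (b - a) = (\<Sum>\<^sub>\<infinity>x. ?A x - ?B x + 2 * ?C x)"
      unfolding power2_norm_eq_inner inner_rep
      by (simp only: infsum_add[OF summable_on_diff[OF sm sm] summable_on_cmult_right[OF sm]]
          infsum_diff[OF sm sm] infsum_cmult_right[OF sm])
    moreover have "norm (\<Sum>\<^sub>\<infinity>x. ?A x - ?B x + 2 * ?C x) \<le> (\<Sum>\<^sub>\<infinity>x. ?D x)"
    proof (rule norm_infsum_le[OF has_sum_infsum has_sum_infsum])
      show "(\<lambda>x. ?A x - ?B x + 2 * ?C x) summable_on UNIV"
        by (intro summable_on_add summable_on_diff summable_on_cmult_right sm)
      show "?D summable_on UNIV" by (rule sm)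
      fix x
      have "?A x - ?B x + 2 * ?C x = m x * ((max 0 (- rep b x))\<^sup>2 - (max 0 (- rep a x))\<^sup>2
          + 2 * max 0 (- rep a x) * (rep b x - rep a x))"
        unfolding rep_emb[OF neg_part_l2] neg_part_def rep_diff by (simp add: power2_eq_square algebra_simps)
      then have "norm (?A x - ?B x + 2 * ?C x) = m x * \<bar>(max 0 (- rep b x))\<^sup>2 - (max 0 (- rep a x))\<^sup>2
          + 2 * max 0 (- rep a x) * (rep b x - rep a x)\<bar>"
        using measure_nonneg[of x] by (simp only: real_norm_def abs_mult abs_of_nonneg)
      also have "\<dots> \<le> m x * (rep b x - rep a x)\<^sup>2"
        by (intro mult_left_mono neg_part_square measure_nonneg)
      finally show "norm (?A x - ?B x + 2 * ?C x) \<le> ?D x"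
        by (simp add: rep_diff power2_eq_square mult.assoc)
    qed
    ultimately show ?thesis by (simp add: power2_norm_eq_inner inner_rep[of "b - a" "b - a"])
  qed
  have "((\<lambda>b. norm ((norm (?N b))\<^sup>2 - (norm (?N a))\<^sup>2 - - 2 * inner (?N a) (b - a)) / norm (b - a)) \<longlongrightarrow> 0) (at a)"
  proof (rule Lim_null_comparison)
    show "\<forall>\<^sub>F b in at a. norm (norm ((norm (?N b))\<^sup>2 - (norm (?N a))\<^sup>2 - - 2 * inner (?N a) (b - a)) / norm (b - a))
        \<le> norm (b - a)"
      using eventually_at_ball'[of 1 a UNIV] 
    proof (rule eventually_mono)
      fix b assume "b \<in> ball a 1 \<and> b \<noteq> a \<and> b \<in> UNIV"
      then show "norm (norm ((norm (?N b))\<^sup>2 - (norm (?N a))\<^sup>2 - - 2 * inner (?N a) (b - a)) / norm (b - a))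
        \<le> norm (b - a)"
        using bound[of b] by (simp add: divide_le_eq power2_eq_square)
    qed simp
    have "((\<lambda>b. norm (b - a)) \<longlongrightarrow> norm (a - a)) (at a)" by (intro tendsto_intros)
    then show "((\<lambda>b. norm (b - a)) \<longlongrightarrow> 0) (at a)" by simp
  qed
  moreover have "bounded_linear (\<lambda>h. - 2 * inner (?N a) h)"
    by (intro bounded_linear_mult_right[THEN bounded_linear_compose] bounded_linear_inner_right)
  ultimately show ?thesis by (simp add: has_derivative_iff_norm)
qed

text \<open>The squared norm of the negative part of the orbit starts at 0 and does not increase:
  with k the orbit and k^- its negative part, its derivative is 2 Q(k, k^-) \<le> 0. A finitely
  supported start makes the orbit differentiable.\<close>

lemma U_nonneg:
  assumes f: "f \<in> finsupp" "\<And>x. 0 \<le> f x" and t: "0 \<le> t"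
  shows "0 \<le> rep (U t (emb f)) x"
proof -
  let ?w = "emb (Lap f)"
  let ?k = "\<lambda>s. U s (emb f)"
  let ?\<theta> = "\<lambda>s. - (norm (emb (neg_part (rep (?k s)))))\<^sup>2"
  note A = finsupp_LapOp[OF f(1)]
  have "?\<theta> 0 \<le> ?\<theta> t"
  proof (rule nonneg_derivative_le[OF t])
    fix s assume s: "s \<in> {0..t}"
    have "((\<lambda>s. (norm (emb (neg_part (rep (?k s)))))\<^sup>2) has_derivative
        (\<lambda>h. - 2 * inner (emb (neg_part (rep (?k s)))) (h *\<^sub>R U s ?w))) (at s within {0..t})"
      using U_derivative'[OF A s] unfolding has_vector_derivative_def
      by (rule has_derivative_compose[OF _ neg_part_has_derivative])
    moreover have "(\<lambda>h. - 2 * inner (emb (neg_part (rep (?k s)))) (h *\<^sub>R U s ?w)) =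
        (\<lambda>h. h *\<^sub>R (- 2 * inner (emb (neg_part (rep (?k s)))) (U s ?w)))"
      by (simp add: fun_eq_iff)
    ultimately have "((\<lambda>s. (norm (emb (neg_part (rep (?k s)))))\<^sup>2) has_vector_derivative
        - 2 * inner (emb (neg_part (rep (?k s)))) (U s ?w)) (at s within {0..t})"
      by (simp only: has_vector_derivative_def)
    from has_vector_derivative_minus[OF this]
    show "(?\<theta> has_vector_derivative 2 * inner (emb (neg_part (rep (?k s)))) (U s ?w)) (at s within {0..t})"
      by simp
    have As: "(?k s, U s ?w) \<in> LapOp" using U_LapOp[OF A] s by simp
    let ?f = "rep (?k s)"
    note D = LapOp_DQ[OF As] neg_part_DQ[OF LapOp_DQ[OF As]]
    have "(\<Sum>\<^sub>\<infinity>(x, y). \<mu> x y * ((?f y - ?f x) * (neg_part ?f y - neg_part ?f x))) \<le> (\<Sum>\<^sub>\<infinity>z::'v \<times> 'v. 0)"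
    proof (rule infsum_mono[OF form_sum(2)[OF D[THEN DQ_energy]]]; clarsimp)
      fix x y
      \<comment> \<open>The negative part is a nonincreasing function of the value, so the two
        increments never have the same strict sign.\<close>
      have "(?f y - ?f x) * (neg_part ?f y - neg_part ?f x) \<le> 0"
        by (auto simp: neg_part_def max_def mult_le_0_iff)
      then show "\<mu> x y * ((?f y - ?f x) * (neg_part ?f y - neg_part ?f x)) \<le> 0"
        using weight_nonneg by (simp add: mult_nonneg_nonpos)
    qed
    then have "form ?f (neg_part ?f) \<le> 0"
      using form_sum(1)[OF D[THEN DQ_energy]] by simp
    then show "0 \<le> 2 * inner (emb (neg_part (rep (?k s)))) (U s ?w)"
      using LapOp_form[OF As D(2)] by (simp add: inner_commute)
  qed
  moreover have "neg_part (rep (?k 0)) = (\<lambda>x. 0)"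
    using f by (auto simp: neg_part_def rep_emb finsupp_l2 fun_eq_iff)
  then have "emb (neg_part (rep (?k 0))) = 0"
    using rep_0 by (intro emb_eqI) simp
  ultimately have "emb (neg_part (rep (?k t))) = 0" by simp
  then have "neg_part (rep (?k t)) x = 0" using rep_emb[OF neg_part_l2] rep_0 by metis
  then show ?thesis by (simp add: neg_part_def max_def split: if_splits)
qed

subsection \<open>The squared gradient of functions of finite energy\<close>

lemma bounded_mult_summable:
  fixes F :: "'b \<Rightarrow> real"
  assumes "F summable_on UNIV" "bounded (range \<kappa>)"
  shows "(\<lambda>z. F z * \<kappa> z) summable_on UNIV"
proof -
  obtain B where B: "\<And>z. \<bar>\<kappa> z\<bar> \<le> B" using assms(2) by (auto simp: bounded_iff)
  have "(\<lambda>z. \<bar>F z\<bar>) summable_on UNIV"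
    using assms(1) summable_on_iff_abs_summable_on_real[of F UNIV] by simp
  then have "(\<lambda>z. \<bar>F z\<bar> * B) summable_on UNIV" by (rule summable_on_cmult_left)
  then show ?thesis
    by (rule summable_on_real_bound) (simp add: abs_mult mult_left_mono B)
qed

lemma Gam_pairs:
  assumes fg: "finite_energy f" "finite_energy g" and k: "bounded (range \<kappa>)"
  shows "(\<lambda>(x, y). \<mu> x y * ((f y - f x) * (g y - g x)) * \<kappa> x) summable_on UNIV"
    and "(\<lambda>x. 2 * m x * Gam f g x * \<kappa> x) summable_on UNIV"
    and "(\<Sum>\<^sub>\<infinity>x. 2 * m x * Gam f g x * \<kappa> x) = (\<Sum>\<^sub>\<infinity>(x, y). \<mu> x y * ((f y - f x) * (g y - g x)) * \<kappa> x)"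
proof -
  let ?F = "\<lambda>x y. \<mu> x y * ((f y - f x) * (g y - g x)) * \<kappa> x"
  have "bounded (range (\<lambda>(x, y). \<kappa> x))"
    using k by (auto simp: bounded_iff)
  from bounded_mult_summable[OF form_sum(2)[OF fg] this]
  show s: "(\<lambda>(x, y). ?F x y) summable_on UNIV" by (simp add: case_prod_unfold)
  have row: "(\<Sum>\<^sub>\<infinity>y. ?F x y) = 2 * m x * Gam f g x * \<kappa> x" for x
  proof -
    have "(\<Sum>\<^sub>\<infinity>y. ?F x y) = (\<Sum>\<^sub>\<infinity>y. \<mu> x y * ((f y - f x) * (g y - g x) * \<kappa> x))"
      by (simp only: mult.assoc)
    also have "\<dots> = 2 * m x * Gam f g x * \<kappa> x"
      unfolding infsum_neighbours Gam_sum sum_distrib_right by (simp only: mult.assoc)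
    finally show ?thesis .
  qed
  show "(\<lambda>x. 2 * m x * Gam f g x * \<kappa> x) summable_on UNIV"
    using summable_pairs_rows[OF s] by (simp only: row)
  show "(\<Sum>\<^sub>\<infinity>x. 2 * m x * Gam f g x * \<kappa> x) = (\<Sum>\<^sub>\<infinity>(x, y). ?F x y)"
    using infsum_pairs[OF s] by (simp only: row)
qed

lemma Gam_summable: "finite_energy f \<Longrightarrow> (\<lambda>x. m x * Gam f f x) summable_on UNIV"
  using summable_on_cmult_right[OF Gam_pairs(2)[of f f "\<lambda>_. 1"], of "1 / 2"] by (simp add: mult_ac)

text \<open>Under a measure bounded below by \<delta>, l1 lies in l2: one term m(x) v(x) is at most
  the total sum S, so v \<le> S/\<delta>, and one of the two factors in the square is bounded by
  this constant.\<close>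

lemma summable_l2:
  assumes "(\<lambda>x. m x * v x) summable_on UNIV" "\<And>x. \<bar>u x\<bar> \<le> v x"
  shows "u \<in> l2 m"
proof -
  let ?S = "\<Sum>\<^sub>\<infinity>x. m x * v x"
  have v0: "0 \<le> v x" for x using assms(2)[of x] by linarith
  have vS: "v x \<le> ?S / \<delta>" for x
  proof -
    have "(\<Sum>x\<in>{x}. m x * v x) \<le> ?S"
      by (rule finite_sum_le_infsum[OF assms(1)]) (auto simp: v0 measure_nonneg)
    moreover have "\<delta> * v x \<le> m x * v x" by (intro mult_right_mono \<delta>_le v0)
    ultimately have "v x * \<delta> \<le> ?S" by (simp add: mult.commute)
    then show ?thesis using \<delta>_pos by (simp only: pos_le_divide_eq)
  qed
  have "(\<lambda>x. ?S / \<delta> * (m x * v x)) summable_on UNIV" by (rule summable_on_cmult_right[OF assms(1)])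
  then have "(\<lambda>x. m x * (u x)\<^sup>2) summable_on UNIV"
  proof (rule summable_on_comparison_test)
    fix x
    have "(u x)\<^sup>2 = \<bar>u x\<bar> * \<bar>u x\<bar>" by (simp add: power2_eq_square)
    also have "\<dots> \<le> ?S / \<delta> * v x"
      by (rule mult_mono[OF order_trans[OF assms(2) vS] assms(2) order_trans[OF v0 vS] abs_ge_zero])
    finally have "m x * (u x)\<^sup>2 \<le> m x * (?S / \<delta> * v x)"
      by (rule mult_left_mono) (rule measure_nonneg)
    then show "m x * (u x)\<^sup>2 \<le> ?S / \<delta> * (m x * v x)" by (simp only: mult.left_commute)
    show "0 \<le> m x * (u x)\<^sup>2" by (intro mult_nonneg_nonneg measure_nonneg zero_le_power2)
  qed
  then show ?thesis by (simp only: l2_def mem_Collect_eq)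
qed

lemma Gam_l2:
  assumes "finite_energy f" "finite_energy g" shows "Gam f g \<in> l2 m"
proof (rule summable_l2)
  show "(\<lambda>x. m x * (1 / 2 * (Gam f f x + Gam g g x))) summable_on UNIV"
    using summable_on_cmult_right[OF summable_on_add[OF Gam_summable[OF assms(1)] Gam_summable[OF assms(2)]], of "1/2"]
    by (simp add: algebra_simps)
  show "\<bar>Gam f g x\<bar> \<le> 1 / 2 * (Gam f f x + Gam g g x)" for x using Gam_bound[of f g x] by simp
qed

lemma inner_Gam:
  assumes "finite_energy f" "finite_energy g"
  shows "2 * inner (emb (Gam f g)) k = (\<Sum>\<^sub>\<infinity>(x, y). \<mu> x y * ((f y - f x) * (g y - g x)) * rep k x)"
proof -
  have "2 * inner (emb (Gam f g)) k = 2 * (\<Sum>\<^sub>\<infinity>x. m x * rep (emb (Gam f g)) x * rep k x)"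
    by (simp only: inner_rep)
  also have "\<dots> = (\<Sum>\<^sub>\<infinity>x. 2 * (m x * rep (emb (Gam f g)) x * rep k x))"
    by (rule infsum_cmult_right[OF inner_rep_summable, symmetric])
  also have "\<dots> = (\<Sum>\<^sub>\<infinity>x. 2 * m x * Gam f g x * rep k x)"
    by (simp add: rep_emb Gam_l2 assms mult.assoc)
  finally show ?thesis using Gam_pairs(3)[OF assms l2_bounded_range[OF rep_l2]] by simp
qed

text \<open>The weak form of 2\<Gamma>(f,g) = \<triangle>(fg) - f\<triangle>g - g\<triangle>f tested
  against k. On each pair the three form densities combine to \<mu>(f y - f x)(g y - g x)(k x + k
  y), and the two halves have equal sums by symmetry.\<close>

lemma form_product:
  assumes f: "f \<in> DQ" and g: "g \<in> DQ" and k: "rep k \<in> DQ"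
  shows "form g (\<lambda>x. f x * rep k x) + form f (\<lambda>x. g x * rep k x) - form (rep k) (\<lambda>x. f x * g x)
     = 2 * inner (emb (Gam f g)) k"
proof -
  let ?F = "\<lambda>x y. \<mu> x y * ((f y - f x) * (g y - g x)) * rep k x"
  let ?s = "\<lambda>p q z. (\<lambda>(x, y). \<mu> x y * ((p y - p x) * (q y - q x))) z"
  note E = f[THEN DQ_energy] g[THEN DQ_energy] k[THEN DQ_energy]
    DQ_mult[OF f k, THEN DQ_energy] DQ_mult[OF g k, THEN DQ_energy] DQ_mult[OF f g, THEN DQ_energy]
  note s = form_sum(2)[OF E(2) E(4)] form_sum(2)[OF E(1) E(5)] form_sum(2)[OF E(3) E(6)]
  note i = form_sum(1)[OF E(2) E(4)] form_sum(1)[OF E(1) E(5)] form_sum(1)[OF E(3) E(6)]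
  note F = Gam_pairs(1)[OF E(1,2) l2_bounded_range[OF rep_l2[of k]]]
  have "2 * (form g (\<lambda>x. f x * rep k x) + form f (\<lambda>x. g x * rep k x) - form (rep k) (\<lambda>x. f x * g x))
     = (\<Sum>\<^sub>\<infinity>z. ?s g (\<lambda>x. f x * rep k x) z + ?s f (\<lambda>x. g x * rep k x) z - ?s (rep k) (\<lambda>x. f x * g x) z)"
    unfolding i infsum_diff[OF summable_on_add[OF s(1,2)] s(3)] infsum_add[OF s(1,2)] by simp
  also have "\<dots> = (\<Sum>\<^sub>\<infinity>z. (\<lambda>(x, y). ?F x y) z + (\<lambda>(x, y). ?F y x) z)"
    by (rule infsum_cong) (auto simp: weight_sym algebra_simps)
  also have "\<dots> = (\<Sum>\<^sub>\<infinity>(x, y). ?F x y) + (\<Sum>\<^sub>\<infinity>(x, y). ?F y x)"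
    by (rule infsum_add[OF F summable_swap_pairs[OF F]])
  also have "\<dots> = 2 * (2 * inner (emb (Gam f g)) k)"
    unfolding infsum_swap_pairs[of ?F] inner_Gam[OF E(1,2)] by simp
  finally show ?thesis by simp
qed

text \<open>For a = b the left-hand side is G, an expression in products and generators that can be
  differentiated along orbits; the right-hand side is its meaning in terms of \<Gamma>.\<close>

lemma LapOp_product:
  assumes a: "(a, a') \<in> LapOp" and b: "(b, b') \<in> LapOp" and k: "(k, k') \<in> LapOp"
  shows "inner (mul a b) k' - inner (mul a b') k - inner (mul b a') k = 2 * inner (emb (Gam (rep a) (rep b))) k"
proof -
  note D = LapOp_DQ[OF a] LapOp_DQ[OF b] LapOp_DQ[OF k]
  have 1: "inner (mul a b) k' = - form (rep k) (\<lambda>x. rep a x * rep b x)"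
    using LapOp_form[OF k DQ_mult[OF D(1,2)]] by (simp add: mul_def inner_commute)
  have 2: "inner (mul a b') k = - form (rep b) (\<lambda>x. rep a x * rep k x)"
    using LapOp_form[OF b DQ_mult[OF D(1,3)]]
    by (simp add: mul_commute[of a b'] inner_mul) (simp add: mul_def)
  have 3: "inner (mul b a') k = - form (rep a) (\<lambda>x. rep b x * rep k x)"
    using LapOp_form[OF a DQ_mult[OF D(2,3)]]
    by (simp add: mul_commute[of b a'] inner_mul) (simp add: mul_def)
  show ?thesis using form_product[OF D] unfolding 1 2 3 by simp
qed

subsection \<open>The curvature condition tested against finite energy functions\<close>

lemma finsupp_weighted_summable: "\<phi> \<in> finsupp \<Longrightarrow> (\<lambda>x. m x * \<phi> x * F x) summable_on UNIV"
  unfolding finsupp_def mem_Collect_eq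
  by (rule finite_nonzero_values_imp_summable_on) (erule rev_finite_subset, auto)

text \<open>The pointwise inequality is multiplied by 2m\<phi> and summed; Green's formula moves one
  difference from \<Gamma>(f) to \<phi>.\<close>

lemma CD_test:
  assumes CD: "CD_inf \<mu> m K" and \<phi>: "\<phi> \<in> finsupp" "\<And>x. 0 \<le> \<phi> x"
  shows "2 * K * (\<Sum>\<^sub>\<infinity>x. m x * \<phi> x * Gam f f x) + 2 * (\<Sum>\<^sub>\<infinity>x. m x * \<phi> x * Gam f (Lap f) x)
     \<le> - (1 / 2 * (\<Sum>\<^sub>\<infinity>(x, y). \<mu> x y * ((\<phi> y - \<phi> x) * (Gam f f y - Gam f f x))))"
proof -
  note s = finsupp_weighted_summable[OF \<phi>(1)]
  have "(\<Sum>\<^sub>\<infinity>x. 2 * K * (m x * \<phi> x * Gam f f x) + 2 * (m x * \<phi> x * Gam f (Lap f) x))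
      \<le> (\<Sum>\<^sub>\<infinity>x. m x * \<phi> x * Lap (Gam f f) x)"
  proof (rule infsum_mono)
    fix x
    have "K * Gam f f x \<le> 1 / 2 * Lap (Gam f f) x - Gam f (Lap f) x"
      using CD by (simp add: CD_inf_def grad2_def)
    then have "2 * K * Gam f f x + 2 * Gam f (Lap f) x \<le> Lap (Gam f f) x" by simp
    then have "m x * \<phi> x * (2 * K * Gam f f x + 2 * Gam f (Lap f) x) \<le> m x * \<phi> x * Lap (Gam f f) x"
      by (rule mult_left_mono) (simp add: measure_nonneg \<phi>)
    then show "2 * K * (m x * \<phi> x * Gam f f x) + 2 * (m x * \<phi> x * Gam f (Lap f) x) \<le> m x * \<phi> x * Lap (Gam f f) x"
      by (simp add: algebra_simps)
  qed (intro summable_on_add summable_on_cmult_right s)+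
  then show ?thesis
    unfolding infsum_add[OF summable_on_cmult_right[OF s] summable_on_cmult_right[OF s]]
      infsum_cmult_right[OF s] green_finsupp(1)[OF \<phi>(1)] .
qed

text \<open>
  A Caccioppoli estimate: the curvature inequality is tested against \<open>\<eta>\<^sup>2 u\<close>
  with \<open>u\<close> the squared gradient, which bounds the energy of \<open>\<eta> u\<close> uniformly in the cutoff.
\<close>

lemma Gam_DQ:
  assumes CD: "CD_inf \<mu> m K" and f: "f \<in> DQ" "Lap f \<in> DQ"
  shows "Gam f f \<in> DQ"
proof -
  note E = f[THEN DQ_energy]
  let ?u = "Gam f f" and ?v = "Gam f (Lap f)"
  note u_l2 = Gam_l2[OF E(1) E(1)] and v_l2 = Gam_l2[OF E]
  note u0 = Gam_nonneg[of f]
  note mu = Gam_summable[OF E(1)]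
  obtain B1 B2 where B: "0 \<le> B1" "\<And>x. \<bar>?u x\<bar> \<le> B1" "0 \<le> B2" "\<And>x. \<bar>?v x\<bar> \<le> B2"
    using l2_bound_exists[OF u_l2] l2_bound_exists[OF v_l2] by blast
  let ?B = "2 * \<bar>K\<bar> * B1 + 2 * B2"
  let ?C = "2 * ?B * (\<Sum>\<^sub>\<infinity>x. m x * ?u x) + 2 * (norm (emb ?u))\<^sup>2"
  have bound: "(norm (dif (\<lambda>x. \<eta> k x * ?u x)))\<^sup>2 \<le> ?C" for k
  proof -
    let ?\<phi> = "\<lambda>x. (\<eta> k x)\<^sup>2 * ?u x"
    let ?\<psi> = "\<lambda>x. \<eta> k x * ?u x"
    have \<phi>: "?\<phi> \<in> finsupp" "\<And>x. 0 \<le> ?\<phi> x" "\<And>x. ?\<phi> x \<le> ?u x"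
    proof -
      show "?\<phi> \<in> finsupp" using finsupp_mult[OF \<eta>_finsupp[of k], of "\<lambda>x. \<eta> k x * ?u x"]
        by (simp add: power2_eq_square mult.assoc)
      show "0 \<le> ?\<phi> x" for x using u0[of x] by simp
      show "?\<phi> x \<le> ?u x" for x
        using u0[of x] \<eta>_nonneg[of k x] \<eta>_le_1[of k x] by (intro mult_left_le_one_le power_le_one) auto
    qed
    note s = finsupp_weighted_summable[OF \<phi>(1)]
    let ?T1 = "\<lambda>(x, y). \<mu> x y * ((?\<phi> y - ?\<phi> x) * (?u y - ?u x))"
    let ?T2 = "\<lambda>x y. \<mu> x y * ((\<eta> k y - \<eta> k x)\<^sup>2 * (?u x)\<^sup>2)"
    have "- (2 * K * (\<Sum>\<^sub>\<infinity>x. m x * ?\<phi> x * ?u x) + 2 * (\<Sum>\<^sub>\<infinity>x. m x * ?\<phi> x * ?v x))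
        = (\<Sum>\<^sub>\<infinity>x. - (2 * K * (m x * ?\<phi> x * ?u x) + 2 * (m x * ?\<phi> x * ?v x)))"
      unfolding infsum_uminus infsum_add[OF summable_on_cmult_right[OF s] summable_on_cmult_right[OF s]]
        infsum_cmult_right[OF s] ..
    also have "\<dots> \<le> (\<Sum>\<^sub>\<infinity>x. ?B * (m x * ?u x))"
    proof (rule infsum_mono)
      show "(\<lambda>x. ?B * (m x * ?u x)) summable_on UNIV" by (rule summable_on_cmult_right[OF mu])
      show "(\<lambda>x. - (2 * K * (m x * ?\<phi> x * ?u x) + 2 * (m x * ?\<phi> x * ?v x))) summable_on UNIV"
        by (intro summable_on_add summable_on_cmult_right s summable_on_uminus[THEN iffD2] | simp)+
      fix x
      have "- (2 * K * ?u x + 2 * ?v x) \<le> 2 * (\<bar>K\<bar> * \<bar>?u x\<bar>) + 2 * \<bar>?v x\<bar>"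
        using abs_ge_minus_self[of "K * ?u x"] abs_ge_minus_self[of "?v x"] by (simp add: abs_mult)
      also have "\<dots> \<le> ?B"
        using mult_left_mono[OF B(2)[of x] abs_ge_zero[of K]] B(4)[of x] by simp
      finally have "(m x * ?\<phi> x) * - (2 * K * ?u x + 2 * ?v x) \<le> (m x * ?\<phi> x) * ?B"
        by (rule mult_left_mono) (simp only: mult_nonneg_nonneg measure_nonneg \<phi>)
      also have "\<dots> \<le> (m x * ?u x) * ?B"
        using B by (intro mult_right_mono mult_left_mono \<phi> measure_nonneg) simp
      finally show "- (2 * K * (m x * ?\<phi> x * ?u x) + 2 * (m x * ?\<phi> x * ?v x)) \<le> ?B * (m x * ?u x)"
        by (simp add: algebra_simps)
    qed
    also have "\<dots> = ?B * (\<Sum>\<^sub>\<infinity>x. m x * ?u x)" by (rule infsum_cmult_right[OF mu])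
    \<comment> \<open>The factor 2 cancels the 1/2 of Green's formula. The zeroth-order terms are
      estimated by sup bounds on \<Gamma>(f) and \<Gamma>(f,\<triangle>f) times the l1 norm of
      \<Gamma>(f).\<close>
    finally have T1: "(\<Sum>\<^sub>\<infinity>z. ?T1 z) \<le> 2 * ?B * (\<Sum>\<^sub>\<infinity>x. m x * ?u x)"
      using CD_test[OF CD \<phi>(1,2), of f] by linarith
    note T2 = cutoff_cross[OF u_l2, of k]
    have T1s: "?T1 summable_on UNIV" by (rule finsupp_pair_summable[OF \<phi>(1)]) (simp only: diff_self mult_zero_left)
    have "(norm (dif ?\<psi>))\<^sup>2 \<le> (\<Sum>\<^sub>\<infinity>z. ?T1 z + 1 / 2 * ((\<lambda>(x, y). ?T2 x y) z + (\<lambda>(x, y). ?T2 y x) z))"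
      unfolding norm_ell2_square
    proof (rule infsum_mono[OF coord_summable])
      show "(\<lambda>z. ?T1 z + 1 / 2 * ((\<lambda>(x, y). ?T2 x y) z + (\<lambda>(x, y). ?T2 y x) z)) summable_on UNIV"
        by (intro summable_on_add summable_on_cmult_right T1s T2(1) summable_swap_pairs[OF T2(1)])
      fix z :: "'v \<times> 'v"
      obtain x y where z: "z = (x, y)" by (cases z)
      have "?u x * ?u y \<le> 1 / 2 * ((?u x)\<^sup>2 + (?u y)\<^sup>2)"
        using sum_squares_bound[of "?u x" "?u y"] by simp
      then have "(\<eta> k y - \<eta> k x)\<^sup>2 * (?u x * ?u y) \<le> (\<eta> k y - \<eta> k x)\<^sup>2 * (1 / 2 * ((?u x)\<^sup>2 + (?u y)\<^sup>2))"
        by (rule mult_left_mono) simp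
      \<comment> \<open>The discrete Caccioppoli identity: the energy of \<eta>u splits into the
        tested term with \<eta>^2 u and a cutoff error with mixed factor u(x)u(y), which is
        symmetrised so that \<open>cutoff_cross\<close> applies.\<close>
      moreover have "(?\<psi> y - ?\<psi> x)\<^sup>2 = (?\<phi> y - ?\<phi> x) * (?u y - ?u x) + (\<eta> k y - \<eta> k x)\<^sup>2 * (?u x * ?u y)"
        by (simp add: power2_eq_square algebra_simps)
      ultimately have "(?\<psi> y - ?\<psi> x)\<^sup>2 \<le> (?\<phi> y - ?\<phi> x) * (?u y - ?u x) +
          (\<eta> k y - \<eta> k x)\<^sup>2 * (1 / 2 * ((?u x)\<^sup>2 + (?u y)\<^sup>2))" by simp
      from mult_left_mono[OF this weight_nonneg[of x y]]
      show "(coord (dif ?\<psi>) z)\<^sup>2 \<le> ?T1 z + 1 / 2 * ((\<lambda>(x, y). ?T2 x y) z + (\<lambda>(x, y). ?T2 y x) z)"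
        unfolding z case_prod_conv coord_dif[OF DQ_energy[OF finsupp_DQ[OF cutoff_finsupp]]] sqrt_weight_square
        by (simp add: weight_sym[of y x] power2_commute[of "\<eta> k x" "\<eta> k y"] algebra_simps)
    qed
    also have "\<dots> = (\<Sum>\<^sub>\<infinity>z. ?T1 z) + 1 / 2 * ((\<Sum>\<^sub>\<infinity>(x, y). ?T2 x y) + (\<Sum>\<^sub>\<infinity>(x, y). ?T2 y x))"
    proof -
      note sa = summable_on_add[OF T2(1) summable_swap_pairs[OF T2(1)]]
      show ?thesis
        unfolding infsum_add[OF T1s summable_on_cmult_right[OF sa]] infsum_cmult_right[OF sa]
          infsum_add[OF T2(1) summable_swap_pairs[OF T2(1)]] ..
    qed
    also have "\<dots> = (\<Sum>\<^sub>\<infinity>z. ?T1 z) + (\<Sum>\<^sub>\<infinity>(x, y). ?T2 x y)"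
      unfolding infsum_swap_pairs[of ?T2] by simp
    also have "\<dots> \<le> 2 * ?B * (\<Sum>\<^sub>\<infinity>x. m x * ?u x) + 2 / Suc k * (norm (emb ?u))\<^sup>2"
      by (rule add_mono[OF T1 T2(2)])
    also have "2 / Suc k * (norm (emb ?u))\<^sup>2 \<le> 2 * (norm (emb ?u))\<^sup>2"
      by (intro mult_right_mono) (auto simp: divide_le_eq)
    finally show ?thesis by simp
  qed
  \<comment> \<open>A Fatou argument: on a finite set of pairs the cutoffs converge to 1, so each
    partial sum inherits the uniform bound.\<close>
  have "finite_energy ?u"
    unfolding finite_energy_def
  proof (rule nonneg_bounded_partial_sums_imp_summable_on)
    show "0 \<le> (case z of (x, y) \<Rightarrow> \<mu> x y * (?u y - ?u x)\<^sup>2)" for z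
      using weight_nonneg by (simp add: case_prod_unfold)
    show "\<forall>\<^sub>F F in finite_subsets_at_top UNIV. (\<Sum>(x, y)\<in>F. \<mu> x y * (?u y - ?u x)\<^sup>2) \<le> ?C"
    proof (rule eventually_finite_subsets_at_top_weakI)
      fix F :: "('v \<times> 'v) set" assume F: "finite F"
      show "(\<Sum>(x, y)\<in>F. \<mu> x y * (?u y - ?u x)\<^sup>2) \<le> ?C"
      proof (rule LIMSEQ_le_const2)
        have "(\<lambda>k. \<Sum>z\<in>F. \<mu> (fst z) (snd z) * (\<eta> k (snd z) * ?u (snd z) - \<eta> k (fst z) * ?u (fst z))\<^sup>2)
           \<longlonglongrightarrow> (\<Sum>z\<in>F. \<mu> (fst z) (snd z) * (1 * ?u (snd z) - 1 * ?u (fst z))\<^sup>2)"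
          by (intro tendsto_intros \<eta>_lim)
        then show "(\<lambda>k. \<Sum>z\<in>F. \<mu> (fst z) (snd z) * (\<eta> k (snd z) * ?u (snd z) - \<eta> k (fst z) * ?u (fst z))\<^sup>2)
           \<longlonglongrightarrow> (\<Sum>(x, y)\<in>F. \<mu> x y * (?u y - ?u x)\<^sup>2)" by (simp add: case_prod_unfold)
        have "(\<Sum>z\<in>F. \<mu> (fst z) (snd z) * (\<eta> k (snd z) * ?u (snd z) - \<eta> k (fst z) * ?u (fst z))\<^sup>2) \<le> ?C" for k
        proof -
          have "(\<Sum>z\<in>F. \<mu> (fst z) (snd z) * (\<eta> k (snd z) * ?u (snd z) - \<eta> k (fst z) * ?u (fst z))\<^sup>2)
              = (\<Sum>z\<in>F. (coord (dif (\<lambda>x. \<eta> k x * ?u x)) z)\<^sup>2)"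
            by (rule sum.cong)
               (auto simp: coord_dif[OF DQ_energy[OF finsupp_DQ[OF cutoff_finsupp]]] sqrt_weight_square)
          also have "\<dots> \<le> ?C" using sum_coord_le_norm[OF F] bound[of k] by (rule order_trans)
          finally show ?thesis .
        qed
        then show "\<exists>N. \<forall>k\<ge>N. (\<Sum>z\<in>F. \<mu> (fst z) (snd z) *
            (\<eta> k (snd z) * ?u (snd z) - \<eta> k (fst z) * ?u (fst z))\<^sup>2) \<le> ?C" by blast
      qed
    qed
  qed
  then show ?thesis using u_l2 by (simp add: DQ_def)
qed

text \<open>The test function is cut off and the cutoff removed. The left side passes to the limit
  in l2; the right side needs convergence of gradients, and there \<open>Gam_DQ\<close>
  enters.\<close>

lemma CD_weak:
  assumes CD: "CD_inf \<mu> m K" and f: "f \<in> DQ" "Lap f \<in> DQ"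
    and h: "h \<in> DQ" "\<And>x. 0 \<le> h x"
  shows "2 * K * inner (emb (Gam f f)) (emb h) + 2 * inner (emb (Gam f (Lap f))) (emb h) \<le> - form (Gam f f) h"
proof -
  let ?u = "Gam f f" and ?v = "Gam f (Lap f)"
  note E = f[THEN DQ_energy]
  note u = Gam_DQ[OF CD f] and v = Gam_l2[OF E]
  let ?h = "\<lambda>k x. \<eta> k x * h x"
  have ineq: "2 * K * inner (emb ?u) (emb (?h k)) + 2 * inner (emb ?v) (emb (?h k)) \<le> - form ?u (?h k)" for k
  proof -
    note hf = cutoff_finsupp[of k h]
    have "inner (emb w) (emb (?h k)) = (\<Sum>\<^sub>\<infinity>x. m x * ?h k x * w x)" if "w \<in> l2 m" for w
      unfolding inner_emb[OF that finsupp_l2[OF hf]] l2_inner_def by (simp only: mult_ac)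
    moreover have "form ?u (?h k) = 1 / 2 * (\<Sum>\<^sub>\<infinity>(x, y). \<mu> x y * ((?h k y - ?h k x) * (?u y - ?u x)))"
      unfolding form_commute[of ?u] by (rule form_sum(1)[OF DQ_energy[OF finsupp_DQ[OF hf]] DQ_energy[OF u]])
    ultimately show ?thesis
      using CD_test[OF CD hf, of f] h(2) \<eta>_nonneg DQ_l2[OF u] v by simp
  qed
  show ?thesis
  proof (rule LIMSEQ_le)
    show "(\<lambda>k. 2 * K * inner (emb ?u) (emb (?h k)) + 2 * inner (emb ?v) (emb (?h k)))
       \<longlonglongrightarrow> 2 * K * inner (emb ?u) (emb h) + 2 * inner (emb ?v) (emb h)"
      by (intro tendsto_intros cutoff_l2_tendsto DQ_l2 h)
    show "(\<lambda>k. - form ?u (?h k)) \<longlonglongrightarrow> - form ?u h"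
      unfolding form_def by (intro tendsto_intros cutoff_dif_tendsto h) simp
  qed (use ineq in blast)
qed

subsection \<open>From the curvature condition to the local Poincare inequality\<close>

lemma mul_minus: "mul (- a) b = - mul a b" "mul a (- b) = - mul a b"
  by (simp_all add: bounded_bilinear.minus_left[OF bounded_bilinear_mul]
      bounded_bilinear.minus_right[OF bounded_bilinear_mul])

text \<open>The right-hand side is the derivative of \<open>G\<close> at a point, the left-hand side is \<open>2 K G\<close>.\<close>

lemma CD_operator:
  assumes CD: "CD_inf \<mu> m K"
    and a: "(a0, a1) \<in> LapOp" "(a1, a2) \<in> LapOp"
    and k: "(k0, k1) \<in> LapOp" "(k1, k2) \<in> LapOp" "\<And>x. 0 \<le> rep k0 x"
  shows "2 * K * (inner (mul a0 a0) k1 - 2 * inner (mul a0 a1) k0) \<le>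
     inner (mul a0 a0) k2 - 4 * inner (mul a0 a1) k1 + 2 * inner (mul a1 a1) k0 + 2 * inner (mul a0 a2) k0"
proof -
  note r = LapOp_rep[OF a(1), symmetric]
  let ?u = "Gam (rep a0) (rep a0)" and ?v = "Gam (rep a0) (rep a1)"
  note D = LapOp_DQ[OF a(1)] LapOp_DQ[OF a(2)] LapOp_DQ[OF k(1)]
  have u: "?u \<in> DQ" using Gam_DQ[OF CD D(1)] D(2) unfolding r .
  have 1: "inner (mul a0 a0) k1 - 2 * inner (mul a0 a1) k0 = 2 * inner (emb ?u) k0"
    using LapOp_product[OF a(1) a(1) k(1)] by simp
  have 2: "inner (mul a0 a0) k2 - 2 * inner (mul a0 a1) k1 = 2 * inner (emb ?u) k1"
    using LapOp_product[OF a(1) a(1) k(2)] by simp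
  have 3: "inner (mul a0 a1) k1 - inner (mul a0 a2) k0 - inner (mul a1 a1) k0 = 2 * inner (emb ?v) k0"
    using LapOp_product[OF a(1) a(2) k(1)] by simp
  \<comment> \<open>Here \<Gamma>(g) has to lie in the form domain: it serves as a test function in
    the weak equation for \<open>k0\<close>.\<close>
  have 4: "inner (emb ?u) k1 = - form ?u (rep k0)"
    using LapOp_form[OF k(1) u] by (simp add: inner_commute form_commute)
  have "2 * K * inner (emb ?u) k0 + 2 * inner (emb ?v) k0 \<le> - form ?u (rep k0)"
    using CD_weak[OF CD D(1) _ D(3) k(3)] D(2) unfolding r by (simp add: emb_rep)
  then show ?thesis using 2 3 4 unfolding 1 by simp
qed

lemma local_poincare:
  assumes CD: "CD_inf \<mu> m K" and f: "f \<in> finsupp" and t: "0 \<le> t"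
  shows "heat t (\<lambda>y. (f y)\<^sup>2) x - (heat t f x)\<^sup>2 \<le> curvature_factor K t * heat t (Gam f f) x"
proof -
  define a0 a1 a2 d0 d1 d2 where "a0 = emb f" and "a1 = emb (Lap f)" and "a2 = emb (Lap (Lap f))"
    and "d0 = emb (dirac x)" and "d1 = emb (Lap (dirac x))" and "d2 = emb (Lap (Lap (dirac x)))"
  have a: "(a0, a1) \<in> LapOp" "(a1, a2) \<in> LapOp" and d: "(d0, d1) \<in> LapOp" "(d1, d2) \<in> LapOp"
    unfolding a0_def a1_def a2_def d0_def d1_def d2_def
    by (intro finsupp_LapOp finsupp_Lap f dirac_finsupp)+
  define A0 A1 A2 K0 K1 K2 where "A0 = (\<lambda>s. U (t - s) a0)" and "A1 = (\<lambda>s. U (t - s) a1)"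
    and "A2 = (\<lambda>s. U (t - s) a2)" and "K0 = (\<lambda>s. U s d0)" and "K1 = (\<lambda>s. U s d1)" and "K2 = (\<lambda>s. U s d2)"
  note defs = A0_def A1_def A2_def K0_def K1_def K2_def
  let ?I = "{0..t}"
  \<comment> \<open>The \<open>A\<close> orbits run backwards in time, hence the minus signs. Two
    derivatives are available because \<open>f\<close>, the point mass and their Laplacians all have
    finite support.\<close>
  have dA: "(A0 has_vector_derivative - A1 s) (at s within ?I)" "(A1 has_vector_derivative - A2 s) (at s within ?I)"
   and dK: "(K0 has_vector_derivative K1 s) (at s within ?I)" "(K1 has_vector_derivative K2 s) (at s within ?I)"
   if s: "s \<in> ?I" for s
    unfolding defs using U_derivative_reverse[OF a(1) s] U_derivative_reverse[OF a(2) s]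
      U_derivative'[OF d(1) s] U_derivative'[OF d(2) s] by auto
  define \<phi> G G' where "\<phi> = (\<lambda>s. inner (mul (A0 s) (A0 s)) (K0 s))"
    and "G = (\<lambda>s. inner (mul (A0 s) (A0 s)) (K1 s) - 2 * inner (mul (A0 s) (A1 s)) (K0 s))"
    and "G' = (\<lambda>s. inner (mul (A0 s) (A0 s)) (K2 s) - 4 * inner (mul (A0 s) (A1 s)) (K1 s)
        + 2 * inner (mul (A1 s) (A1 s)) (K0 s) + 2 * inner (mul (A0 s) (A2 s)) (K0 s))"
  note mul_der = bounded_bilinear.has_vector_derivative[OF bounded_bilinear_mul]
  note inner_der = bounded_bilinear.has_vector_derivative[OF bounded_bilinear_inner]
  have d\<phi>: "(\<phi> has_vector_derivative G s) (at s within ?I)" if s: "s \<in> ?I" for s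
  proof -
    note D = dA[OF s] dK[OF s]
    show ?thesis unfolding \<phi>_def
      by (rule has_vector_derivative_eq_rhs[OF inner_der[OF mul_der[OF D(1) D(1)] D(3)]])
         (simp add: G_def mul_minus mul_commute[of "A1 s"] inner_diff_left)
  qed
  have dG: "(G has_vector_derivative G' s) (at s within ?I)" if s: "s \<in> ?I" for s
  proof -
    note D = dA[OF s] dK[OF s]
    note D1 = inner_der[OF mul_der[OF D(1) D(1)] D(4)]
    note D2 = inner_der[OF mul_der[OF D(1) D(2)] D(3)]
    show ?thesis unfolding G_def
      by (rule has_vector_derivative_eq_rhs[OF has_vector_derivative_diff[OF D1
            bounded_linear.has_vector_derivative[OF bounded_linear_mult_right D2]]])
         (simp add: G'_def mul_minus mul_commute[of "A1 s" "A0 s"] inner_diff_left)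
  qed
  have GG': "2 * K * G s \<le> G' s" if s: "s \<in> ?I" for s
    unfolding G_def G'_def
  proof (rule CD_operator[OF CD])
    show "(A0 s, A1 s) \<in> LapOp" "(A1 s, A2 s) \<in> LapOp" "(K0 s, K1 s) \<in> LapOp" "(K1 s, K2 s) \<in> LapOp"
      unfolding defs using U_LapOp a d s by auto
    show "0 \<le> rep (K0 s) y" for y
      unfolding defs d0_def using s by (intro U_nonneg dirac_finsupp) (auto simp: dirac_def)
  qed
  have G_le: "G s \<le> exp (- 2 * K * (t - s)) * G t" if s: "s \<in> ?I" for s
  proof -
    \<comment> \<open>Gronwall with the integrating factor exp (-2Kr): the product with G is
      nondecreasing on [s,t].\<close>
    have "exp (- 2 * K * s) * G s \<le> exp (- 2 * K * t) * G t"
    proof (rule nonneg_derivative_le[where \<phi> = "\<lambda>r. exp (- 2 * K * r) * G r" and \<phi>' = "\<lambda>r. exp (- 2 * K * r) * (G' r - 2 * K * G r)"])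
      show "s \<le> t" using s by simp
      fix r assume r: "r \<in> {s..t}"
      then have r': "r \<in> ?I" using s by simp
      have e: "((\<lambda>r. exp (- 2 * K * r)) has_real_derivative exp (- 2 * K * r) * (- 2 * K)) (at r within {s..t})"
        by (auto intro!: derivative_eq_intros)
      have g: "(G has_real_derivative G' r) (at r within {s..t})"
        unfolding has_real_derivative_iff_has_vector_derivative
        by (rule has_vector_derivative_within_subset[OF dG[OF r']]) (use s in auto)
      show "((\<lambda>r. exp (- 2 * K * r) * G r) has_vector_derivative exp (- 2 * K * r) * (G' r - 2 * K * G r))
          (at r within {s..t})"
        unfolding has_real_derivative_iff_has_vector_derivative[symmetric]
        by (rule DERIV_cong[OF DERIV_mult[OF e g]]) (simp add: algebra_simps)
      show "0 \<le> exp (- 2 * K * r) * (G' r - 2 * K * G r)" using GG'[OF r'] by simp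
    qed
    then have "exp (2 * K * s) * (exp (- 2 * K * s) * G s) \<le> exp (2 * K * s) * (exp (- 2 * K * t) * G t)"
      by (rule mult_left_mono) simp
    then show ?thesis
      unfolding mult.assoc[symmetric] exp_add[symmetric] by (simp add: algebra_simps)
  qed
  \<comment> \<open>An antiderivative of exp (-2K(t-s)); its increment over [0,t] is half the
    curvature factor, also for K = 0.\<close>
  define c where "c = (\<lambda>s. if K = 0 then s else exp (- 2 * K * (t - s)) / (2 * K))"
  have dc: "(c has_vector_derivative exp (- 2 * K * (t - s))) (at s within ?I)" for s
    unfolding c_def has_real_derivative_iff_has_vector_derivative[symmetric]
    by (cases "K = 0") (auto intro!: derivative_eq_intros)
  have "c 0 * G t - \<phi> 0 \<le> c t * G t - \<phi> t"
  proof (rule nonneg_derivative_le[OF t, where \<phi> = "\<lambda>s. c s * G t - \<phi> s" and \<phi>' = "\<lambda>s. exp (- 2 * K * (t - s)) * G t - G s"])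
    fix s assume s: "s \<in> ?I"
    show "((\<lambda>s. c s * G t - \<phi> s) has_vector_derivative exp (- 2 * K * (t - s)) * G t - G s) (at s within ?I)"
      by (intro has_vector_derivative_diff d\<phi>[OF s] bounded_linear.has_vector_derivative[OF bounded_linear_mult_left dc])
    show "0 \<le> exp (- 2 * K * (t - s)) * G t - G s" using G_le[OF s] by simp
  qed
  then have main: "\<phi> t - \<phi> 0 \<le> (c t - c 0) * G t" by (simp add: algebra_simps)
  have c2: "c t - c 0 = curvature_factor K t / 2"
    by (simp add: c_def curvature_factor_def field_simps)
  note fl = finsupp_l2[OF f]
  have G_t: "G t = 2 * (m x * heat t (Gam f f) x)"
  proof -
    have "G t = 2 * inner (emb (Gam (rep a0) (rep a0))) (K0 t)"
      using LapOp_product[OF a(1) a(1), of "K0 t" "K1 t"] U_LapOp[OF d(1) t] by (simp add: G_def defs)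
    also have "\<dots> = 2 * inner (U t (emb (Gam f f))) d0"
      by (simp add: a0_def rep_emb fl K0_def U_symmetric t)
    finally show ?thesis
      by (simp add: d0_def inner_dirac heat_eq t finsupp_l2 finsupp_Gam f)
  qed
  have \<phi>_t: "\<phi> t = m x * heat t (\<lambda>y. (f y)\<^sup>2) x"
  proof -
    have "mul a0 a0 = emb (\<lambda>y. (f y)\<^sup>2)" by (simp add: mul_def a0_def rep_emb fl power2_eq_square)
    moreover have "(\<lambda>y. (f y)\<^sup>2) \<in> l2 m" using l2_mult[OF fl fl] by (simp add: power2_eq_square)
    moreover have "\<phi> t = inner (U t (mul a0 a0)) d0" by (simp add: \<phi>_def defs U_symmetric t)
    ultimately show ?thesis by (simp add: d0_def inner_dirac heat_eq t)
  qed
  have \<phi>_0: "\<phi> 0 = m x * (heat t f x)\<^sup>2"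
    by (simp add: \<phi>_def defs d0_def inner_dirac rep_mul heat_eq t fl power2_eq_square a0_def)
  have "m x * (heat t (\<lambda>y. (f y)\<^sup>2) x - (heat t f x)\<^sup>2) \<le> m x * (curvature_factor K t * heat t (Gam f f) x)"
    using main unfolding c2 G_t \<phi>_t \<phi>_0 by (simp add: algebra_simps)
  then show ?thesis using m_pos[of x] by simp
qed

end

text \<open>If L < 0, then \<Phi>'(h) < (L/2) h for small h > 0, and integration gives \<Phi>(h)
  \<le> (L/4) h^2 < 0.\<close>

lemma second_derivative_nonneg:
  fixes \<Phi> \<Phi>' :: "real \<Rightarrow> real"
  assumes d1: "\<And>t. 0 \<le> t \<Longrightarrow> (\<Phi> has_real_derivative \<Phi>' t) (at t within {0..})"
    and d2: "(\<Phi>' has_real_derivative L) (at 0 within {0..})"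
    and zero: "\<Phi> 0 = 0" "\<Phi>' 0 = 0" and nonneg: "\<And>t. 0 \<le> t \<Longrightarrow> 0 \<le> \<Phi> t"
  shows "0 \<le> L"
proof (rule ccontr)
  assume "\<not> 0 \<le> L"
  then have L: "L < 0" by simp
  have "((\<lambda>h. \<Phi>' h - L / 2 * h) has_real_derivative L - L / 2) (at 0 within {0..})"
    by (auto intro!: derivative_eq_intros d2)
  then obtain d where d: "d > 0" "\<And>h. 0 < h \<Longrightarrow> h < d \<Longrightarrow> \<Phi>' h - L / 2 * h < 0"
    using has_real_derivative_neg_dec_right[of "\<lambda>h. \<Phi>' h - L / 2 * h" "L - L / 2" 0 "{0..}"] L zero by auto
  let ?b = "d / 2"
  have "L / 4 * 0\<^sup>2 - \<Phi> 0 \<le> L / 4 * ?b\<^sup>2 - \<Phi> ?b"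
  proof (rule nonneg_derivative_le[where \<phi> = "\<lambda>t. L / 4 * t\<^sup>2 - \<Phi> t" and \<phi>' = "\<lambda>t. L / 2 * t - \<Phi>' t"])
    fix s assume s: "s \<in> {0..?b}"
    have "(\<Phi> has_real_derivative \<Phi>' s) (at s within {0..?b})"
      by (rule DERIV_subset[OF d1]) (use s in auto)
    then show "((\<lambda>t. L / 4 * t\<^sup>2 - \<Phi> t) has_vector_derivative L / 2 * s - \<Phi>' s) (at s within {0..?b})"
      unfolding has_real_derivative_iff_has_vector_derivative[symmetric]
      by (auto intro!: derivative_eq_intros)
    show "0 \<le> L / 2 * s - \<Phi>' s"
      using d(2)[of s] s d(1) zero by (cases "s = 0") auto
  qed (use d in simp)
  moreover have "L / 4 * ?b\<^sup>2 < 0" using L d by (intro mult_neg_pos) auto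
  ultimately show False using zero nonneg[of ?b] d(1) by simp
qed

context cutoff_graph
begin

subsection \<open>Extension to the form domain\<close>

text \<open>Written this way, the pairing of \<Gamma>(f,g) with \<open>k\<close> is a bounded
  bilinear expression in the gradients, hence continuous under convergence in energy.\<close>

lemma inner_Gam_dif:
  assumes "finite_energy f" "finite_energy g"
  shows "2 * inner (emb (Gam f g)) k = inner (dif f) (ell2_mult (\<lambda>(x, y). rep k x) (dif g))"
proof -
  have "bounded (range (\<lambda>(x, y). rep k x))"
    using l2_bounded_range[OF rep_l2[of k]] by (auto simp: bounded_iff)
  note c = coord_ell2_mult[OF this]
  show ?thesis
    unfolding inner_Gam[OF assms] unfolding inner_ell2_def
    by (rule infsum_cong) (auto simp: c coord_dif assms weight_nonneg mult_ac real_sqrt_mult_self)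
qed

lemma poincare_form_domain:
  assumes P: "\<And>f. f \<in> finsupp \<Longrightarrow>
      heat t (\<lambda>y. (f y)\<^sup>2) x - (heat t f x)\<^sup>2 \<le> C * heat t (Gam f f) x"
    and f: "f \<in> DQ" and t: "0 \<le> t"
  shows "heat t (\<lambda>y. (f y)\<^sup>2) x - (heat t f x)\<^sup>2 \<le> C * heat t (Gam f f) x"
proof -
  let ?f = "\<lambda>n x. \<eta> n x * f x"
  let ?k = "U t (emb (dirac x))"
  let ?M = "ell2_mult (\<lambda>(x, y :: 'v). rep ?k x)"
  have sq: "heat t (\<lambda>y. (g y)\<^sup>2) x = rep (U t (mul (emb g) (emb g))) x" if g: "g \<in> DQ" for g
  proof -
    have "(\<lambda>y. (g y)\<^sup>2) \<in> l2 m" using l2_mult[OF DQ_l2[OF g] DQ_l2[OF g]] by (simp add: power2_eq_square)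
    then show ?thesis by (simp add: heat_eq t mul_def rep_emb DQ_l2 g power2_eq_square)
  qed
  \<comment> \<open>By symmetry the semigroup is moved to the point mass. Its image
    \<open>?k\<close> does not depend on \<open>g\<close>, and what remains is quadratic in the
    gradient of \<open>g\<close>.\<close>
  have gam: "heat t (Gam g g) x = inner (dif g) (?M (dif g)) / (2 * m x)" if g: "g \<in> DQ" for g
  proof -
    note E = DQ_energy[OF g]
    have "m x * heat t (Gam g g) x = inner (U t (emb (Gam g g))) (emb (dirac x))"
      by (simp add: heat_eq t Gam_l2 E inner_dirac)
    also have "\<dots> = inner (emb (Gam g g)) ?k" by (rule U_symmetric[OF t])
    finally have "2 * (m x * heat t (Gam g g) x) = inner (dif g) (?M (dif g))"
      using inner_Gam_dif[OF E E, of ?k] by simp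
    then show ?thesis using m_pos[of x] by (simp add: field_simps)
  qed
  have "bounded (range (\<lambda>(x, y :: 'v). rep ?k x))"
    using l2_bounded_range[OF rep_l2[of ?k]] by (auto simp: bounded_iff)
  note M = bounded_linear.tendsto[OF bounded_linear_ell2_mult[OF this]]
  note UT = bounded_linear.tendsto[OF U.bounded_linear[OF t]]
  have fn: "?f n \<in> DQ" for n by (rule finsupp_DQ[OF cutoff_finsupp])
  note lim = cutoff_l2_tendsto[OF DQ_l2[OF f]] cutoff_dif_tendsto[OF f]
  show ?thesis
  proof (rule LIMSEQ_le)
    have "(\<lambda>n. rep (U t (mul (emb (?f n)) (emb (?f n)))) x - (rep (U t (emb (?f n))) x)\<^sup>2)
       \<longlonglongrightarrow> rep (U t (mul (emb f) (emb f))) x - (rep (U t (emb f)) x)\<^sup>2"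
      by (intro tendsto_diff tendsto_power tendsto_rep UT lim
          bounded_bilinear.tendsto[OF bounded_bilinear_mul])
    then show "(\<lambda>n. heat t (\<lambda>y. (?f n y)\<^sup>2) x - (heat t (?f n) x)\<^sup>2)
       \<longlonglongrightarrow> heat t (\<lambda>y. (f y)\<^sup>2) x - (heat t f x)\<^sup>2"
      unfolding sq[OF f] sq[OF fn] by (simp add: heat_eq t DQ_l2 f fn)
    have "(\<lambda>n. C * (inner (dif (?f n)) (?M (dif (?f n))) / (2 * m x)))
       \<longlonglongrightarrow> C * (inner (dif f) (?M (dif f)) / (2 * m x))"
      using m_pos[of x] by (intro tendsto_intros M lim) auto
    then show "(\<lambda>n. C * heat t (Gam (?f n) (?f n)) x) \<longlonglongrightarrow> C * heat t (Gam f f) x"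
      unfolding gam[OF f] gam[OF fn] .
    show "\<exists>N. \<forall>n\<ge>N. heat t (\<lambda>y. (?f n y)\<^sup>2) x - (heat t (?f n) x)\<^sup>2 \<le> C * heat t (Gam (?f n) (?f n)) x"
      using P[OF cutoff_finsupp] by blast
  qed
qed

subsection \<open>From the local Poincare inequality to the curvature condition\<close>

lemma heat_derivative:
  assumes g: "g \<in> finsupp" and t: "0 \<le> t"
  shows "((\<lambda>s. rep (U s (emb g)) x) has_real_derivative rep (U t (emb (Lap g))) x) (at t within {0..})"
  unfolding has_real_derivative_iff_has_vector_derivative
  by (rule bounded_linear.has_vector_derivative[OF bounded_linear_rep U_derivative[OF finsupp_LapOp[OF g] t]])

lemma Lap_lin: "Lap (\<lambda>z. a * f z + b * g z) x = a * Lap f x + b * Lap g x"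
proof -
  have "(\<Sum>y\<in>N x. \<mu> x y * ((a * f y + b * g y) - (a * f x + b * g x)))
     = a * (\<Sum>y\<in>N x. \<mu> x y * (f y - f x)) + b * (\<Sum>y\<in>N x. \<mu> x y * (g y - g x))"
    unfolding sum_distrib_left sum.distrib[symmetric] by (rule sum.cong) (auto simp: algebra_simps)
  then show ?thesis by (simp add: Lap_eq add_divide_distrib)
qed

lemma curvature_of_poincare_finsupp:
  assumes P: "\<And>t. 0 \<le> t \<Longrightarrow> heat t (\<lambda>y. (f y)\<^sup>2) x - (heat t f x)\<^sup>2 \<le> curvature_factor K t * heat t (Gam f f) x"
    and f: "f \<in> finsupp"
  shows "K * Gam f f x \<le> grad2 \<mu> m f x"
proof -
  let ?g = "Gam f f" and ?q = "\<lambda>y. (f y)\<^sup>2"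
  let ?r = "\<lambda>g s. rep (U s (emb g)) x"
  have q: "?q \<in> finsupp" using finsupp_mult[OF f, of f] by (simp add: power2_eq_square)
  note g = finsupp_Gam[OF f]
  note L = finsupp_Lap
  have at0: "?r h 0 = h x" if "h \<in> finsupp" for h using that by (simp add: rep_emb finsupp_l2)
  define c' where "c' = (\<lambda>t. 2 * exp (- 2 * K * t))"
  have c: "(curvature_factor K has_real_derivative c' t) (at t within {0..})" for t
    unfolding curvature_factor_def[abs_def] c'_def
    by (cases "K = 0") (auto intro!: derivative_eq_intros)
  have dc': "(c' has_real_derivative - 2 * K * c' t) (at t within {0..})" for t
    unfolding c'_def by (auto intro!: derivative_eq_intros)
  have c0: "curvature_factor K 0 = 0" "c' 0 = 2" by (simp_all add: curvature_factor_def c'_def)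
  let ?\<Phi> = "\<lambda>t. curvature_factor K t * ?r ?g t - ?r ?q t + ?r f t * ?r f t"
  let ?\<Phi>' = "\<lambda>t. (c' t * ?r ?g t + ?r (Lap ?g) t * curvature_factor K t) - ?r (Lap ?q) t
      + (?r (Lap f) t * ?r f t + ?r (Lap f) t * ?r f t)"
  \<comment> \<open>This identity makes the first-order terms cancel: the curvature factor has slope
    2 at 0, so \<Phi>'(0) = 2\<Gamma>(f) - \<triangle>(f^2) + 2f\<triangle>f = 0.\<close>
  have Lq: "Lap ?q = (\<lambda>z. 2 * ?g z + 2 * (f z * Lap f z))"
    by (simp add: fun_eq_iff grad_def power2_eq_square diff_divide_distrib)
  have "0 \<le> ((- 2 * K * c' 0 * ?r ?g 0 + ?r (Lap ?g) 0 * c' 0)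
      + (?r (Lap (Lap ?g)) 0 * curvature_factor K 0 + c' 0 * ?r (Lap ?g) 0)) - ?r (Lap (Lap ?q)) 0
      + ((?r (Lap (Lap f)) 0 * ?r f 0 + ?r (Lap f) 0 * ?r (Lap f) 0)
       + (?r (Lap (Lap f)) 0 * ?r f 0 + ?r (Lap f) 0 * ?r (Lap f) 0))"
  proof (rule second_derivative_nonneg[where \<Phi> = ?\<Phi> and \<Phi>' = ?\<Phi>'])
    fix t :: real assume t: "0 \<le> t"
    show "(?\<Phi> has_real_derivative ?\<Phi>' t) (at t within {0..})"
      by (intro DERIV_add DERIV_diff DERIV_mult c heat_derivative g q f t)
    have "?q \<in> l2 m" "?g \<in> l2 m" "f \<in> l2 m" using q g f finsupp_l2 by auto
    then show "0 \<le> ?\<Phi> t" using P[OF t] by (simp add: heat_eq t power2_eq_square)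
  next
    show "(?\<Phi>' has_real_derivative (((- 2 * K * c' 0 * ?r ?g 0 + ?r (Lap ?g) 0 * c' 0)
      + (?r (Lap (Lap ?g)) 0 * curvature_factor K 0 + c' 0 * ?r (Lap ?g) 0)) - ?r (Lap (Lap ?q)) 0
      + ((?r (Lap (Lap f)) 0 * ?r f 0 + ?r (Lap f) 0 * ?r (Lap f) 0)
       + (?r (Lap (Lap f)) 0 * ?r f 0 + ?r (Lap f) 0 * ?r (Lap f) 0)))) (at 0 within {0..})"
      by (intro DERIV_add DERIV_diff DERIV_mult c dc' heat_derivative L g q f order_refl)
    show "?\<Phi> 0 = 0" by (simp only: at0 g q f c0) (simp add: power2_eq_square)
    show "?\<Phi>' 0 = 0" by (simp only: at0 L g q f c0) (simp add: Lq)
  qed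
  \<comment> \<open>The curvature term comes from the second derivative -4K of the curvature factor
    at 0, and 4\<triangle>\<Gamma>(f) from the cross terms of the product with slope 2.\<close>
  then have "0 \<le> - 4 * K * ?g x + 4 * Lap ?g x - Lap (Lap ?q) x + 2 * (Lap f x * Lap f x) + 2 * (Lap (Lap f) x * f x)"
    by (simp only: at0 L g q f c0)
  moreover have "Lap (Lap ?q) x = 2 * Lap ?g x + 2 * Lap (\<lambda>z. f z * Lap f z) x"
    unfolding Lq by (rule Lap_lin)
  moreover have "2 * Gam f (Lap f) x = Lap (\<lambda>z. f z * Lap f z) x - f x * Lap (Lap f) x - Lap f x * Lap f x"
    by (simp add: grad_def)
  ultimately have "0 \<le> - 4 * K * ?g x + 2 * Lap ?g x - 4 * Gam f (Lap f) x" by (simp add: algebra_simps)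
  then show ?thesis by (simp add: grad2_def)
qed

text \<open>\<Gamma>_2 at x consists of nested one-step operators, so it sees only values within two
  steps of x. This reduces arbitrary functions to finitely supported ones.\<close>

lemma grad2_local:
  assumes "\<And>y. y \<in> {x} \<union> N x \<union> (\<Union>y\<in>N x. N y) \<Longrightarrow> f y = g y"
  shows "Gam f f x = Gam g g x" "grad2 \<mu> m f x = grad2 \<mu> m g x"
proof -
  have Lap_cong: "Lap p y = Lap q y" if "p y = q y" "\<And>z. z \<in> N y \<Longrightarrow> p z = q z" for p q y
    unfolding Lap_eq using that by (auto intro!: arg_cong[where f = "\<lambda>s. s / m y"] sum.cong)
  have Gam_cong: "Gam p r y = Gam q s y"
    if "p y = q y" "\<And>z. z \<in> N y \<Longrightarrow> p z = q z" "r y = s y" "\<And>z. z \<in> N y \<Longrightarrow> r z = s z" for p q r s y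
    unfolding Gam_eq using that by (auto intro!: arg_cong[where f = "\<lambda>s. s / (2 * m y)"] sum.cong)
  have near: "f y = g y" "\<And>z. z \<in> N y \<Longrightarrow> f z = g z" if "y = x \<or> y \<in> N x" for y
    using that assms by blast+
  have G: "Gam f f y = Gam g g y" if "y = x \<or> y \<in> N x" for y
    by (rule Gam_cong) (use near[OF that] in auto)
  have L: "Lap f y = Lap g y" if "y = x \<or> y \<in> N x" for y
    by (rule Lap_cong) (use near[OF that] in auto)
  show "Gam f f x = Gam g g x" by (rule G) simp
  have "Lap (Gam f f) x = Lap (Gam g g) x" by (intro Lap_cong G) auto
  moreover have "Gam f (Lap f) x = Gam g (Lap g) x" by (intro Gam_cong L near) auto
  ultimately show "grad2 \<mu> m f x = grad2 \<mu> m g x" by (simp add: grad2_def)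
qed

lemma CD_of_poincare:
  assumes P: "\<And>f t x. f \<in> finsupp \<Longrightarrow> 0 \<le> t \<Longrightarrow>
    heat t (\<lambda>y. (f y)\<^sup>2) x - (heat t f x)\<^sup>2 \<le> curvature_factor K t * heat t (Gam f f) x"
  shows "CD_inf \<mu> m K"
  unfolding CD_inf_def
proof (intro allI)
  fix f :: "'v \<Rightarrow> real" and x
  let ?B = "{x} \<union> N x \<union> (\<Union>y\<in>N x. N y)"
  let ?g = "\<lambda>y. if y \<in> ?B then f y else 0"
  have "finite ?B" using finite_neighbours by auto
  then have g: "?g \<in> finsupp" unfolding finsupp_def mem_Collect_eq by (rule rev_finite_subset) auto
  have "f y = ?g y" if "y \<in> ?B" for y using that by simp
  note eq = grad2_local[of x f ?g, OF this]
  have "K * Gam ?g ?g x \<le> grad2 \<mu> m ?g x"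
    by (rule curvature_of_poincare_finsupp[OF _ g]) (rule P[OF g])
  then show "K * Gam f f x \<le> grad2 \<mu> m f x" by (simp only: eq)
qed

end

section \<open>Cutoff functions on complete graphs\<close>

lemma (in nondegenerate_graph) positive_part_gradient:
  "(\<Sum>y\<in>N x. \<mu> x y * (max 0 (f y) - max 0 (f x))\<^sup>2) \<le> 2 * m x * Gam f f x"
  unfolding Gam_sum power2_eq_square[symmetric]
proof (intro sum_mono mult_left_mono weight_nonneg)
  fix y
  have "\<bar>max 0 (f y) - max 0 (f x)\<bar> \<le> \<bar>f y - f x\<bar>" by (auto simp: max_def abs_if)
  then show "(max 0 (f y) - max 0 (f x))\<^sup>2 \<le> (f y - f x)\<^sup>2" by (simp add: abs_le_square_iff)
qed

text \<open>The given functions are at most 1 because they increase to 1, but they may be negative;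
  the positive part is a 1-Lipschitz change of values and preserves the gradient bound. The index
  shift leaves out k = 0, where no bound is given.\<close>

lemma (in nondegenerate_graph) complete_cutoffs:
  assumes "complete_graph \<mu> m"
  obtains \<eta> where "cutoff_graph E \<mu> m \<delta> \<eta>"
proof -
  obtain \<eta> :: "nat \<Rightarrow> 'v \<Rightarrow> real" where \<eta>: "mono \<eta>" "\<And>k. \<eta> k \<in> finsupp" "\<And>x. (\<lambda>k. \<eta> k x) \<longlonglongrightarrow> 1"
    "\<And>k x. k \<ge> 1 \<Longrightarrow> Gam (\<eta> k) (\<eta> k) x \<le> 1 / real k"
    using assms unfolding complete_graph_def by blast
  have "cutoff_graph E \<mu> m \<delta> (\<lambda>k x. max 0 (\<eta> (Suc k) x))"
  proof unfold_locales
    fix k x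
    have "incseq (\<lambda>k. \<eta> k x)" using \<eta>(1) by (auto simp: mono_def le_fun_def)
    then have "\<eta> (Suc k) x \<le> 1" using incseq_le \<eta>(3) by blast
    then show "max 0 (\<eta> (Suc k) x) \<le> 1" by simp
    have "finite {x. \<eta> (Suc k) x \<noteq> 0}" using \<eta>(2) by (simp add: finsupp_def)
    then show "(\<lambda>x. max 0 (\<eta> (Suc k) x)) \<in> finsupp"
      unfolding finsupp_def mem_Collect_eq by (rule rev_finite_subset) auto
    have "(\<lambda>k. max 0 (\<eta> (Suc k) x)) \<longlonglongrightarrow> max 0 1"
      by (intro tendsto_intros LIMSEQ_Suc \<eta>(3))
    then show "(\<lambda>k. max 0 (\<eta> (Suc k) x)) \<longlonglongrightarrow> 1" by simp
    have "(\<Sum>y\<in>N x. \<mu> x y * (max 0 (\<eta> (Suc k) y) - max 0 (\<eta> (Suc k) x))\<^sup>2)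
        \<le> 2 * m x * Gam (\<eta> (Suc k)) (\<eta> (Suc k)) x"
      by (rule positive_part_gradient)
    also have "\<dots> \<le> 2 * m x * (1 / Suc k)"
      using measure_nonneg[of x] by (intro mult_left_mono \<eta>(4)) auto
    finally show "(\<Sum>y\<in>N x. \<mu> x y * (max 0 (\<eta> (Suc k) y) - max 0 (\<eta> (Suc k) x))\<^sup>2) \<le> 2 * m x / Suc k"
      by simp
  qed simp
  then show ?thesis by (rule that)
qed

theorem theorem3p2:
  fixes E :: "('v \<times> 'v) set" and \<mu> :: "'v \<Rightarrow> 'v \<Rightarrow> real" and m :: "'v \<Rightarrow> real" and K :: real
  assumes "weighted_graph E \<mu> m"
    and "locally_finite E"
    and "complete_graph \<mu> m"
    and "nondegenerate m"
  defines "P \<equiv> heat_semigroup \<mu> m"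
  defines "poincare \<equiv> \<lambda>f :: 'v \<Rightarrow> real. \<forall>t\<ge>0. \<forall>x.
      P t (\<lambda>y. (f y)\<^sup>2) x - (P t f x)\<^sup>2 \<le> curvature_factor K t * P t (grad \<mu> m f f) x"
  shows "(CD_inf \<mu> m K \<longleftrightarrow> (\<forall>f\<in>finsupp. poincare f)) \<and>
         ((\<forall>f\<in>finsupp. poincare f) \<longleftrightarrow> (\<forall>f\<in>form_domain \<mu> m. poincare f))"
proof -
  interpret weighted_graph E \<mu> m by fact
  have "bdd_below (range m)" using measure_nonneg by (intro bdd_belowI2[of _ 0])
  then have "(INF x. m x) \<le> m x" for x by (rule cINF_lower) simp
  \<comment> \<open>The infimum of the measure serves as the uniform lower bound \<delta>.\<close>
  then interpret nondegenerate_graph E \<mu> m "INF x. m x"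
    using assms(2,4) by unfold_locales (auto simp: locally_finite_def nondegenerate_def)
  obtain \<eta> where "cutoff_graph E \<mu> m (INF x. m x) \<eta>" using complete_cutoffs[OF assms(3)] .
  then interpret cutoff_graph E \<mu> m "INF x. m x" \<eta> .
  have "CD_inf \<mu> m K \<Longrightarrow> \<forall>f\<in>finsupp. poincare f"
    using local_poincare unfolding poincare_def P_def by blast
  moreover have "\<forall>f\<in>finsupp. poincare f \<Longrightarrow> CD_inf \<mu> m K"
    using CD_of_poincare unfolding poincare_def P_def by blast
  moreover have "\<forall>f\<in>finsupp. poincare f \<Longrightarrow> \<forall>f\<in>form_domain \<mu> m. poincare f"
    using poincare_form_domain unfolding poincare_def P_def form_domain_eq by blast
  moreover have "\<forall>f\<in>form_domain \<mu> m. poincare f \<Longrightarrow> \<forall>f\<in>finsupp. poincare f"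
    using finsupp_DQ unfolding form_domain_eq by blast
  ultimately show ?thesis by blast
qed

end
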